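(* Let $\ell$ be a field of characteristic $\ne 2$ such that $\ell \in \mathscr{A}_i(2)$ for some integer $i \geq 0$ and $u(\ell) = 2^i$. For each integer $r \geq 1$ let $L_r = \ell(x_1, \ldots, x_r)$ (a purely transcendental extension in independent indeterminates), and for $r \geq 2$ let $V_r$ be the set of non-trivial discrete valuations on $L_r$ that are trivial on $L_{r-1}$. Then for every $r \geq 2$ and every integer $n$ with $0 \leq n < 2^{i+r-2}$, there exists a regular quadratic form of dimension $2^{i+r}-n$ over $L_r$ that violates $\mathrm{LGP}(2^{i+r-2}-n, 1)$ with respect to $V_r$.
   Context: All quadratic forms are regular (nondegenerate). For a quadratic form $q$ over a field $k$ of characteristic $\ne 2$, the Witt index $i_W(q)$ is the unique integer with $q \simeq i_W(q)\mathbb{H} \perp q_{an}$, $q_{an}$ anisotropic, where $\mathbb{H}$ is the hyperbolic plane. The $u$-invariant $u(k)$ is the maximal dimension of an anisotropic quadratic form over $k$ ($\infty$ if no maximum exists). A field $\ell$ of characteristic $\ne 2$ satisfies property $\mathscr{A}_i(2)$ if every system of $s$ quadratic forms over $\ell$ in $n > s\cdot 2^i$ common variables has a non-trivial simultaneous zero in some odd degree extension of $\ell$. For a field $k$ with a non-empty set $V$ of non-trivial discrete valuations, $k_v$ denotes the $v$-adic completion and $q_v = q_{k_v}$. For integers $r,s \geq 1$, a form $q$ over $k$ satisfies $\mathrm{LGP}(r,s)$ with respect to $V$ if ($i_W(q_v) \geq r$ for all $v \in V$) implies $i_W(q) \geq s$; it violates $\mathrm{LGP}(r,s)$ if $i_W(q_v)\ge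 r$ for all $v\in V$ but $i_W(q)<s$. *)

theory Defs
  imports
    "HOL-Algebra.Algebra"
    "HOL-Algebra.Algebraic_Closure_Type"
    "HOL-Library.Poly_Mapping"
    "HOL-Library.Extended_Nat"
    "HOL-Computational_Algebra.Fraction_Field"
begin

section \<open>Quadratic forms over a field\<close>

text \<open>
  Fields are carrier-based (HOL-Algebra), since completions and finite extensions depend on
  terms. All fields below have characteristic different from 2, so a quadratic form of
  dimension \<open>n\<close> is given by a symmetric Gram matrix \<open>A\<close>, with \<open>q(x) = \<Sum> A i j x\<^sub>i x\<^sub>j\<close>;
  entries of \<open>A\<close> with an index \<open>\<ge> n\<close> are irrelevant.
\<close>

datatype 'a qform = QForm (qdim: nat) (gram: "nat \<Rightarrow> nat \<Rightarrow> 'a")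

definition quadratic_form :: "('a, 'm) ring_scheme \<Rightarrow> 'a qform \<Rightarrow> bool" where
  "quadratic_form K q \<longleftrightarrow>
     (\<forall>i<qdim q. \<forall>j<qdim q. gram q i j \<in> carrier K \<and> gram q i j = gram q j i)"

definition vecs :: "('a, 'm) ring_scheme \<Rightarrow> nat \<Rightarrow> (nat \<Rightarrow> 'a) set" where
  "vecs K n = {..<n} \<rightarrow>\<^sub>E carrier K"

definition vec_zero :: "('a, 'm) ring_scheme \<Rightarrow> nat \<Rightarrow> nat \<Rightarrow> 'a" where
  "vec_zero K n = (\<lambda>i\<in>{..<n}. \<zero>\<^bsub>K\<^esub>)"

definition vec_add :: "('a, 'm) ring_scheme \<Rightarrow> nat \<Rightarrow> (nat \<Rightarrow> 'a) \<Rightarrow> (nat \<Rightarrow> 'a) \<Rightarrow> nat \<Rightarrow> 'a" where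
  "vec_add K n x y = (\<lambda>i\<in>{..<n}. x i \<oplus>\<^bsub>K\<^esub> y i)"

definition vec_smult :: "('a, 'm) ring_scheme \<Rightarrow> nat \<Rightarrow> 'a \<Rightarrow> (nat \<Rightarrow> 'a) \<Rightarrow> nat \<Rightarrow> 'a" where
  "vec_smult K n c x = (\<lambda>i\<in>{..<n}. c \<otimes>\<^bsub>K\<^esub> x i)"

definition qbilin :: "('a, 'm) ring_scheme \<Rightarrow> 'a qform \<Rightarrow> (nat \<Rightarrow> 'a) \<Rightarrow> (nat \<Rightarrow> 'a) \<Rightarrow> 'a" where
  "qbilin K q x y =
     (\<Oplus>\<^bsub>K\<^esub>i\<in>{..<qdim q}. \<Oplus>\<^bsub>K\<^esub>j\<in>{..<qdim q}. gram q i j \<otimes>\<^bsub>K\<^esub> (x i \<otimes>\<^bsub>K\<^esub> y j))"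

definition qeval :: "('a, 'm) ring_scheme \<Rightarrow> 'a qform \<Rightarrow> (nat \<Rightarrow> 'a) \<Rightarrow> 'a" where
  "qeval K q x = qbilin K q x x"

definition regular_form :: "('a, 'm) ring_scheme \<Rightarrow> 'a qform \<Rightarrow> bool" where
  "regular_form K q \<longleftrightarrow> quadratic_form K q \<and>
     (\<forall>x\<in>vecs K (qdim q). (\<forall>y\<in>vecs K (qdim q). qbilin K q x y = \<zero>\<^bsub>K\<^esub>)
        \<longrightarrow> x = vec_zero K (qdim q))"

definition anisotropic :: "('a, 'm) ring_scheme \<Rightarrow> 'a qform \<Rightarrow> bool" where
  "anisotropic K q \<longleftrightarrow>
     (\<forall>x\<in>vecs K (qdim q). qeval K q x = \<zero>\<^bsub>K\<^esub> \<longrightarrow> x = vec_zero K (qdim q))"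

definition isometric :: "('a, 'm) ring_scheme \<Rightarrow> 'a qform \<Rightarrow> 'a qform \<Rightarrow> bool" where
  "isometric K p q \<longleftrightarrow>
     (\<exists>f. bij_betw f (vecs K (qdim p)) (vecs K (qdim q)) \<and>
        (\<forall>x\<in>vecs K (qdim p). \<forall>y\<in>vecs K (qdim p).
           f (vec_add K (qdim p) x y) = vec_add K (qdim q) (f x) (f y)) \<and>
        (\<forall>c\<in>carrier K. \<forall>x\<in>vecs K (qdim p).
           f (vec_smult K (qdim p) c x) = vec_smult K (qdim q) c (f x)) \<and>
        (\<forall>x\<in>vecs K (qdim p). qeval K q (f x) = qeval K p x))"

definition orth_sum :: "('a, 'm) ring_scheme \<Rightarrow> 'a qform \<Rightarrow> 'a qform \<Rightarrow> 'a qform" where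
  "orth_sum K p q = QForm (qdim p + qdim q)
     (\<lambda>i j. if i < qdim p \<and> j < qdim p then gram p i j
            else if qdim p \<le> i \<and> qdim p \<le> j then gram q (i - qdim p) (j - qdim p)
            else \<zero>\<^bsub>K\<^esub>)"

definition hyperbolic_plane :: "('a, 'm) ring_scheme \<Rightarrow> 'a qform" where
  "hyperbolic_plane K = QForm 2
     (\<lambda>i j. if i \<noteq> j then \<zero>\<^bsub>K\<^esub> else if i = 0 then \<one>\<^bsub>K\<^esub> else \<ominus>\<^bsub>K\<^esub> \<one>\<^bsub>K\<^esub>)"

fun hyperbolic :: "('a, 'm) ring_scheme \<Rightarrow> nat \<Rightarrow> 'a qform" where
  "hyperbolic K 0 = QForm 0 (\<lambda>i j. \<zero>\<^bsub>K\<^esub>)"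
| "hyperbolic K (Suc m) = orth_sum K (hyperbolic_plane K) (hyperbolic K m)"

definition witt_index :: "('a, 'm) ring_scheme \<Rightarrow> 'a qform \<Rightarrow> nat" where
  "witt_index K q = (THE m. \<exists>q_an. regular_form K q_an \<and> anisotropic K q_an \<and>
     isometric K q (orth_sum K (hyperbolic K m) q_an))"

text \<open>The supremum is a maximum if it is finite, and \<open>\<infinity>\<close> otherwise.\<close>

definition u_invariant :: "('a, 'm) ring_scheme \<Rightarrow> enat" where
  "u_invariant K = Sup {enat (qdim q) |q. regular_form K q \<and> anisotropic K q}"

definition base_change :: "('a \<Rightarrow> 'b) \<Rightarrow> 'a qform \<Rightarrow> 'b qform" where
  "base_change h q = QForm (qdim q) (\<lambda>i j. h (gram q i j))"


section \<open>The property \<open>\<A>\<^sub>i(2)\<close>\<close>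

text \<open>
  A field extension of \<open>K\<close> of finite degree \<open>d\<close> is in bijection with the \<open>d\<close>-tuples over \<open>K\<close>, so
  it has a copy whose elements are of type \<^typ>\<open>nat \<Rightarrow> 'a\<close>: quantifying over the field structures
  on subsets of that type covers all finite extensions of \<open>K\<close> up to isomorphism. The members of a system
  are arbitrary quadratic forms, not necessarily regular (and possibly zero).
\<close>

definition odd_degree_extension ::
    "('a, 'm) ring_scheme \<Rightarrow> (nat \<Rightarrow> 'a) ring \<Rightarrow> ('a \<Rightarrow> nat \<Rightarrow> 'a) \<Rightarrow> bool" where
  "odd_degree_extension K E h \<longleftrightarrow> field E \<and> h \<in> ring_hom K E \<and>
     (\<exists>d. odd d \<and> ring.dimension E d (h ` carrier K) (carrier E))"

definition property_A2 :: "nat \<Rightarrow> ('a, 'm) ring_scheme \<Rightarrow> bool" where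
  "property_A2 i K \<longleftrightarrow>
     (\<forall>s n. \<forall>Q :: nat \<Rightarrow> 'a qform.
        1 \<le> s \<longrightarrow> s * 2 ^ i < n \<longrightarrow>
        (\<forall>t<s. quadratic_form K (Q t) \<and> qdim (Q t) = n) \<longrightarrow>
        (\<exists>E h. odd_degree_extension K E h \<and>
           (\<exists>x\<in>vecs E n. x \<noteq> vec_zero E n \<and>
              (\<forall>t<s. qeval E (base_change h (Q t)) x = \<zero>\<^bsub>E\<^esub>))))"


section \<open>Discrete valuations and completions\<close>

text \<open>
  Only the values of \<open>v\<close> on nonzero elements of \<open>K\<close> matter; implicitly \<open>v(0) = \<infinity>\<close>. The value
  group is a nonzero subgroup of the integers, not necessarily all of them.
\<close>

definition discrete_valuation :: "('a, 'm) ring_scheme \<Rightarrow> ('a \<Rightarrow> int) \<Rightarrow> bool" where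
  "discrete_valuation K v \<longleftrightarrow>
     (\<forall>x\<in>carrier K - {\<zero>\<^bsub>K\<^esub>}. \<forall>y\<in>carrier K - {\<zero>\<^bsub>K\<^esub>}.
        v (x \<otimes>\<^bsub>K\<^esub> y) = v x + v y \<and>
        (x \<oplus>\<^bsub>K\<^esub> y \<noteq> \<zero>\<^bsub>K\<^esub> \<longrightarrow> min (v x) (v y) \<le> v (x \<oplus>\<^bsub>K\<^esub> y)))"

definition nontrivial_discrete_valuation :: "('a, 'm) ring_scheme \<Rightarrow> ('a \<Rightarrow> int) \<Rightarrow> bool" where
  "nontrivial_discrete_valuation K v \<longleftrightarrow>
     discrete_valuation K v \<and> (\<exists>x\<in>carrier K - {\<zero>\<^bsub>K\<^esub>}. v x \<noteq> 0)"

definition trivial_on :: "('a, 'm) ring_scheme \<Rightarrow> ('a \<Rightarrow> int) \<Rightarrow> 'a set \<Rightarrow> bool" where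
  "trivial_on K v F \<longleftrightarrow> (\<forall>x\<in>F - {\<zero>\<^bsub>K\<^esub>}. v x = 0)"

definition val_ge :: "('a, 'm) ring_scheme \<Rightarrow> ('a \<Rightarrow> int) \<Rightarrow> int \<Rightarrow> 'a \<Rightarrow> bool" where
  "val_ge K v N x \<longleftrightarrow> x = \<zero>\<^bsub>K\<^esub> \<or> N \<le> v x"

definition cauchy_ring :: "('a, 'm) ring_scheme \<Rightarrow> ('a \<Rightarrow> int) \<Rightarrow> (nat \<Rightarrow> 'a) ring" where
  "cauchy_ring K v =
     \<lparr> carrier = {s. (\<forall>n. s n \<in> carrier K) \<and>
         (\<forall>N. \<exists>M. \<forall>m\<ge>M. \<forall>n\<ge>M. val_ge K v N (s m \<ominus>\<^bsub>K\<^esub> s n))},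
       monoid.mult = (\<lambda>s t n. s n \<otimes>\<^bsub>K\<^esub> t n),
       one = (\<lambda>n. \<one>\<^bsub>K\<^esub>),
       ring.zero = (\<lambda>n. \<zero>\<^bsub>K\<^esub>),
       add = (\<lambda>s t n. s n \<oplus>\<^bsub>K\<^esub> t n) \<rparr>"

definition null_seqs :: "('a, 'm) ring_scheme \<Rightarrow> ('a \<Rightarrow> int) \<Rightarrow> (nat \<Rightarrow> 'a) set" where
  "null_seqs K v = {s. (\<forall>n. s n \<in> carrier K) \<and> (\<forall>N. \<exists>M. \<forall>n\<ge>M. val_ge K v N (s n))}"

definition completion :: "('a, 'm) ring_scheme \<Rightarrow> ('a \<Rightarrow> int) \<Rightarrow> (nat \<Rightarrow> 'a) set ring" where
  "completion K v = cauchy_ring K v Quot null_seqs K v"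

definition completion_embed ::
    "('a, 'm) ring_scheme \<Rightarrow> ('a \<Rightarrow> int) \<Rightarrow> 'a \<Rightarrow> (nat \<Rightarrow> 'a) set" where
  "completion_embed K v a = null_seqs K v +>\<^bsub>cauchy_ring K v\<^esub> (\<lambda>n. a)"

definition violates_LGP ::
    "('a, 'm) ring_scheme \<Rightarrow> ('a \<Rightarrow> int) set \<Rightarrow> nat \<Rightarrow> nat \<Rightarrow> 'a qform \<Rightarrow> bool" where
  "violates_LGP K V r s q \<longleftrightarrow>
     (\<forall>v\<in>V. r \<le> witt_index (completion K v) (base_change (completion_embed K v) q)) \<and>
     witt_index K q < s"


section \<open>Rational function fields\<close>

text \<open>
  All the fields \<open>L\<^sub>r = \<ell>(x\<^sub>1, \<dots>, x\<^sub>r)\<close> are realised as subfields of \<open>\<ell>(x\<^sub>0, x\<^sub>1, x\<^sub>2, \<dots>)\<close>, where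
  \<open>\<ell>\<close> is the type \<^typ>\<open>'a\<close>. A polynomial maps each monomial, given by its exponents, to its
  coefficient.
\<close>

type_synonym 'a mpoly = "(nat \<Rightarrow>\<^sub>0 nat) \<Rightarrow>\<^sub>0 'a"

definition poly_vars :: "'a::zero mpoly \<Rightarrow> nat set" where
  "poly_vars p = (\<Union>m\<in>Poly_Mapping.keys p. Poly_Mapping.keys m)"

definition ratfun_field :: "nat \<Rightarrow> 'a::field mpoly fract ring" where
  "ratfun_field r = ring_of_type_algebra
     \<lparr> carrier := {Fraction_Field.Fract p q |p q.
         q \<noteq> 0 \<and> poly_vars p \<subseteq> {1..r} \<and> poly_vars q \<subseteq> {1..r}} \<rparr>"

definition ratfun_valuations :: "nat \<Rightarrow> ('a::field mpoly fract \<Rightarrow> int) set" where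
  "ratfun_valuations r = {v. nontrivial_discrete_valuation (ratfun_field r) v \<and>
     trivial_on (ratfun_field r) v (carrier (ratfun_field (r - 1)))}"

end

theory Submission
  imports Defs
begin

text \<open>
  Let \<open>\<phi>\<close> be anisotropic of dimension \<open>2\<^sup>i\<close> over the constant field, let \<open>F = \<phi> \<otimes> \<langle>1, x\<^sub>1\<rangle> \<otimes> \<dots> \<otimes> \<langle>1, x\<^sub>r\<^sub>-\<^sub>2\<rangle>\<close>,
  and write \<open>x\<close> and \<open>z\<close> for the last two variables. The form \<open>F \<otimes> \<langle>1, -z, -x, x(z - 1)(z - x\<^sup>2)\<rangle>\<close> is anisotropic:
  specialise \<open>x = 0\<close>, then \<open>z = 0\<close>. The required form arises by dropping \<open>n\<close> entries of the block \<open>F\<close>.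

  Let \<open>v\<close> be a place trivial on the field of the other variables. If \<open>z\<close> is not a unit at \<open>v\<close>, then \<open>(z - 1)(z - x\<^sup>2)\<close> is
  locally a square by Hensel's lemma; if \<open>z - 1\<close> or \<open>z - x\<^sup>2\<close> is a nonunit, then \<open>z\<close> is one. So one of \<open>\<langle>-x, x(z - 1)(z - x\<^sup>2)\<rangle>\<close>
  and \<open>\<langle>1, -z\<rangle>\<close> is hyperbolic, which gives \<open>2\<^sup>i\<^sup>+\<^sup>r\<^sup>-\<^sup>2 - n\<close> planes. Otherwise all entries are units. A form \<open>U\<close> with unit
  entries of dimension greater than \<open>2\<^sup>i\<^sup>+\<^sup>r\<^sup>-\<^sup>1\<close> is isotropic modulo a uniformizer \<open>\<pi>\<close>, because \<open>U \<perp> \<pi> U\<close> is isotropic by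
  counting coefficients of polynomials in the manner of Lang; the zero found in an odd degree extension is brought down
  by Springer's theorem. By Hensel's lemma hyperbolic planes can be split off down to that dimension.
\<close>

section \<open>Diagonal forms\<close>

text \<open>Global anisotropy is detected at x = 0, a valuation that is non-trivial on L_(r-1) and
  so lies outside the family \<open>ratfun_valuations r\<close>. At every member of that family x
  and the entries of F are units, and only the behaviour of z varies. The factor (z - 1)(z - x^2)
  vanishes only where z is the square 1 or x^2, while at z = 0 and z = infinity it agrees up to a
  1-unit with x^2 or z^2. Dropping n entries of F costs at most n planes and cannot create isotropy.
  With N the length of F, forms over L_r of dimension above 4N are isotropic, so unit forms split
  off planes down to dimension 2N; starting from 4N - n this gives at least N - n planes. The
  property A_i(2) yields zeros only over an extension E that depends on the system of equations.
  What has to descend is a zero with polynomial coordinates, so Springer's theorem is needed over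
  the rational functions and not just over the constants. For this, E is mapped into the algebraic
  closure, where all fields of constants become subsets of one type.\<close>

definition consq :: "('a, 'm) ring_scheme \<Rightarrow> 'a \<Rightarrow> 'a qform \<Rightarrow> 'a qform" where
  "consq K a p = orth_sum K (QForm 1 (\<lambda>_ _. a)) p"

fun diagq :: "('a, 'm) ring_scheme \<Rightarrow> 'a list \<Rightarrow> 'a qform" where
  "diagq K [] = QForm 0 (\<lambda>i j. \<zero>\<^bsub>K\<^esub>)"
| "diagq K (a # us) = consq K a (diagq K us)"

definition vcons :: "nat \<Rightarrow> 'a \<Rightarrow> (nat \<Rightarrow> 'a) \<Rightarrow> nat \<Rightarrow> 'a" where
  "vcons n c x = (\<lambda>i\<in>{..<Suc n}. case i of 0 \<Rightarrow> c | Suc j \<Rightarrow> x j)"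

text \<open>The witness of \<open>isometric\<close> is named, because Witt cancellation has to
  compose, invert and restrict concrete maps.\<close>

definition isometry :: "('a, 'm) ring_scheme \<Rightarrow> 'a qform \<Rightarrow> 'a qform \<Rightarrow> ((nat \<Rightarrow> 'a) \<Rightarrow> nat \<Rightarrow> 'a) \<Rightarrow> bool" where
  "isometry K p q f \<longleftrightarrow> bij_betw f (vecs K (qdim p)) (vecs K (qdim q)) \<and>
        (\<forall>x\<in>vecs K (qdim p). \<forall>y\<in>vecs K (qdim p).
           f (vec_add K (qdim p) x y) = vec_add K (qdim q) (f x) (f y)) \<and>
        (\<forall>c\<in>carrier K. \<forall>x\<in>vecs K (qdim p).
           f (vec_smult K (qdim p) c x) = vec_smult K (qdim q) c (f x)) \<and>
        (\<forall>x\<in>vecs K (qdim p). qeval K q (f x) = qeval K p x)"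

lemma isometric_altdef: "isometric K p q \<longleftrightarrow> (\<exists>f. isometry K p q f)"
  unfolding isometric_def isometry_def ..

lemma isometryI:
  assumes "\<forall>x\<in>vecs K (qdim p). f x \<in> vecs K (qdim q)"
    and "\<forall>y\<in>vecs K (qdim q). g y \<in> vecs K (qdim p)"
    and "\<forall>x\<in>vecs K (qdim p). g (f x) = x"
    and "\<forall>y\<in>vecs K (qdim q). f (g y) = y"
    and "\<forall>x\<in>vecs K (qdim p). \<forall>y\<in>vecs K (qdim p).
           f (vec_add K (qdim p) x y) = vec_add K (qdim q) (f x) (f y)"
    and "\<forall>c\<in>carrier K. \<forall>x\<in>vecs K (qdim p).
           f (vec_smult K (qdim p) c x) = vec_smult K (qdim q) c (f x)"
    and "\<forall>x\<in>vecs K (qdim p). qeval K q (f x) = qeval K p x"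
  shows "isometry K p q f"
  unfolding isometry_def using assms
  by (intro conjI bij_betw_byWitness[where f' = g]) auto

lemma qdim_consq [simp]: "qdim (consq K a p) = Suc (qdim p)"
  by (simp add: consq_def orth_sum_def)

lemma qdim_diagq [simp]: "qdim (diagq K us) = length us"
  by (induction us) auto

lemma gram_consq:
  "gram (consq K a p) i j = (case i of 0 \<Rightarrow> (case j of 0 \<Rightarrow> a | Suc _ \<Rightarrow> \<zero>\<^bsub>K\<^esub>)
     | Suc i' \<Rightarrow> (case j of 0 \<Rightarrow> \<zero>\<^bsub>K\<^esub> | Suc j' \<Rightarrow> gram p i' j'))"
  by (auto simp: consq_def orth_sum_def split: nat.splits)

text \<open>Entries beyond the dimension are carried along by \<open>orth_sum\<close> too, so this
  is an equality of forms, and hyperbolic sums can be regrouped by rewriting instead of by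
  isometries.\<close>

lemma orth_sum_assoc:
  "orth_sum K (orth_sum K p q) s = orth_sum K p (orth_sum K q s)"
  unfolding orth_sum_def by (auto simp: fun_eq_iff)

lemma orth_sum_zero_left: "orth_sum K (QForm 0 g) q = q"
  unfolding orth_sum_def by (cases q) (auto simp: fun_eq_iff)

lemma orth_sum_consq: "orth_sum K (consq K a p) s = consq K a (orth_sum K p s)"
  unfolding consq_def orth_sum_assoc ..

lemma orth_sum_hyperbolic_plane:
  "orth_sum K (hyperbolic_plane K) p = consq K \<one>\<^bsub>K\<^esub> (consq K (\<ominus>\<^bsub>K\<^esub> \<one>\<^bsub>K\<^esub>) p)"
  unfolding orth_sum_def hyperbolic_plane_def consq_def by (auto simp: fun_eq_iff numeral_2_eq_2)

lemma base_change_diagq: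
  assumes "h \<zero>\<^bsub>K\<^esub> = \<zero>\<^bsub>L\<^esub>"
  shows "base_change h (diagq K us) = diagq L (map h us)"
proof (induction us)
  case Nil
  then show ?case using assms by (simp add: base_change_def)
next
  case (Cons a us)
  have "base_change h (consq K a p) = consq L (h a) (base_change h p)" for p
    using assms unfolding base_change_def
    by (intro qform.expand) (auto simp: gram_consq fun_eq_iff split: nat.splits)
  with Cons show ?case by simp
qed

section \<open>Vectors as a head followed by a tail\<close>

lemma vcons_0 [simp]: "vcons n c x 0 = c"
  and vcons_Suc: "i < n \<Longrightarrow> vcons n c x (Suc i) = x i"
  by (auto simp: vcons_def)

lemma vecs_D: "x \<in> vecs K n \<Longrightarrow> i < n \<Longrightarrow> x i \<in> carrier K"
  by (auto simp: vecs_def PiE_def Pi_def)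

lemma vecs_eqI:
  assumes "x \<in> vecs K n" "y \<in> vecs K n" "\<And>i. i < n \<Longrightarrow> x i = y i"
  shows "x = y"
  using assms unfolding vecs_def by (metis (no_types, lifting) PiE_ext lessThan_iff)

lemma vcons_closed [intro, simp]:
  "c \<in> carrier K \<Longrightarrow> x \<in> vecs K n \<Longrightarrow> vcons n c x \<in> vecs K (Suc n)"
  by (auto simp: vcons_def vecs_def PiE_def Pi_def split: nat.splits)

lemma vecs_SucE:
  assumes "v \<in> vecs K (Suc n)"
  obtains c x where "c \<in> carrier K" "x \<in> vecs K n" "v = vcons n c x"
proof
  show "v 0 \<in> carrier K" using assms by (auto intro: vecs_D)
  show x: "(\<lambda>i\<in>{..<n}. v (Suc i)) \<in> vecs K n" using assms by (auto simp: vecs_def PiE_def Pi_def)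
  show "v = vcons n (v 0) (\<lambda>i\<in>{..<n}. v (Suc i))"
    by (rule vecs_eqI[OF assms vcons_closed[OF \<open>v 0 \<in> carrier K\<close> x]])
       (auto simp: vcons_def split: nat.splits)
qed

text \<open>As a rewrite rule this turns the conditions of \<open>isometryI\<close> on vectors into
  conditions on a head coordinate and a tail.\<close>

lemma ball_vecs_Suc:
  "(\<forall>v\<in>vecs K (Suc n). P v) \<longleftrightarrow> (\<forall>c\<in>carrier K. \<forall>x\<in>vecs K n. P (vcons n c x))"
  by (metis vecs_SucE vcons_closed)

lemma vcons_inject:
  assumes "x \<in> vecs K n" "y \<in> vecs K n"
  shows "vcons n c x = vcons n d y \<longleftrightarrow> c = d \<and> x = y"
proof
  assume e: "vcons n c x = vcons n d y"
  have "c = d" using fun_cong[OF e, of 0] by simp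
  moreover have "x = y"
    using fun_cong[OF e, of "Suc i" for i] by (intro vecs_eqI[OF assms]) (metis vcons_Suc)
  ultimately show "c = d \<and> x = y" ..
qed simp

lemma vec_add_vcons: "vec_add K (Suc n) (vcons n c x) (vcons n d y) = vcons n (c \<oplus>\<^bsub>K\<^esub> d) (vec_add K n x y)"
  by (auto simp: vec_add_def vcons_def fun_eq_iff split: nat.splits)

lemma vec_smult_vcons: "vec_smult K (Suc n) d (vcons n c x) = vcons n (d \<otimes>\<^bsub>K\<^esub> c) (vec_smult K n d x)"
  by (auto simp: vec_smult_def vcons_def fun_eq_iff split: nat.splits)

lemma vec_zero_Suc: "vec_zero K (Suc n) = vcons n \<zero>\<^bsub>K\<^esub> (vec_zero K n)"
  by (auto simp: vec_zero_def vcons_def fun_eq_iff split: nat.splits)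

section \<open>Bilinear algebra of Gram matrices\<close>

context field
begin

lemma vec_zero_closed [simp]: "vec_zero R n \<in> vecs R n"
  by (auto simp: vec_zero_def vecs_def)

lemma vec_add_closed [simp]: "x \<in> vecs R n \<Longrightarrow> y \<in> vecs R n \<Longrightarrow> vec_add R n x y \<in> vecs R n"
  by (auto simp: vec_add_def vecs_def PiE_def Pi_def)

lemma vec_smult_closed [simp]: "c \<in> carrier R \<Longrightarrow> x \<in> vecs R n \<Longrightarrow> vec_smult R n c x \<in> vecs R n"
  by (auto simp: vec_smult_def vecs_def PiE_def Pi_def)

lemma finsum_lessThan_Suc_shift:
  assumes "\<And>i. i < Suc n \<Longrightarrow> f i \<in> carrier R"
  shows "(\<Oplus>i\<in>{..<Suc n}. f i) = f 0 \<oplus> (\<Oplus>i\<in>{..<n}. f (Suc i))"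
proof -
  have "(\<Oplus>i\<in>{..<Suc n}. f i) = (\<Oplus>i\<in>insert 0 (Suc ` {..<n}). f i)"
    by (simp only: lessThan_Suc_eq_insert_0)
  also have "\<dots> = f 0 \<oplus> (\<Oplus>i\<in>Suc ` {..<n}. f i)"
    using assms by (subst finsum_insert) auto
  also have "(\<Oplus>i\<in>Suc ` {..<n}. f i) = (\<Oplus>i\<in>{..<n}. f (Suc i))"
    using assms by (subst finsum_reindex) auto
  finally show ?thesis .
qed

lemma quadratic_form_consq [simp]:
  "a \<in> carrier R \<Longrightarrow> quadratic_form R p \<Longrightarrow> quadratic_form R (consq R a p)"
  by (auto simp: quadratic_form_def gram_consq split: nat.splits)

lemma quadratic_form_diagq [simp]: "set us \<subseteq> carrier R \<Longrightarrow> quadratic_form R (diagq R us)"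
  by (induction us) (auto simp: quadratic_form_def[of _ "QForm 0 _"])

lemma quadratic_formD:
  assumes "quadratic_form R q" "i < qdim q" "j < qdim q"
  shows "gram q i j \<in> carrier R" "gram q i j = gram q j i"
  using assms by (auto simp: quadratic_form_def)

lemma qbilin_closed [simp]:
  assumes "quadratic_form R q" "x \<in> vecs R (qdim q)" "y \<in> vecs R (qdim q)"
  shows "qbilin R q x y \<in> carrier R"
  unfolding qbilin_def using assms
  by (auto intro!: finsum_closed simp: vecs_D quadratic_formD)

lemma qeval_closed [simp]:
  "quadratic_form R q \<Longrightarrow> x \<in> vecs R (qdim q) \<Longrightarrow> qeval R q x \<in> carrier R"
  unfolding qeval_def by simp

lemma qbilin_add_left:
  assumes "quadratic_form R q" "x \<in> vecs R (qdim q)" "x' \<in> vecs R (qdim q)" "y \<in> vecs R (qdim q)"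
  shows "qbilin R q (vec_add R (qdim q) x x') y = qbilin R q x y \<oplus> qbilin R q x' y"
proof -
  have "qbilin R q (vec_add R (qdim q) x x') y =
    (\<Oplus>i\<in>{..<qdim q}. (\<Oplus>j\<in>{..<qdim q}. gram q i j \<otimes> (x i \<otimes> y j)) \<oplus>
       (\<Oplus>j\<in>{..<qdim q}. gram q i j \<otimes> (x' i \<otimes> y j)))"
    unfolding qbilin_def
  proof (rule finsum_cong', goal_cases)
    case (3 i)
    have "(\<Oplus>j\<in>{..<qdim q}. gram q i j \<otimes> (vec_add R (qdim q) x x' i \<otimes> y j)) =
      (\<Oplus>j\<in>{..<qdim q}. gram q i j \<otimes> (x i \<otimes> y j) \<oplus> gram q i j \<otimes> (x' i \<otimes> y j))"
      using 3 assms by (intro finsum_cong')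
       (auto simp: vec_add_def l_distr r_distr vecs_D quadratic_formD)
    also have "\<dots> = (\<Oplus>j\<in>{..<qdim q}. gram q i j \<otimes> (x i \<otimes> y j)) \<oplus>
       (\<Oplus>j\<in>{..<qdim q}. gram q i j \<otimes> (x' i \<otimes> y j))"
      using 3 assms by (intro finsum_addf) (auto simp: vecs_D quadratic_formD)
    finally show ?case .
  qed (use assms in \<open>auto simp: vecs_D quadratic_formD\<close>)
  also have "\<dots> = qbilin R q x y \<oplus> qbilin R q x' y"
    unfolding qbilin_def using assms
    by (intro finsum_addf) (auto simp: vecs_D quadratic_formD)
  finally show ?thesis .
qed

lemma qbilin_smult_left:
  assumes "quadratic_form R q" "c \<in> carrier R" "x \<in> vecs R (qdim q)" "y \<in> vecs R (qdim q)"
  shows "qbilin R q (vec_smult R (qdim q) c x) y = c \<otimes> qbilin R q x y"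
proof -
  have "qbilin R q (vec_smult R (qdim q) c x) y =
    (\<Oplus>i\<in>{..<qdim q}. c \<otimes> (\<Oplus>j\<in>{..<qdim q}. gram q i j \<otimes> (x i \<otimes> y j)))"
    unfolding qbilin_def
  proof (rule finsum_cong', goal_cases)
    case (3 i)
    have "(\<Oplus>j\<in>{..<qdim q}. gram q i j \<otimes> (vec_smult R (qdim q) c x i \<otimes> y j)) =
      (\<Oplus>j\<in>{..<qdim q}. c \<otimes> (gram q i j \<otimes> (x i \<otimes> y j)))"
      using 3 assms by (intro finsum_cong')
       (auto simp: vec_smult_def m_ac vecs_D quadratic_formD)
    also have "\<dots> = c \<otimes> (\<Oplus>j\<in>{..<qdim q}. gram q i j \<otimes> (x i \<otimes> y j))"
      using 3 assms by (intro finsum_rdistr[symmetric]) (auto simp: vecs_D quadratic_formD)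
    finally show ?case .
  qed (use assms in \<open>auto simp: vecs_D quadratic_formD\<close>)
  also have "\<dots> = c \<otimes> qbilin R q x y"
    unfolding qbilin_def using assms
    by (intro finsum_rdistr[symmetric]) (auto simp: vecs_D quadratic_formD)
  finally show ?thesis .
qed

lemma finsum_swap:
  assumes "finite A" "finite B" "\<And>i j. i \<in> A \<Longrightarrow> j \<in> B \<Longrightarrow> f i j \<in> carrier R"
  shows "(\<Oplus>i\<in>A. \<Oplus>j\<in>B. f i j) = (\<Oplus>j\<in>B. \<Oplus>i\<in>A. f i j)"
  using assms(1,3)
proof (induction A rule: finite_induct)
  case (insert a A)
  have "(\<Oplus>i\<in>insert a A. \<Oplus>j\<in>B. f i j) = (\<Oplus>j\<in>B. f a j) \<oplus> (\<Oplus>j\<in>B. \<Oplus>i\<in>A. f i j)"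
    using insert by (subst finsum_insert) auto
  also have "\<dots> = (\<Oplus>j\<in>B. f a j \<oplus> (\<Oplus>i\<in>A. f i j))"
    using insert by (subst finsum_addf) auto
  also have "\<dots> = (\<Oplus>j\<in>B. \<Oplus>i\<in>insert a A. f i j)"
    using insert by (intro finsum_cong') auto
  finally show ?case .
qed auto

lemma qbilin_sym:
  assumes "quadratic_form R q" "x \<in> vecs R (qdim q)" "y \<in> vecs R (qdim q)"
  shows "qbilin R q x y = qbilin R q y x"
proof -
  have "qbilin R q x y = (\<Oplus>j\<in>{..<qdim q}. \<Oplus>i\<in>{..<qdim q}. gram q i j \<otimes> (x i \<otimes> y j))"
    unfolding qbilin_def by (rule finsum_swap) (use assms in \<open>auto simp: vecs_D quadratic_formD\<close>)
  also have "\<dots> = qbilin R q y x"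
    unfolding qbilin_def
  proof (intro finsum_cong' refl, goal_cases)
    case (3 j i)
    then have "gram q i j = gram q j i" using assms(1) quadratic_formD(2) by auto
    then show ?case using 3 assms by (simp add: m_comm vecs_D)
  qed (use assms in \<open>auto simp: vecs_D quadratic_formD\<close>)
  finally show ?thesis .
qed

lemma qbilin_consq:
  assumes "a \<in> carrier R" "quadratic_form R p" "c \<in> carrier R" "d \<in> carrier R"
    "x \<in> vecs R (qdim p)" "y \<in> vecs R (qdim p)"
  shows "qbilin R (consq R a p) (vcons (qdim p) c x) (vcons (qdim p) d y) =
    a \<otimes> (c \<otimes> d) \<oplus> qbilin R p x y"
proof -
  let ?n = "qdim p" and ?q = "consq R a p"
  let ?x = "vcons ?n c x" and ?y = "vcons ?n d y"
  have xy: "?x \<in> vecs R (Suc ?n)" "?y \<in> vecs R (Suc ?n)" using assms by auto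
  have Q: "quadratic_form R ?q" using assms by simp
  have G: "i < Suc ?n \<Longrightarrow> j < Suc ?n \<Longrightarrow> gram ?q i j \<in> carrier R" for i j
    using quadratic_formD(1)[OF Q] by simp
  have inner: "(\<Oplus>j\<in>{..<Suc ?n}. gram ?q i j \<otimes> (?x i \<otimes> ?y j)) =
    gram ?q i 0 \<otimes> (?x i \<otimes> d) \<oplus> (\<Oplus>j\<in>{..<?n}. gram ?q i (Suc j) \<otimes> (?x i \<otimes> y j))"
    if "i < Suc ?n" for i
    using that G vecs_D[OF xy(1)] vecs_D[OF xy(2)] assms
    by (subst finsum_lessThan_Suc_shift)
       (auto simp: vecs_D vcons_Suc intro!: finsum_cong' arg_cong2[where f="(\<oplus>)"])
  have z: "(\<Oplus>j\<in>{..<?n}. \<zero> \<otimes> (c \<otimes> y j)) = \<zero>"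
    using assms by (subst finsum_cong'[where g = "\<lambda>_. \<zero>"]) (auto simp: vecs_D)
  have "qbilin R ?q ?x ?y = (\<Oplus>i\<in>{..<Suc ?n}. \<Oplus>j\<in>{..<Suc ?n}. gram ?q i j \<otimes> (?x i \<otimes> ?y j))"
    by (simp add: qbilin_def)
  also have "\<dots> = (\<Oplus>j\<in>{..<Suc ?n}. gram ?q 0 j \<otimes> (?x 0 \<otimes> ?y j)) \<oplus>
      (\<Oplus>i\<in>{..<?n}. \<Oplus>j\<in>{..<Suc ?n}. gram ?q (Suc i) j \<otimes> (?x (Suc i) \<otimes> ?y j))"
    using G vecs_D[OF xy(1)] vecs_D[OF xy(2)]
    by (subst finsum_lessThan_Suc_shift) (auto intro!: finsum_closed)
  also have "(\<Oplus>j\<in>{..<Suc ?n}. gram ?q 0 j \<otimes> (?x 0 \<otimes> ?y j)) = a \<otimes> (c \<otimes> d)"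
    using assms by (subst inner) (auto simp: gram_consq z)
  also have "(\<Oplus>i\<in>{..<?n}. \<Oplus>j\<in>{..<Suc ?n}. gram ?q (Suc i) j \<otimes> (?x (Suc i) \<otimes> ?y j)) =
     qbilin R p x y"
    unfolding qbilin_def
  proof (rule finsum_cong', goal_cases)
    case (3 i)
    then show ?case using assms
      by (subst inner) (auto simp: gram_consq vcons_Suc vecs_D quadratic_formD)
  qed (use assms in \<open>auto simp: vecs_D quadratic_formD\<close>)
  finally show ?thesis .
qed

lemma qeval_consq:
  assumes "a \<in> carrier R" "quadratic_form R p" "c \<in> carrier R" "x \<in> vecs R (qdim p)"
  shows "qeval R (consq R a p) (vcons (qdim p) c x) = a \<otimes> (c \<otimes> c) \<oplus> qeval R p x"
  unfolding qeval_def using assms by (simp add: qbilin_consq)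

section \<open>Isometry as an equivalence relation\<close>

lemma isometric_refl: "isometric R q q"
  unfolding isometric_altdef by (rule exI[of _ id], rule isometryI[where g = id]) auto

lemma isometric_trans:
  assumes "isometric R p q" "isometric R q s"
  shows "isometric R p s"
proof -
  obtain f g where "isometry R p q f" "isometry R q s g"
    using assms by (auto simp: isometric_altdef)
  then have "isometry R p s (g \<circ> f)"
    unfolding isometry_def by (auto intro: bij_betw_trans simp: bij_betwE)
  then show ?thesis by (auto simp: isometric_altdef)
qed

lemma isometry_inv:
  assumes f: "isometry R p q f"
  shows "isometry R q p (inv_into (vecs R (qdim p)) f)"
proof -
  let ?A = "vecs R (qdim p)" let ?B = "vecs R (qdim q)" let ?g = "inv_into ?A f"
  have b: "bij_betw f ?A ?B" using f by (simp add: isometry_def)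
  have gB: "?g y \<in> ?A" "f (?g y) = y" if "y \<in> ?B" for y
    using b that by (auto simp: bij_betw_def inv_into_into f_inv_into_f)
  have inj: "x = y" if "f x = f y" "x \<in> ?A" "y \<in> ?A" for x y
    using b that by (auto simp: bij_betw_def inj_on_def)
  have fa: "f (vec_add R (qdim p) x y) = vec_add R (qdim q) (f x) (f y)" if "x \<in> ?A" "y \<in> ?A" for x y
    using f that by (simp add: isometry_def)
  have fs: "f (vec_smult R (qdim p) c x) = vec_smult R (qdim q) c (f x)"
    if "c \<in> carrier R" "x \<in> ?A" for c x
    using f that by (simp add: isometry_def)
  have fq: "qeval R q (f x) = qeval R p x" if "x \<in> ?A" for x
    using f that by (simp add: isometry_def)
  have fA: "f x \<in> ?B" "?g (f x) = x" if "x \<in> ?A" for x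
    using b that by (auto simp: bij_betw_def)
  show ?thesis
  proof (rule isometryI[where g = f])
    show "\<forall>x\<in>?B. \<forall>y\<in>?B. ?g (vec_add R (qdim q) x y) = vec_add R (qdim p) (?g x) (?g y)"
      by (intro ballI, rule inj) (simp_all add: fa gB)
    show "\<forall>c\<in>carrier R. \<forall>x\<in>?B. ?g (vec_smult R (qdim q) c x) = vec_smult R (qdim p) c (?g x)"
      by (intro ballI, rule inj) (simp_all add: fs gB)
    show "\<forall>x\<in>?B. qeval R p (?g x) = qeval R q x"
      using gB fq by metis
  qed (use fA gB in auto)
qed

lemma isometric_sym: "isometric R p q \<Longrightarrow> isometric R q p"
  using isometry_inv by (auto simp: isometric_altdef)

lemma isometric_consq:
  assumes "a \<in> carrier R" "quadratic_form R p" "quadratic_form R q" "isometric R p q"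
  shows "isometric R (consq R a p) (consq R a q)"
proof -
  obtain f where f: "isometry R p q f" using assms by (auto simp: isometric_altdef)
  define tl where "tl = (\<lambda>n (v :: nat \<Rightarrow> 'a). \<lambda>i\<in>{..<n}. v (Suc i))"
  have tl: "tl n (vcons n c x) = x" if "x \<in> vecs R n" for n c x
    using that by (intro vecs_eqI[OF _ that]) (auto simp: tl_def vcons_Suc vecs_def PiE_def Pi_def)
  define F where "F = (\<lambda>v. vcons (qdim q) (v 0) (f (tl (qdim p) v)))"
  let ?g = "inv_into (vecs R (qdim p)) f"
  define G where "G = (\<lambda>v. vcons (qdim p) (v 0) (?g (tl (qdim q) v)))"
  have g: "isometry R q p ?g" using isometry_inv[OF f] .
  have fc: "f x \<in> vecs R (qdim q)" "?g (f x) = x" if "x \<in> vecs R (qdim p)" for x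
    using f that by (auto simp: isometry_def bij_betw_def)
  have gc: "?g x \<in> vecs R (qdim p)" "f (?g x) = x" if "x \<in> vecs R (qdim q)" for x
    using f that by (auto simp: isometry_def bij_betw_def inv_into_into f_inv_into_f)
  have F: "F (vcons (qdim p) c x) = vcons (qdim q) c (f x)" if "x \<in> vecs R (qdim p)" for c x
    using that by (simp add: F_def tl)
  have G: "G (vcons (qdim q) c x) = vcons (qdim p) c (?g x)" if "x \<in> vecs R (qdim q)" for c x
    using that by (simp add: G_def tl)
  have "isometry R (consq R a p) (consq R a q) F"
    using f by (intro isometryI[where g = G])
      (simp_all add: ball_vecs_Suc F G fc gc vec_add_vcons vec_smult_vcons qeval_consq assms isometry_def)
  then show ?thesis by (auto simp: isometric_altdef)
qed

end

section \<open>Isometries that change at most two diagonal entries\<close>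

definition vtl :: "nat \<Rightarrow> (nat \<Rightarrow> 'a) \<Rightarrow> nat \<Rightarrow> 'a" where
  "vtl n v = (\<lambda>i\<in>{..<n}. v (Suc i))"

lemma vtl_vcons: "x \<in> vecs K n \<Longrightarrow> vtl n (vcons n c x) = x"
  by (rule vecs_eqI[where K = K]) (auto simp: vtl_def vcons_Suc vecs_def PiE_def Pi_def)

context field
begin

text \<open>A linear change of the first two coordinates, given by \<open>Fa\<close>,
  \<open>Fb\<close> with inverse \<open>Ga\<close>, \<open>Gb\<close>, extends by the identity on p.
  The later moves of two entries reduce to this, which leaves only polynomial identities to
  check.\<close>

lemma isometric_move2:
  assumes cl: "a \<in> carrier R" "b \<in> carrier R" "a' \<in> carrier R" "b' \<in> carrier R" "quadratic_form R p"
    and F: "\<And>x y. x \<in> carrier R \<Longrightarrow> y \<in> carrier R \<Longrightarrow> Fa x y \<in> carrier R"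
      "\<And>x y. x \<in> carrier R \<Longrightarrow> y \<in> carrier R \<Longrightarrow> Fb x y \<in> carrier R"
    and G: "\<And>x y. x \<in> carrier R \<Longrightarrow> y \<in> carrier R \<Longrightarrow> Ga x y \<in> carrier R"
      "\<And>x y. x \<in> carrier R \<Longrightarrow> y \<in> carrier R \<Longrightarrow> Gb x y \<in> carrier R"
    and add: "\<And>x y z w. x \<in> carrier R \<Longrightarrow> y \<in> carrier R \<Longrightarrow> z \<in> carrier R \<Longrightarrow> w \<in> carrier R \<Longrightarrow>
        Fa (x \<oplus> z) (y \<oplus> w) = Fa x y \<oplus> Fa z w"
      "\<And>x y z w. x \<in> carrier R \<Longrightarrow> y \<in> carrier R \<Longrightarrow> z \<in> carrier R \<Longrightarrow> w \<in> carrier R \<Longrightarrow>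
        Fb (x \<oplus> z) (y \<oplus> w) = Fb x y \<oplus> Fb z w"
    and smult: "\<And>c x y. c \<in> carrier R \<Longrightarrow> x \<in> carrier R \<Longrightarrow> y \<in> carrier R \<Longrightarrow>
        Fa (c \<otimes> x) (c \<otimes> y) = c \<otimes> Fa x y"
      "\<And>c x y. c \<in> carrier R \<Longrightarrow> x \<in> carrier R \<Longrightarrow> y \<in> carrier R \<Longrightarrow>
        Fb (c \<otimes> x) (c \<otimes> y) = c \<otimes> Fb x y"
    and inv: "\<And>x y. x \<in> carrier R \<Longrightarrow> y \<in> carrier R \<Longrightarrow> Ga (Fa x y) (Fb x y) = x"
      "\<And>x y. x \<in> carrier R \<Longrightarrow> y \<in> carrier R \<Longrightarrow> Gb (Fa x y) (Fb x y) = y"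
      "\<And>x y. x \<in> carrier R \<Longrightarrow> y \<in> carrier R \<Longrightarrow> Fa (Ga x y) (Gb x y) = x"
      "\<And>x y. x \<in> carrier R \<Longrightarrow> y \<in> carrier R \<Longrightarrow> Fb (Ga x y) (Gb x y) = y"
    and norm: "\<And>x y. x \<in> carrier R \<Longrightarrow> y \<in> carrier R \<Longrightarrow>
        a' \<otimes> (Fa x y \<otimes> Fa x y) \<oplus> b' \<otimes> (Fb x y \<otimes> Fb x y) = a \<otimes> (x \<otimes> x) \<oplus> b \<otimes> (y \<otimes> y)"
  shows "isometric R (consq R a (consq R b p)) (consq R a' (consq R b' p))"
proof -
  let ?n = "qdim p"
  define M where "M = (\<lambda>Ha Hb v. vcons (Suc ?n) (Ha (v 0) (v (Suc 0)) :: 'a)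
      (vcons ?n (Hb (v 0) (v (Suc 0))) (vtl ?n (vtl (Suc ?n) v))))"
  have M: "M Ha Hb (vcons (Suc ?n) c (vcons ?n d x)) = vcons (Suc ?n) (Ha c d) (vcons ?n (Hb c d) x)"
    if "x \<in> vecs R ?n" "d \<in> carrier R" for Ha Hb c d x
  proof -
    have "vcons ?n d x \<in> vecs R (Suc ?n)" using that by simp
    with that show ?thesis by (simp add: M_def vcons_Suc vtl_vcons[where K = R])
  qed
  have norm': "a' \<otimes> (Fa x y \<otimes> Fa x y) \<oplus> (b' \<otimes> (Fb x y \<otimes> Fb x y) \<oplus> t) = a \<otimes> (x \<otimes> x) \<oplus> (b \<otimes> (y \<otimes> y) \<oplus> t)"
    if "x \<in> carrier R" "y \<in> carrier R" "t \<in> carrier R" for x y t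
    using norm[OF that(1,2)] that cl F by (simp add: a_assoc[symmetric])
  have "isometry R (consq R a (consq R b p)) (consq R a' (consq R b' p)) (M Fa Fb)"
    by (rule isometryI[where g = "M Ga Gb"])
       (simp_all add: ball_vecs_Suc M F G inv add smult vec_add_vcons vec_smult_vcons cl norm'
          qeval_consq[of _ "consq R _ p", simplified] qeval_consq[of _ p])
  then show ?thesis by (auto simp: isometric_altdef)
qed

lemma isometric_swap:
  assumes "a \<in> carrier R" "b \<in> carrier R" "quadratic_form R p"
  shows "isometric R (consq R a (consq R b p)) (consq R b (consq R a p))"
  by (rule isometric_move2[where Fa = "\<lambda>x y. y" and Fb = "\<lambda>x y. x"
        and Ga = "\<lambda>x y. y" and Gb = "\<lambda>x y. x"])
     (use assms in \<open>auto simp: a_comm\<close>)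

lemma isometric_scale:
  assumes "a \<in> carrier R" "c \<in> carrier R - {\<zero>}" "quadratic_form R p"
  shows "isometric R (consq R (a \<otimes> (c \<otimes> c)) p) (consq R a p)"
proof -
  let ?n = "qdim p"
  define M where "M = (\<lambda>s v. vcons ?n (s \<otimes> v 0) (vtl ?n v))"
  have M: "M s (vcons ?n d x) = vcons ?n (s \<otimes> d) x" if "x \<in> vecs R ?n" for s d x
    using that by (simp add: M_def vtl_vcons[where K = R])
  have ci: "inv c \<in> carrier R" "inv c \<otimes> c = \<one>" "c \<otimes> inv c = \<one>"
    using assms field_Units by auto
  have inv: "inv c \<otimes> (c \<otimes> d) = d" "c \<otimes> (inv c \<otimes> d) = d" if "d \<in> carrier R" for d
    using that ci assms by (simp_all add: m_assoc[symmetric])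
  have cc: "c \<in> carrier R" using assms by simp
  have norm: "a \<otimes> (c \<otimes> d \<otimes> (c \<otimes> d)) = a \<otimes> (c \<otimes> c) \<otimes> (d \<otimes> d)" if "d \<in> carrier R" for d
    using that assms cc by (simp add: m_ac)
  have "isometry R (consq R (a \<otimes> (c \<otimes> c)) p) (consq R a p) (M c)"
    by (rule isometryI[where g = "M (inv c)"])
       (use assms in \<open>simp_all add: ball_vecs_Suc M inv ci vec_add_vcons vec_smult_vcons qeval_consq
          r_distr m_ac\<close>)
  then show ?thesis by (auto simp: isometric_altdef)
qed

text \<open>In the binary form with entries a and b, the vector (1, 1) has value a + b, and (b, -a)
  is orthogonal to it with value ab(a + b). The map sends (x, y) to x(1, 1) + y(b, -a); its
  determinant is -(a + b).\<close>

lemma isometric_merge: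
  assumes "a \<in> carrier R" "b \<in> carrier R" "a \<oplus> b \<noteq> \<zero>" "quadratic_form R p"
  shows "isometric R (consq R (a \<oplus> b) (consq R (a \<otimes> b \<otimes> (a \<oplus> b)) p)) (consq R a (consq R b p))"
proof -
  define e where "e = inv (a \<oplus> b)"
  have e: "e \<in> carrier R" "(a \<oplus> b) \<otimes> e = \<one>"
    unfolding e_def using assms field_Units by auto
  have e1: "x \<otimes> (a \<oplus> b) \<otimes> e = x" if "x \<in> carrier R" for x
    using that e assms by (simp add: m_assoc)
  show ?thesis
  proof (rule isometric_move2[where Fa = "\<lambda>x y. x \<oplus> b \<otimes> y" and Fb = "\<lambda>x y. x \<ominus> a \<otimes> y"
        and Ga = "\<lambda>x y. (a \<otimes> x \<oplus> b \<otimes> y) \<otimes> e" and Gb = "\<lambda>x y. (x \<ominus> y) \<otimes> e"], goal_cases)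
    case (14 x y)
    have "a \<otimes> (x \<oplus> b \<otimes> y) \<oplus> b \<otimes> (x \<ominus> a \<otimes> y) = x \<otimes> (a \<oplus> b)"
      using 14 assms by algebra
    then show ?case using 14 e1 by simp
  next
    case (15 x y)
    have "x \<oplus> b \<otimes> y \<ominus> (x \<ominus> a \<otimes> y) = y \<otimes> (a \<oplus> b)"
      using 15 assms by algebra
    then show ?case using 15 e1 by simp
  next
    case (16 x y)
    have "(a \<otimes> x \<oplus> b \<otimes> y) \<otimes> e \<oplus> b \<otimes> ((x \<ominus> y) \<otimes> e) = x \<otimes> (a \<oplus> b) \<otimes> e"
      using 16 assms e(1) by algebra
    then show ?case using 16 e1 by simp
  next
    case (17 x y)
    have "(a \<otimes> x \<oplus> b \<otimes> y) \<otimes> e \<ominus> a \<otimes> ((x \<ominus> y) \<otimes> e) = y \<otimes> (a \<oplus> b) \<otimes> e"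
      using 17 assms e(1) by algebra
    then show ?case using 17 e1 by simp
  next
    case (10 x y z w) then show ?case using assms by algebra
  next
    case (11 x y z w) then show ?case using assms by algebra
  next
    case (12 c x y) then show ?case using assms by algebra
  next
    case (13 c x y) then show ?case using assms by algebra
  next
    case (18 x y) then show ?case using assms by algebra
  qed (use assms e in auto)
qed

end

section \<open>Witt cancellation and hyperbolic planes\<close>

locale field_not2 = field +
  assumes two_neq_zero: "\<one> \<oplus> \<one> \<noteq> \<zero>"
begin

definition half :: 'a where "half = inv (\<one> \<oplus> \<one>)"

lemma half: "half \<in> carrier R" "half \<otimes> (\<one> \<oplus> \<one>) = \<one>"
  unfolding half_def using two_neq_zero field_Units by auto

lemma half_double: "x \<in> carrier R \<Longrightarrow> half \<otimes> (x \<oplus> x) = x"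
  using half by (metis l_distr l_one m_assoc m_comm one_closed r_one add.m_closed)

text \<open>Both binary forms are products of two linear forms: a(x^2 - y^2) is x + y times a(x -
  y). The new coordinates are half the sum and half the difference of these factors.\<close>

lemma isometric_hyperbolic:
  assumes "a \<in> carrier R" "a \<noteq> \<zero>" "quadratic_form R p"
  shows "isometric R (consq R a (consq R (\<ominus> a) p)) (consq R \<one> (consq R (\<ominus> \<one>) p))"
proof -
  define e where "e = inv a"
  have e: "e \<in> carrier R" "e \<otimes> a = \<one>"
    unfolding e_def using assms field_Units by auto
  have ea: "e \<otimes> (a \<otimes> x) = x" "a \<otimes> (e \<otimes> x) = x" if "x \<in> carrier R" for x
    using that e assms by (simp_all add: m_assoc[symmetric] m_comm[of a e])
  let ?Fa = "\<lambda>x y. half \<otimes> ((x \<oplus> y) \<oplus> a \<otimes> (x \<ominus> y))"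
  let ?Fb = "\<lambda>x y. half \<otimes> ((x \<oplus> y) \<ominus> a \<otimes> (x \<ominus> y))"
  let ?Ga = "\<lambda>x y. half \<otimes> ((x \<oplus> y) \<oplus> e \<otimes> (x \<ominus> y))"
  let ?Gb = "\<lambda>x y. half \<otimes> ((x \<oplus> y) \<ominus> e \<otimes> (x \<ominus> y))"
  have h: "half \<in> carrier R" by (rule half)
  have s: "half \<otimes> (u \<oplus> v) \<oplus> half \<otimes> (u \<ominus> v) = u" "half \<otimes> (u \<oplus> v) \<ominus> half \<otimes> (u \<ominus> v) = v"
    if "u \<in> carrier R" "v \<in> carrier R" for u v
  proof -
    have "half \<otimes> (u \<oplus> v) \<oplus> half \<otimes> (u \<ominus> v) = half \<otimes> (u \<oplus> u)" using that h by algebra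
    then show "half \<otimes> (u \<oplus> v) \<oplus> half \<otimes> (u \<ominus> v) = u" using that half_double by simp
    have "half \<otimes> (u \<oplus> v) \<ominus> half \<otimes> (u \<ominus> v) = half \<otimes> (v \<oplus> v)" using that h by algebra
    then show "half \<otimes> (u \<oplus> v) \<ominus> half \<otimes> (u \<ominus> v) = v" using that half_double by simp
  qed
  have t: "half \<otimes> ((x \<oplus> y) \<oplus> (x \<ominus> y)) = x" "half \<otimes> ((x \<oplus> y) \<ominus> (x \<ominus> y)) = y"
    if "x \<in> carrier R" "y \<in> carrier R" for x y
  proof -
    have "(x \<oplus> y) \<oplus> (x \<ominus> y) = x \<oplus> x" "(x \<oplus> y) \<ominus> (x \<ominus> y) = y \<oplus> y"
      using that by algebra+
    then show "half \<otimes> ((x \<oplus> y) \<oplus> (x \<ominus> y)) = x" "half \<otimes> ((x \<oplus> y) \<ominus> (x \<ominus> y)) = y"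
      using that half_double by simp_all
  qed
  show ?thesis
  proof (rule isometric_move2[where Fa = ?Fa and Fb = ?Fb and Ga = ?Ga and Gb = ?Gb], goal_cases)
    case (14 x y)
    then show ?case using assms h e by (simp add: s ea t)
  next
    case (15 x y)
    then show ?case using assms h e by (simp add: s ea t)
  next
    case (16 x y)
    then show ?case using assms h e by (simp add: s ea t)
  next
    case (17 x y)
    then show ?case using assms h e by (simp add: s ea t)
  next
    case (10 x y z w) then show ?case using assms h by algebra
  next
    case (11 x y z w) then show ?case using assms h by algebra
  next
    case (12 c x y) then show ?case using assms h by algebra
  next
    case (13 c x y) then show ?case using assms h by algebra
  next
    case (18 x y)
    have *: "\<one> \<otimes> (P \<otimes> P) \<oplus> (\<ominus> \<one>) \<otimes> (Q \<otimes> Q) = (P \<oplus> Q) \<otimes> (P \<ominus> Q)"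
      if "P \<in> carrier R" "Q \<in> carrier R" for P Q
    proof -
      have "P \<otimes> P \<ominus> Q \<otimes> Q = (P \<oplus> Q) \<otimes> (P \<ominus> Q)" using that by algebra
      then show ?thesis using that by (simp add: l_minus a_minus_def)
    qed
    have "\<one> \<otimes> (?Fa x y \<otimes> ?Fa x y) \<oplus> (\<ominus> \<one>) \<otimes> (?Fb x y \<otimes> ?Fb x y) =
      (x \<oplus> y) \<otimes> (a \<otimes> (x \<ominus> y))"
      using 18 assms h by (subst *) (auto simp: s)
    also have "\<dots> = a \<otimes> (x \<otimes> x) \<oplus> (\<ominus> a) \<otimes> (y \<otimes> y)"
      using 18 assms by algebra
    finally show ?case .
  qed (use assms h e in auto)
qed

end

section \<open>Polarization, reflections and Witt cancellation\<close>

context field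
begin

lemma qeval_add:
  assumes "quadratic_form R q" "x \<in> vecs R (qdim q)" "y \<in> vecs R (qdim q)"
  shows "qeval R q (vec_add R (qdim q) x y) =
    qeval R q x \<oplus> (qbilin R q x y \<oplus> qbilin R q x y) \<oplus> qeval R q y"
proof -
  let ?B = "qbilin R q"
  have r: "?B z (vec_add R (qdim q) x y) = ?B x z \<oplus> ?B y z" if "z \<in> vecs R (qdim q)" for z
    using assms that by (subst qbilin_sym) (auto simp: qbilin_add_left)
  have "qeval R q (vec_add R (qdim q) x y) = (?B x x \<oplus> ?B y x) \<oplus> (?B x y \<oplus> ?B y y)"
    unfolding qeval_def using assms by (simp add: qbilin_add_left r)
  also have "?B y x = ?B x y" using assms by (simp add: qbilin_sym)
  finally show ?thesis unfolding qeval_def using assms by (simp add: a_assoc)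
qed

lemma qbilin_smult_right:
  assumes "quadratic_form R q" "c \<in> carrier R" "x \<in> vecs R (qdim q)" "y \<in> vecs R (qdim q)"
  shows "qbilin R q x (vec_smult R (qdim q) c y) = c \<otimes> qbilin R q x y"
  using assms by (metis qbilin_smult_left qbilin_sym vec_smult_closed)

lemma qbilin_add_right:
  assumes "quadratic_form R q" "x \<in> vecs R (qdim q)" "x' \<in> vecs R (qdim q)" "y \<in> vecs R (qdim q)"
  shows "qbilin R q y (vec_add R (qdim q) x x') = qbilin R q y x \<oplus> qbilin R q y x'"
  using assms by (metis qbilin_add_left qbilin_sym vec_add_closed)

lemma qeval_smult:
  assumes "quadratic_form R q" "c \<in> carrier R" "x \<in> vecs R (qdim q)"
  shows "qeval R q (vec_smult R (qdim q) c x) = (c \<otimes> c) \<otimes> qeval R q x"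
  unfolding qeval_def using assms
  by (simp add: qbilin_smult_left qbilin_smult_right m_assoc)

lemma isometry_comp: "isometry R p q f \<Longrightarrow> isometry R q s g \<Longrightarrow> isometry R p s (g \<circ> f)"
  unfolding isometry_def by (auto intro: bij_betw_trans simp: bij_betwE)

lemma isometryD:
  assumes "isometry R p q f" "x \<in> vecs R (qdim p)"
  shows "f x \<in> vecs R (qdim q)" "qeval R q (f x) = qeval R p x"
    "y \<in> vecs R (qdim p) \<Longrightarrow> f (vec_add R (qdim p) x y) = vec_add R (qdim q) (f x) (f y)"
    "c \<in> carrier R \<Longrightarrow> f (vec_smult R (qdim p) c x) = vec_smult R (qdim q) c (f x)"
    "inv_into (vecs R (qdim p)) f (f x) = x"
  using assms by (auto simp: isometry_def bij_betw_def)

end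

context field_not2
begin

lemma double_cancel:
  assumes "x \<in> carrier R" "y \<in> carrier R" "x \<oplus> x = y \<oplus> y"
  shows "x = y"
  using assms half_double by metis

text \<open>An isometry is only required to preserve values; polarization determines twice the
  bilinear form, and 2 is invertible.\<close>

lemma isometry_qbilin:
  assumes f: "isometry R p q f" and Q: "quadratic_form R p" "quadratic_form R q"
    and x: "x \<in> vecs R (qdim p)" "y \<in> vecs R (qdim p)"
  shows "qbilin R q (f x) (f y) = qbilin R p x y"
proof (rule double_cancel)
  let ?B = "qbilin R p x y" and ?B' = "qbilin R q (f x) (f y)"
  note fx = isometryD(1,2)[OF f x(1)] isometryD(1,2)[OF f x(2)]
  have fadd: "f (vec_add R (qdim p) x y) = vec_add R (qdim q) (f x) (f y)"
    using isometryD(3)[OF f x] .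
  have "qeval R q (vec_add R (qdim q) (f x) (f y)) = qeval R p (vec_add R (qdim p) x y)"
    using x isometryD(2)[OF f, of "vec_add R (qdim p) x y"] by (simp add: fadd)
  then have "qeval R p x \<oplus> (?B' \<oplus> ?B') \<oplus> qeval R p y = qeval R p x \<oplus> (?B \<oplus> ?B) \<oplus> qeval R p y"
    using Q x fx by (simp add: qeval_add)
  then show "?B' \<oplus> ?B' = ?B \<oplus> ?B" using Q x fx by simp
qed (use Q x isometryD(1)[OF f x(1)] isometryD(1)[OF f x(2)] in auto)

text \<open>The map is x - 2 B(x,w)/q(w) w. Its effect is recorded for 2 B(x,w) = q(w), where it
  subtracts w: this is the case that moves a vector to another one of the same value.\<close>

lemma reflection:
  assumes Q: "quadratic_form R q" and w: "w \<in> vecs R (qdim q)" "qeval R q w \<noteq> \<zero>"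
  obtains T where "isometry R q q T"
    and "\<And>x. x \<in> vecs R (qdim q) \<Longrightarrow> qbilin R q x w \<oplus> qbilin R q x w = qeval R q w \<Longrightarrow>
      T x = vec_add R (qdim q) x (vec_smult R (qdim q) (\<ominus> \<one>) w)"
proof -
  let ?V = "vecs R (qdim q)" and ?B = "\<lambda>x. qbilin R q x w" and ?w = "qeval R q w"
  let ?add = "vec_add R (qdim q)" and ?sm = "vec_smult R (qdim q)"
  define e where "e = inv ?w"
  have wc: "?w \<in> carrier R" using Q w by simp
  have e: "e \<in> carrier R" "e \<otimes> ?w = \<one>"
    unfolding e_def using wc w field_Units by auto
  define t where "t = (\<lambda>x. \<ominus> ((?B x \<oplus> ?B x) \<otimes> e))"
  have Bc: "?B x \<in> carrier R" if "x \<in> ?V" for x using that Q w by simp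
  have tc: "t x \<in> carrier R" if "x \<in> ?V" for x using Bc[OF that] e by (simp add: t_def)
  have tw: "t x \<otimes> ?w = \<ominus> (?B x \<oplus> ?B x)" if "x \<in> ?V" for x
  proof -
    have "(\<ominus> ((b \<oplus> b) \<otimes> e)) \<otimes> ?w = (\<ominus> (b \<oplus> b)) \<otimes> (e \<otimes> ?w)" if "b \<in> carrier R" for b
      using that e(1) wc by algebra
    with Bc[OF that] e show ?thesis by (simp add: t_def)
  qed
  define T where "T = (\<lambda>x. ?add x (?sm (t x) w))"
  have TV: "T x \<in> ?V" if "x \<in> ?V" for x using that tc w by (simp add: T_def)
  have comp: "?add x (?sm c w) i = x i \<oplus> c \<otimes> w i" if "i < qdim q" for x c i
    using that by (simp add: vec_add_def vec_smult_def)
  have Ti: "T x i = x i \<oplus> t x \<otimes> w i" if "i < qdim q" for x i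
    using comp[OF that] by (simp add: T_def)
  have vi: "?add x y i = x i \<oplus> y i" "?sm c x i = c \<otimes> x i" if "i < qdim q" for c x y i
    using that by (simp_all add: vec_add_def vec_smult_def)
  \<comment> \<open>The sign of B(x,w) is reversed, which makes the reflection an involution and its
    own inverse in \<open>isometryI\<close>.\<close>
  have BT: "?B (T x) = \<ominus> ?B x" if "x \<in> ?V" for x
  proof -
    have "?B (T x) = ?B x \<oplus> t x \<otimes> ?w"
      using that Q w tc[OF that] by (simp add: T_def qbilin_add_left qbilin_smult_left qeval_def)
    also have "\<dots> = ?B x \<oplus> \<ominus> (?B x \<oplus> ?B x)" using tw[OF that] by simp
    also have "\<dots> = \<ominus> ?B x" using Bc[OF that] by algebra
    finally show ?thesis .
  qed
  have tT: "t (T x) = \<ominus> t x" if "x \<in> ?V" for x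
  proof -
    have "\<ominus> ((\<ominus> b \<oplus> \<ominus> b) \<otimes> e) = \<ominus> (\<ominus> ((b \<oplus> b) \<otimes> e))" if "b \<in> carrier R" for b
      using that e(1) by algebra
    with Bc[OF that] show ?thesis by (simp only: t_def BT[OF that])
  qed
  have wi: "w i \<in> carrier R" if "i < qdim q" for i using vecs_D[OF w(1) that] .
  have TT: "T (T x) = x" if x: "x \<in> ?V" for x
  proof (rule vecs_eqI[OF TV[OF TV[OF x]] x])
    fix i assume i: "i < qdim q"
    have "T (T x) i = (x i \<oplus> t x \<otimes> w i) \<oplus> (\<ominus> t x) \<otimes> w i"
      by (simp add: Ti[OF i] tT[OF x])
    also have "\<dots> = x i" using tc[OF x] vecs_D[OF x i] wi[OF i] by algebra
    finally show "T (T x) i = x i" .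
  qed
  have tadd: "t (?add x y) = t x \<oplus> t y" if "x \<in> ?V" "y \<in> ?V" for x y
  proof -
    have "?B (?add x y) = ?B x \<oplus> ?B y" using that Q w by (simp add: qbilin_add_left)
    moreover have "\<ominus> (((b \<oplus> c) \<oplus> (b \<oplus> c)) \<otimes> e) = \<ominus> ((b \<oplus> b) \<otimes> e) \<oplus> \<ominus> ((c \<oplus> c) \<otimes> e)"
      if "b \<in> carrier R" "c \<in> carrier R" for b c using that e(1) by algebra
    ultimately show ?thesis using Bc that by (simp only: t_def)
  qed
  have tsm: "t (?sm c x) = c \<otimes> t x" if "x \<in> ?V" "c \<in> carrier R" for c x
  proof -
    have "?B (?sm c x) = c \<otimes> ?B x" using that Q w by (simp add: qbilin_smult_left)
    moreover have "\<ominus> ((c \<otimes> b \<oplus> c \<otimes> b) \<otimes> e) = c \<otimes> (\<ominus> ((b \<oplus> b) \<otimes> e))"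
      if "b \<in> carrier R" for b using that \<open>c \<in> carrier R\<close> e(1) by algebra
    ultimately show ?thesis using Bc that by (simp only: t_def)
  qed
  have "isometry R q q T"
  proof (rule isometryI[where g = T]; intro ballI)
    fix x y assume x: "x \<in> ?V" and y: "y \<in> ?V"
    show "T (?add x y) = ?add (T x) (T y)"
    proof (rule vecs_eqI[of _ R "qdim q"])
      fix i assume i: "i < qdim q"
      have "(x i \<oplus> y i) \<oplus> (t x \<oplus> t y) \<otimes> w i = (x i \<oplus> t x \<otimes> w i) \<oplus> (y i \<oplus> t y \<otimes> w i)"
        using tc[OF x] tc[OF y] vecs_D[OF x i] vecs_D[OF y i] wi[OF i] by algebra
      then show "T (?add x y) i = ?add (T x) (T y) i"
        by (simp add: Ti[OF i] tadd[OF x y] vi[OF i])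
    qed (use x y TV in auto)
  next
    fix c x assume c: "c \<in> carrier R" and x: "x \<in> ?V"
    show "T (?sm c x) = ?sm c (T x)"
    proof (rule vecs_eqI[of _ R "qdim q"])
      fix i assume i: "i < qdim q"
      have "c \<otimes> x i \<oplus> (c \<otimes> t x) \<otimes> w i = c \<otimes> (x i \<oplus> t x \<otimes> w i)"
        using tc[OF x] c vecs_D[OF x i] wi[OF i] by algebra
      then show "T (?sm c x) i = ?sm c (T x) i"
        by (simp add: Ti[OF i] tsm[OF x c] vi[OF i])
    qed (use x c TV in auto)
  next
    fix x assume x: "x \<in> ?V"
    have "qeval R q (T x) = qeval R q x \<oplus> (t x \<otimes> ?B x \<oplus> t x \<otimes> ?B x) \<oplus> (t x \<otimes> t x) \<otimes> ?w"
      unfolding T_def using x Q w tc[OF x]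
      by (simp add: qeval_add qeval_smult qbilin_smult_right)
    also have "(t x \<otimes> t x) \<otimes> ?w = t x \<otimes> (\<ominus> (?B x \<oplus> ?B x))"
      using tw[OF x] tc[OF x] wc by (simp add: m_assoc)
    also have "qeval R q x \<oplus> (t x \<otimes> ?B x \<oplus> t x \<otimes> ?B x) \<oplus> t x \<otimes> (\<ominus> (?B x \<oplus> ?B x)) = qeval R q x"
    proof -
      have "Q' \<oplus> (s \<otimes> b \<oplus> s \<otimes> b) \<oplus> s \<otimes> (\<ominus> (b \<oplus> b)) = Q'"
        if "Q' \<in> carrier R" "s \<in> carrier R" "b \<in> carrier R" for Q' s b
        using that by algebra
      then show ?thesis using tc[OF x] Bc[OF x] x Q by simp
    qed
    finally show "qeval R q (T x) = qeval R q x" .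
  qed (use TV TT in auto)
  moreover have "T x = ?add x (?sm (\<ominus> \<one>) w)"
    if "x \<in> ?V" "?B x \<oplus> ?B x = ?w" for x
  proof -
    have "t x = \<ominus> \<one>" using that e wc by (simp add: t_def m_comm)
    then show ?thesis by (simp add: T_def)
  qed
  ultimately show ?thesis using that by blast
qed

lemma vec_smult_neg_neg:
  assumes "x \<in> vecs R n"
  shows "vec_smult R n (\<ominus> \<one>) (vec_smult R n (\<ominus> \<one>) x) = x"
proof (rule vecs_eqI[of _ R n])
  fix i assume "i < n"
  then show "vec_smult R n (\<ominus> \<one>) (vec_smult R n (\<ominus> \<one>) x) i = x i"
    using vecs_D[OF assms] by (simp add: vec_smult_def l_minus)
qed (use assms in auto)

lemma isometry_neg:
  assumes "quadratic_form R q"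
  shows "isometry R q q (vec_smult R (qdim q) (\<ominus> \<one>))"
proof (rule isometryI[where g = "vec_smult R (qdim q) (\<ominus> \<one>)"]; intro ballI)
  fix x y assume xy: "x \<in> vecs R (qdim q)" "y \<in> vecs R (qdim q)"
  show "vec_smult R (qdim q) (\<ominus> \<one>) (vec_add R (qdim q) x y) =
    vec_add R (qdim q) (vec_smult R (qdim q) (\<ominus> \<one>) x) (vec_smult R (qdim q) (\<ominus> \<one>) y)"
    using xy by (auto simp: vec_add_def vec_smult_def fun_eq_iff vecs_D r_distr)
next
  fix c x assume "c \<in> carrier R" "x \<in> vecs R (qdim q)"
  then show "vec_smult R (qdim q) (\<ominus> \<one>) (vec_smult R (qdim q) c x) =
    vec_smult R (qdim q) c (vec_smult R (qdim q) (\<ominus> \<one>) x)"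
    by (auto simp: vec_smult_def fun_eq_iff vecs_D m_ac)
next
  fix x assume x: "x \<in> vecs R (qdim q)"
  show "vec_smult R (qdim q) (\<ominus> \<one>) (vec_smult R (qdim q) (\<ominus> \<one>) x) = x"
    using x by (rule vec_smult_neg_neg)
  then show "vec_smult R (qdim q) (\<ominus> \<one>) (vec_smult R (qdim q) (\<ominus> \<one>) x) = x" .
  show "qeval R q (vec_smult R (qdim q) (\<ominus> \<one>) x) = qeval R q x"
    using x assms by (simp add: qeval_smult l_minus)
qed auto

text \<open>The values of u - v and u + v add up to 4a, so one of these vectors is anisotropic. If
  it is u - v, the reflection in it takes u to v; otherwise the reflection in u + v takes u to -v,
  and a change of sign follows.\<close>

lemma isometry_transitive:
  assumes Q: "quadratic_form R q" and u: "u \<in> vecs R (qdim q)" and v: "v \<in> vecs R (qdim q)"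
    and a: "qeval R q u = a" "qeval R q v = a" "a \<noteq> \<zero>"
  obtains T where "isometry R q q T" "T u = v"
proof -
  let ?V = "vecs R (qdim q)" and ?B = "qbilin R q"
  let ?add = "vec_add R (qdim q)" and ?sm = "vec_smult R (qdim q)"
  have ac: "a \<in> carrier R" using Q u a by auto
  have main: "\<exists>T. isometry R q q T \<and> T u = y"
    if y: "y \<in> ?V" "qeval R q y = a" and nz: "qeval R q (?add u (?sm (\<ominus> \<one>) y)) \<noteq> \<zero>" for y
  proof -
    let ?w = "?add u (?sm (\<ominus> \<one>) y)"
    have w: "?w \<in> ?V" using u y by simp
    obtain T where T: "isometry R q q T" "\<And>x. x \<in> ?V \<Longrightarrow> ?B x ?w \<oplus> ?B x ?w = qeval R q ?w \<Longrightarrow>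
      T x = ?add x (?sm (\<ominus> \<one>) ?w)"
      using reflection[OF Q w nz] by blast
    have b: "?B u y \<in> carrier R" using Q u y by simp
    have "?B u ?w = a \<oplus> (\<ominus> \<one>) \<otimes> ?B u y"
      using Q u y a w
      by (simp add: qbilin_add_right qbilin_smult_right qeval_def)
    moreover have "qeval R q ?w = a \<oplus> ((\<ominus> \<one>) \<otimes> ?B u y \<oplus> (\<ominus> \<one>) \<otimes> ?B u y) \<oplus> a"
      using Q u y a ac
      by (simp add: qeval_add qeval_smult qbilin_smult_right l_minus)
    \<comment> \<open>Since u and y have the same value a, both sides equal 2a - 2 B(u,y).\<close>
    ultimately have "?B u ?w \<oplus> ?B u ?w = qeval R q ?w"
      using ac b by (simp add: l_minus a_ac)
    then have "T u = ?add u (?sm (\<ominus> \<one>) ?w)" using T(2) u by blast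
    also have "\<dots> = y"
    proof (rule vecs_eqI[of _ R "qdim q"])
      fix i assume i: "i < qdim q"
      have "u i \<oplus> (\<ominus> \<one>) \<otimes> (u i \<oplus> (\<ominus> \<one>) \<otimes> y i) = y i"
      proof -
        have "s \<oplus> \<ominus> (s \<oplus> \<ominus> t) = t" if "s \<in> carrier R" "t \<in> carrier R" for s t
          using that by algebra
        then show ?thesis using vecs_D[OF u i] vecs_D[OF y(1) i] by (simp add: l_minus)
      qed
      then show "?add u (?sm (\<ominus> \<one>) ?w) i = y i" using i by (simp add: vec_add_def vec_smult_def)
    qed (use u y in auto)
    finally show ?thesis using T(1) by blast
  qed
  let ?v' = "?sm (\<ominus> \<one>) v"
  have v': "?v' \<in> ?V" "qeval R q ?v' = a" using v Q a ac by (auto simp: qeval_smult l_minus)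
  have vv: "?sm (\<ominus> \<one>) ?v' = v"
    using v by (rule vec_smult_neg_neg)
  show ?thesis
  proof (cases "qeval R q (?add u ?v') = \<zero>")
    case False
    then show ?thesis using main[OF v a(2)] that by blast
  next
    case True
    have b: "?B u v \<in> carrier R" using Q u v by simp
    have e1: "qeval R q (?add u ?v') = a \<oplus> ((\<ominus> \<one>) \<otimes> ?B u v \<oplus> (\<ominus> \<one>) \<otimes> ?B u v) \<oplus> a"
      using Q u v a ac
      by (simp add: qeval_add qeval_smult qbilin_smult_right l_minus)
    have e2: "qeval R q (?add u v) = a \<oplus> (?B u v \<oplus> ?B u v) \<oplus> a"
      using Q u v a ac by (simp add: qeval_add)
    have "qeval R q (?add u (?sm (\<ominus> \<one>) ?v')) \<noteq> \<zero>"
    proof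
      assume "qeval R q (?add u (?sm (\<ominus> \<one>) ?v')) = \<zero>"
      then have "(a \<oplus> ((\<ominus> \<one>) \<otimes> ?B u v \<oplus> (\<ominus> \<one>) \<otimes> ?B u v) \<oplus> a) \<oplus> (a \<oplus> (?B u v \<oplus> ?B u v) \<oplus> a) = \<zero>"
        using True e1 e2 vv by simp
      moreover have "(a \<oplus> ((\<ominus> \<one>) \<otimes> ?B u v \<oplus> (\<ominus> \<one>) \<otimes> ?B u v) \<oplus> a) \<oplus> (a \<oplus> (?B u v \<oplus> ?B u v) \<oplus> a) = (a \<oplus> a) \<oplus> (a \<oplus> a)"
      proof -
        have "(a \<oplus> (\<ominus> b \<oplus> \<ominus> b) \<oplus> a) \<oplus> (a \<oplus> (b \<oplus> b) \<oplus> a) = (a \<oplus> a) \<oplus> (a \<oplus> a)"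
          if "b \<in> carrier R" for b using that ac by algebra
        then show ?thesis using b by (simp add: l_minus)
      qed
      ultimately have "(a \<oplus> a) \<oplus> (a \<oplus> a) = \<zero> \<oplus> \<zero>" by simp
      then have "a \<oplus> a = \<zero> \<oplus> \<zero>" using ac double_cancel[of "a \<oplus> a" \<zero>] by simp
      then show False using ac double_cancel[of a \<zero>] a by simp
    qed
    then obtain T where T: "isometry R q q T" "T u = ?v'" using main[OF v'] by blast
    show ?thesis
      by (rule that[OF isometry_comp[OF T(1) isometry_neg[OF Q]]]) (simp add: T vv)
  qed
qed

text \<open>By transitivity on vectors of value a, the isometry can be corrected so that it maps the
  first basis vector to the first basis vector. It then maps the orthogonal complement, the vectors
  with head zero, onto the orthogonal complement.\<close>

lemma witt_cancellation:
  assumes a: "a \<in> carrier R" "a \<noteq> \<zero>" and Q: "quadratic_form R p" "quadratic_form R q"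
    and iso: "isometric R (consq R a p) (consq R a q)"
  shows "isometric R p q"
proof -
  let ?E = "\<lambda>q. vcons (qdim q) \<one> (vec_zero R (qdim q))"
  have smz: "vec_smult R n \<zero> x = vec_zero R n" if "x \<in> vecs R n" for x n
    using that by (auto simp: vec_smult_def vec_zero_def fun_eq_iff vecs_D)
  have Bz: "qbilin R q x (vec_zero R (qdim q)) = \<zero>" if "quadratic_form R q" "x \<in> vecs R (qdim q)" for q x
    using that qbilin_smult_left[of q \<zero> x x] by (metis smz qbilin_sym zero_closed l_null qbilin_closed vec_zero_closed)
  have EB: "qbilin R (consq R a q) (vcons (qdim q) c x) (?E q) = a \<otimes> c"
    if "quadratic_form R q" "c \<in> carrier R" "x \<in> vecs R (qdim q)" for q c x
    using that a by (simp add: qbilin_consq Bz)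
  have EV: "?E q \<in> vecs R (qdim (consq R a q))" for q by simp
  have Ea: "qeval R (consq R a q) (?E q) = a" if "quadratic_form R q" for q
    using EB[OF that, of \<one>] a by (simp add: qeval_def)
  obtain f where f: "isometry R (consq R a p) (consq R a q) f"
    using iso by (auto simp: isometric_altdef)
  obtain T where T: "isometry R (consq R a q) (consq R a q) T" "T (f (?E p)) = ?E q"
    by (rule isometry_transitive[of "consq R a q" "f (?E p)" "?E q" a])
       (use a Q isometryD(1,2)[OF f EV] Ea in auto)
  define g where "g = T \<circ> f"
  have g: "isometry R (consq R a p) (consq R a q) g" "g (?E p) = ?E q"
    using isometry_comp[OF f T(1)] T(2) by (auto simp: g_def)
  define h where "h = inv_into (vecs R (qdim (consq R a p))) g"
  have h: "isometry R (consq R a q) (consq R a p) h" "h (?E q) = ?E p"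
    using isometry_inv[OF g(1)] isometryD(5)[OF g(1) EV] g(2) by (auto simp: h_def)
  \<comment> \<open>Stated for arbitrary forms and maps, because it is applied to \<open>g\<close>
    and to its inverse \<open>h\<close>. Orthogonality to the first basis vector forces
    \<open>a \<otimes> d\<close> to vanish.\<close>
  have key: "vtl (qdim q) (g (vcons (qdim p) \<zero> x)) \<in> vecs R (qdim q) \<and>
      g (vcons (qdim p) \<zero> x) = vcons (qdim q) \<zero> (vtl (qdim q) (g (vcons (qdim p) \<zero> x)))"
    if g: "isometry R (consq R a p) (consq R a q) g" "g (?E p) = ?E q"
      and Q: "quadratic_form R p" "quadratic_form R q"
      and x: "x \<in> vecs R (qdim p)" for p q g x
  proof -
    have "g (vcons (qdim p) \<zero> x) \<in> vecs R (Suc (qdim q))"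
      using isometryD(1)[OF g(1)] x by simp
    then obtain d y where dy: "d \<in> carrier R" "y \<in> vecs R (qdim q)"
      "g (vcons (qdim p) \<zero> x) = vcons (qdim q) d y" by (auto elim: vecs_SucE)
    have "qbilin R (consq R a q) (g (vcons (qdim p) \<zero> x)) (g (?E p)) =
      qbilin R (consq R a p) (vcons (qdim p) \<zero> x) (?E p)"
      using Q x a by (intro isometry_qbilin[OF g(1)]) auto
    then have "a \<otimes> d = \<zero>" using Q x dy a g(2) by (simp add: EB)
    then have "d = \<zero>" using a dy integral by blast
    with dy show ?thesis by (simp add: vtl_vcons[where K = R])
  qed
  note kg = key[OF g Q] note kh = key[OF h Q(2,1)]
  define k where "k = (\<lambda>x. vtl (qdim q) (g (vcons (qdim p) \<zero> x)))"
  define l where "l = (\<lambda>x. vtl (qdim p) (h (vcons (qdim q) \<zero> x)))"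
  have k: "k x \<in> vecs R (qdim q)" "g (vcons (qdim p) \<zero> x) = vcons (qdim q) \<zero> (k x)"
    if "x \<in> vecs R (qdim p)" for x using kg[OF that] by (auto simp: k_def)
  have l: "l x \<in> vecs R (qdim p)" "h (vcons (qdim q) \<zero> x) = vcons (qdim p) \<zero> (l x)"
    if "x \<in> vecs R (qdim q)" for x using kh[OF that] by (auto simp: l_def)
  have hg: "h (g x) = x" if "x \<in> vecs R (qdim (consq R a p))" for x
    using isometryD(5)[OF g(1) that] by (simp add: h_def)
  have gh: "g (h x) = x" if "x \<in> vecs R (qdim (consq R a q))" for x
    using g(1) that by (auto simp: h_def isometry_def bij_betw_def f_inv_into_f)
  have "isometry R p q k"
  proof (rule isometryI[where g = l]; intro ballI)
    show "k x \<in> vecs R (qdim q)" if "x \<in> vecs R (qdim p)" for x using k that by simp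
    show "l x \<in> vecs R (qdim p)" if "x \<in> vecs R (qdim q)" for x using l that by simp
    show "l (k x) = x" if x: "x \<in> vecs R (qdim p)" for x
      using hg[of "vcons (qdim p) \<zero> x"] x k l
      by (simp add: vcons_inject[where K = R])
    show "k (l x) = x" if x: "x \<in> vecs R (qdim q)" for x
      using gh[of "vcons (qdim q) \<zero> x"] x k l
      by (simp add: vcons_inject[where K = R])
    show "k (vec_add R (qdim p) x y) = vec_add R (qdim q) (k x) (k y)"
      if "x \<in> vecs R (qdim p)" "y \<in> vecs R (qdim p)" for x y
      using isometryD(3)[OF g(1), of "vcons (qdim p) \<zero> x" "vcons (qdim p) \<zero> y"] that k
      by (simp add: vec_add_vcons vcons_inject[where K = R])
    show "k (vec_smult R (qdim p) c x) = vec_smult R (qdim q) c (k x)"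
      if "c \<in> carrier R" "x \<in> vecs R (qdim p)" for c x
      using isometryD(4)[OF g(1), of "vcons (qdim p) \<zero> x" c] that k
      by (simp add: vec_smult_vcons vcons_inject[where K = R])
    show "qeval R q (k x) = qeval R p x" if "x \<in> vecs R (qdim p)" for x
      using isometryD(2)[OF g(1), of "vcons (qdim p) \<zero> x"] that k a Q
      by (simp add: qeval_consq)
  qed
  then show ?thesis by (auto simp: isometric_altdef)
qed

end

section \<open>Uniqueness of the Witt index\<close>

lemma orth_sum_hyperbolic_Suc:
  "orth_sum K (hyperbolic K (Suc m)) p =
     consq K \<one>\<^bsub>K\<^esub> (consq K (\<ominus>\<^bsub>K\<^esub> \<one>\<^bsub>K\<^esub>) (orth_sum K (hyperbolic K m) p))"
  by (simp add: orth_sum_consq orth_sum_hyperbolic_plane)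

context field
begin

lemma quadratic_form_orth_sum:
  "quadratic_form R p \<Longrightarrow> quadratic_form R q \<Longrightarrow> quadratic_form R (orth_sum R p q)"
  by (auto simp: quadratic_form_def orth_sum_def)

lemma quadratic_form_hyperbolic [simp]: "quadratic_form R (hyperbolic R m)"
proof (induction m)
  case 0
  then show ?case by (simp add: quadratic_form_def)
next
  case (Suc m)
  have "quadratic_form R (hyperbolic_plane R)"
    by (auto simp: quadratic_form_def hyperbolic_plane_def)
  with Suc show ?case by (simp add: quadratic_form_orth_sum)
qed

lemma quadratic_form_hyperbolic_sum:
  "quadratic_form R q \<Longrightarrow> quadratic_form R (orth_sum R (hyperbolic R m) q)"
  by (simp add: quadratic_form_orth_sum)

lemma qeval_vec_zero: "quadratic_form R q \<Longrightarrow> qeval R q (vec_zero R (qdim q)) = \<zero>"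
proof -
  assume "quadratic_form R q"
  moreover have "vec_smult R (qdim q) \<zero> (vec_zero R (qdim q)) = vec_zero R (qdim q)"
    by (auto simp: vec_smult_def vec_zero_def)
  ultimately show ?thesis using qeval_smult[of q \<zero> "vec_zero R (qdim q)"] by simp
qed

lemma isometry_zero:
  assumes "isometry R p q f"
  shows "f (vec_zero R (qdim p)) = vec_zero R (qdim q)"
proof -
  have sz: "vec_smult R n \<zero> x = vec_zero R n" if "x \<in> vecs R n" for n x
    using that by (auto simp: vec_smult_def vec_zero_def fun_eq_iff vecs_D)
  show ?thesis
    using isometryD(4)[OF assms vec_zero_closed zero_closed] isometryD(1)[OF assms vec_zero_closed]
    by (simp add: sz)
qed

lemma anisotropic_isometric:
  assumes "isometric R p q" "anisotropic R p"
  shows "anisotropic R q"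
proof -
  obtain f where f: "isometry R q p f" using isometric_sym[OF assms(1)] by (auto simp: isometric_altdef)
  show ?thesis
    unfolding anisotropic_def
  proof (intro ballI impI)
    fix x assume x: "x \<in> vecs R (qdim q)" "qeval R q x = \<zero>"
    then have "f x = vec_zero R (qdim p)"
      using assms(2) isometryD(1,2)[OF f x(1)] by (simp add: anisotropic_def)
    then have "f x = f (vec_zero R (qdim q))" using isometry_zero[OF f] by simp
    then show "x = vec_zero R (qdim q)"
      using isometryD(5)[OF f x(1)] isometryD(5)[OF f vec_zero_closed] by metis
  qed
qed

lemma not_anisotropic_hyperbolic_sum:
  assumes "quadratic_form R q"
  shows "\<not> anisotropic R (orth_sum R (hyperbolic R (Suc m)) q)"
proof
  let ?p = "orth_sum R (hyperbolic R m) q"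
  let ?n = "qdim ?p"
  let ?v = "vcons (Suc ?n) \<one> (vcons ?n \<one> (vec_zero R ?n))"
  assume a: "anisotropic R (orth_sum R (hyperbolic R (Suc m)) q)"
  have Q: "quadratic_form R ?p" using assms by (simp add: quadratic_form_hyperbolic_sum)
  have "qeval R (orth_sum R (hyperbolic R (Suc m)) q) ?v = \<zero>"
    unfolding orth_sum_hyperbolic_Suc
    using Q qeval_consq[of \<one> "consq R (\<ominus> \<one>) ?p" \<one> "vcons ?n \<one> (vec_zero R ?n)"]
    by (simp add: qeval_consq qeval_vec_zero r_neg)
  moreover have "?v \<in> vecs R (qdim (orth_sum R (hyperbolic R (Suc m)) q))"
    unfolding orth_sum_hyperbolic_Suc by simp
  ultimately have "?v = vec_zero R (Suc (Suc ?n))"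
    using a unfolding anisotropic_def by (auto simp: orth_sum_hyperbolic_Suc simp del: hyperbolic.simps)
  then show False by (simp add: vec_zero_Suc vcons_inject[where K = R])
qed

end

context field_not2
begin

text \<open>Witt cancellation removes a plane from both sides until one side is a bare anisotropic
  form, and then the other cannot contain a plane either. This is the uniqueness behind the definite
  description in \<open>witt_index\<close>.\<close>

lemma hyperbolic_sum_unique:
  assumes "quadratic_form R p" "quadratic_form R q" "anisotropic R p" "anisotropic R q"
    and "isometric R (orth_sum R (hyperbolic R m) p) (orth_sum R (hyperbolic R k) q)"
  shows "m = k"
  using assms(5)
proof (induction m arbitrary: k)
  case 0
  then have "isometric R p (orth_sum R (hyperbolic R k) q)" by (simp add: orth_sum_zero_left)
  then have "anisotropic R (orth_sum R (hyperbolic R k) q)"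
    using assms(3) by (rule anisotropic_isometric)
  then show ?case using not_anisotropic_hyperbolic_sum[OF assms(2)] by (cases k) auto
next
  case (Suc m)
  show ?case
  proof (cases k)
    case 0
    then have "isometric R (orth_sum R (hyperbolic R (Suc m)) p) q"
      using Suc.prems by (simp add: orth_sum_zero_left del: hyperbolic.simps(2))
    from anisotropic_isometric[OF isometric_sym[OF this] assms(4)]
    have "anisotropic R (orth_sum R (hyperbolic R (Suc m)) p)" .
    then show ?thesis using not_anisotropic_hyperbolic_sum[OF assms(1)] by blast
  next
    case (Suc k')
    let ?p = "orth_sum R (hyperbolic R m) p" and ?q = "orth_sum R (hyperbolic R k') q"
    have Q: "quadratic_form R ?p" "quadratic_form R ?q"
      using assms(1,2) by (simp_all add: quadratic_form_hyperbolic_sum)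
    have "isometric R (consq R \<one> (consq R (\<ominus> \<one>) ?p)) (consq R \<one> (consq R (\<ominus> \<one>) ?q))"
      using Suc.prems unfolding Suc orth_sum_hyperbolic_Suc .
    then have "isometric R (consq R (\<ominus> \<one>) ?p) (consq R (\<ominus> \<one>) ?q)"
      by (rule witt_cancellation[rotated -1]) (use Q in auto)
    then have "isometric R ?p ?q"
      by (rule witt_cancellation[rotated -1]) (use Q in auto)
    then show ?thesis using Suc.IH Suc by simp
  qed
qed

lemma witt_index_eqI:
  assumes "quadratic_form R p" "regular_form R q" "anisotropic R q"
    "isometric R p (orth_sum R (hyperbolic R m) q)"
  shows "witt_index R p = m"
  unfolding witt_index_def
proof (rule the_equality)
  show "\<exists>q_an. regular_form R q_an \<and> anisotropic R q_an \<and> isometric R p (orth_sum R (hyperbolic R m) q_an)"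
    using assms by blast
next
  fix k assume "\<exists>q_an. regular_form R q_an \<and> anisotropic R q_an \<and> isometric R p (orth_sum R (hyperbolic R k) q_an)"
  then obtain s where s: "regular_form R s" "anisotropic R s" "isometric R p (orth_sum R (hyperbolic R k) s)"
    by blast
  have "isometric R (orth_sum R (hyperbolic R k) s) (orth_sum R (hyperbolic R m) q)"
    using isometric_trans[OF isometric_sym[OF s(3)] assms(4)] .
  then show "k = m"
    using s(1,2) assms(2,3) by (intro hyperbolic_sum_unique) (auto simp: regular_form_def)
qed

lemma witt_index_anisotropic:
  "regular_form R q \<Longrightarrow> anisotropic R q \<Longrightarrow> witt_index R q = 0"
  by (rule witt_index_eqI[of _ q]) (auto simp: regular_form_def orth_sum_zero_left isometric_refl)

section \<open>Splitting hyperbolic planes off diagonal forms\<close>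

lemma isometric_diagq_move:
  assumes "a \<in> carrier R" "set us \<subseteq> carrier R" "set vs \<subseteq> carrier R"
  shows "isometric R (diagq R (us @ a # vs)) (diagq R (a # us @ vs))"
  using assms(2)
proof (induction us)
  case Nil
  then show ?case by (simp add: isometric_refl)
next
  case (Cons b us)
  have "isometric R (diagq R (b # us @ a # vs)) (diagq R (b # a # us @ vs))"
    using Cons assms by (auto intro!: isometric_consq)
  moreover have "isometric R (diagq R (b # a # us @ vs)) (diagq R (a # b # us @ vs))"
    using Cons assms by (auto intro!: isometric_swap)
  ultimately show ?case using isometric_trans by simp
qed

text \<open>Later rearrangements of diagonal entries are reduced by this to identities between
  multisets.\<close>

lemma isometric_diagq_perm:
  assumes "mset us = mset vs" "set us \<subseteq> carrier R"
  shows "isometric R (diagq R us) (diagq R vs)"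
  using assms
proof (induction us arbitrary: vs)
  case Nil
  then show ?case by (simp add: isometric_refl)
next
  case (Cons a us)
  then have "a \<in> set vs" by (metis list.set_intros(1) set_mset_mset)
  then obtain vs1 vs2 where vs: "vs = vs1 @ a # vs2" by (auto dest: split_list)
  have m: "mset us = mset (vs1 @ vs2)" using Cons.prems(1) by (simp add: vs)
  have s: "set us \<subseteq> carrier R" "a \<in> carrier R" "set (vs1 @ vs2) \<subseteq> carrier R"
    using Cons.prems(2) mset_eq_setD[OF m] by auto
  have "isometric R (diagq R (a # us)) (diagq R (a # vs1 @ vs2))"
    using Cons.IH[OF m s(1)] s by (auto intro!: isometric_consq)
  moreover have "isometric R (diagq R (a # vs1 @ vs2)) (diagq R vs)"
    unfolding vs using s by (intro isometric_sym[OF isometric_diagq_move]) auto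
  ultimately show ?case by (rule isometric_trans)
qed

text \<open>
  Satisfied by all nonzero elements, which yields the Witt decomposition, and, by Hensel's lemma, by the units
  of a discretely valued field inside its completion.
\<close>

definition hensel_units :: "'a set \<Rightarrow> bool" where
  "hensel_units U \<longleftrightarrow> U \<subseteq> carrier R - {\<zero>} \<and> (\<forall>a\<in>U. \<forall>b\<in>U. a \<otimes> b \<in> U \<and>
     (a \<oplus> b \<in> U \<or> (\<exists>c\<in>carrier R. c \<noteq> \<zero> \<and> c \<otimes> c = \<ominus> (a \<otimes> b))))"

text \<open>If -ab = c^2, then b = -a (c/a)^2, so b may be replaced by -a.\<close>

lemma isometric_hyperbolic_pair:
  assumes "a \<in> carrier R" "b \<in> carrier R" "c \<in> carrier R" "a \<noteq> \<zero>" "c \<noteq> \<zero>" "c \<otimes> c = \<ominus> (a \<otimes> b)"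
    "quadratic_form R p"
  shows "isometric R (consq R a (consq R b p)) (consq R \<one> (consq R (\<ominus> \<one>) p))"
proof -
  define e where "e = inv a"
  have e: "e \<in> carrier R" "e \<otimes> a = \<one>"
    unfolding e_def using assms field_Units by auto
  have e0: "e \<noteq> \<zero>" using e assms by auto
  have "(\<ominus> a) \<otimes> ((c \<otimes> e) \<otimes> (c \<otimes> e)) = \<ominus> ((c \<otimes> c) \<otimes> e \<otimes> (e \<otimes> a))"
    using assms(1-3) e(1) by algebra
  also have "\<dots> = \<ominus> ((\<ominus> (a \<otimes> b)) \<otimes> e \<otimes> (e \<otimes> a))" by (simp only: assms(6))
  also have "\<dots> = (e \<otimes> a) \<otimes> b \<otimes> (e \<otimes> a)" using assms(1,2) e(1) by algebra
  also have "\<dots> = b" using e assms by simp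
  finally have b: "b = (\<ominus> a) \<otimes> ((c \<otimes> e) \<otimes> (c \<otimes> e))" ..
  have "isometric R (consq R b p) (consq R (\<ominus> a) p)"
    unfolding b using assms e e0 integral[of c e] by (intro isometric_scale) auto
  then have "isometric R (consq R a (consq R b p)) (consq R a (consq R (\<ominus> a) p))"
    using assms by (intro isometric_consq) auto
  then show ?thesis
    using isometric_hyperbolic[of a p] assms isometric_trans by blast
qed

text \<open>Two summands a and b are merged by \<open>isometric_merge\<close>: a + b stays in
  \<open>as\<close>, whose sum is unchanged, and ab(a + b) joins \<open>bs\<close>. The process
  meets a pair for which -ab is a square, since a single remaining summand would put the sum into
  \<open>U\<close>.\<close>

lemma split_hyperbolic_of_sum:
  assumes U: "hensel_units U" and "as \<noteq> []" "set as \<subseteq> U" "set bs \<subseteq> U" "foldr (\<oplus>) as \<zero> \<notin> U"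
  shows "\<exists>cs. set cs \<subseteq> U \<and> length cs + 2 = length as + length bs \<and>
    isometric R (diagq R (as @ bs)) (diagq R (\<one> # (\<ominus> \<one>) # cs))"
  using assms(2-)
proof (induction "length as" arbitrary: as bs rule: less_induct)
  case less
  have Uc: "a \<in> carrier R" "a \<noteq> \<zero>" if "a \<in> U" for a using U that by (auto simp: hensel_units_def)
  obtain a as' where as: "as = a # as'" using less.prems(1) by (cases as) auto
  have a: "a \<in> U" using less.prems as by simp
  show ?case
  proof (cases as')
    case Nil
    then show ?thesis using less.prems as a Uc by simp
  next
    case (Cons b as'')
    have b: "b \<in> U" and rest: "set as'' \<subseteq> U" using less.prems as Cons by auto
    have restc: "set as'' \<subseteq> carrier R" "set bs \<subseteq> carrier R" using rest less.prems(3) Uc by auto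
    have fc: "foldr (\<oplus>) xs \<zero> \<in> carrier R" if "set xs \<subseteq> carrier R" for xs
      using that by (induction xs) auto
    consider "a \<oplus> b \<in> U" | c where "c \<in> carrier R" "c \<noteq> \<zero>" "c \<otimes> c = \<ominus> (a \<otimes> b)"
      using U a b unfolding hensel_units_def by blast
    then show ?thesis
    proof cases
      case 1
      define d where "d = a \<otimes> b \<otimes> (a \<oplus> b)"
      have d: "d \<in> U" using U a b 1 unfolding d_def hensel_units_def by blast
      have "isometric R (consq R a (consq R b (diagq R (as'' @ bs))))
         (consq R (a \<oplus> b) (consq R d (diagq R (as'' @ bs))))"
        unfolding d_def using Uc a b 1 restc by (intro isometric_sym[OF isometric_merge]) auto
      then have i1: "isometric R (diagq R (as @ bs)) (diagq R ((a \<oplus> b) # d # as'' @ bs))"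
        by (simp add: as Cons)
      have i2: "isometric R (diagq R ((a \<oplus> b) # d # as'' @ bs)) (diagq R (((a \<oplus> b) # as'') @ d # bs))"
        using Uc a b 1 d restc by (intro isometric_diagq_perm) auto
      have "foldr (\<oplus>) ((a \<oplus> b) # as'') \<zero> = foldr (\<oplus>) as \<zero>"
        using Uc a b fc[OF restc(1)] by (simp add: as Cons a_assoc)
      then obtain cs where cs: "set cs \<subseteq> U" "length cs + 2 = length ((a \<oplus> b) # as'') + length (d # bs)"
        "isometric R (diagq R (((a \<oplus> b) # as'') @ d # bs)) (diagq R (\<one> # (\<ominus> \<one>) # cs))"
        using less.hyps[of "(a \<oplus> b) # as''" "d # bs"] less.prems 1 d rest as Cons by auto
      then show ?thesis
        using isometric_trans[OF i1 isometric_trans[OF i2 cs(3)]] by (intro exI[of _ cs]) (auto simp: as Cons)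
    next
      case 2
      have "isometric R (diagq R (as @ bs)) (diagq R (\<one> # (\<ominus> \<one>) # (as'' @ bs)))"
        using isometric_hyperbolic_pair[of a b c "diagq R (as'' @ bs)"] 2 Uc a b restc
        by (simp add: as Cons)
      then show ?thesis using rest less.prems(3)
        by (intro exI[of _ "as'' @ bs"]) (auto simp: as Cons)
    qed
  qed
qed

text \<open>Absorbing each coordinate c into its entry u as a square factor turns the value of the
  form at a vector into a plain sum of entries, as \<open>split_hyperbolic_of_sum\<close> needs
  it.\<close>

lemma isometric_diagq_scale:
  assumes "set (map fst ps) \<subseteq> carrier R" "set (map snd ps) \<subseteq> carrier R - {\<zero>}" "set bs \<subseteq> carrier R"
  shows "isometric R (diagq R (map fst ps @ bs)) (diagq R (map (\<lambda>(u, c). u \<otimes> (c \<otimes> c)) ps @ bs))"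
  using assms
proof (induction ps)
  case Nil
  then show ?case by (simp add: isometric_refl)
next
  case (Cons pr ps)
  obtain u c where pr: "pr = (u, c)" by (cases pr)
  let ?D = "diagq R (map fst ps @ bs)" and ?D' = "diagq R (map (\<lambda>(u, c). u \<otimes> (c \<otimes> c)) ps @ bs)"
  have "u \<otimes> (c \<otimes> c) \<in> carrier R" if "(u, c) \<in> set ps" for u c
  proof -
    have "u \<in> set (map fst (pr # ps))" "c \<in> set (map snd (pr # ps))" using that by force+
    then show ?thesis using Cons.prems(1,2) by blast
  qed
  then have set': "set (map (\<lambda>(u, c). u \<otimes> (c \<otimes> c)) ps @ bs) \<subseteq> carrier R"
    using Cons.prems(3) by auto
  have Q: "quadratic_form R ?D" "quadratic_form R ?D'"
    using Cons.prems set' by (auto intro!: quadratic_form_diagq)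
  have u: "u \<in> carrier R" "c \<in> carrier R - {\<zero>}" using Cons.prems pr by auto
  have "isometric R (consq R u ?D) (consq R u ?D')"
    using Cons u Q by (intro isometric_consq) auto
  moreover have "isometric R (consq R u ?D') (consq R (u \<otimes> (c \<otimes> c)) ?D')"
    using u Q by (intro isometric_sym[OF isometric_scale]) auto
  ultimately show ?case using isometric_trans by (simp add: pr)
qed

text \<open>
  The coordinates \<open>c\<close> of a vector that is isotropic modulo the complement of \<open>U\<close> must lie in \<open>U\<close>. They are therefore
  listed only where they do, and the other entries of the form are in \<open>bs\<close>.
\<close>

lemma split_hyperbolic:
  assumes U: "hensel_units U" and "ps \<noteq> []" "set (map fst ps) \<subseteq> U" "set (map snd ps) \<subseteq> U"
    "set bs \<subseteq> U" "foldr (\<oplus>) (map (\<lambda>(u, c). u \<otimes> (c \<otimes> c)) ps) \<zero> \<notin> U"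
  shows "\<exists>cs. set cs \<subseteq> U \<and> length cs + 2 = length ps + length bs \<and>
    isometric R (diagq R (map fst ps @ bs)) (diagq R (\<one> # (\<ominus> \<one>) # cs))"
proof -
  have Uc: "U \<subseteq> carrier R - {\<zero>}" using U by (simp add: hensel_units_def)
  let ?as = "map (\<lambda>(u, c). u \<otimes> (c \<otimes> c)) ps"
  have "u \<otimes> (c \<otimes> c) \<in> U" if "(u, c) \<in> set ps" for u c
  proof -
    have "u \<in> set (map fst ps)" "c \<in> set (map snd ps)" using that by force+
    then show ?thesis using U assms(3,4) unfolding hensel_units_def by blast
  qed
  then have "set ?as \<subseteq> U" by auto
  then obtain cs where cs: "set cs \<subseteq> U" "length cs + 2 = length ?as + length bs"
    "isometric R (diagq R (?as @ bs)) (diagq R (\<one> # (\<ominus> \<one>) # cs))"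
    using split_hyperbolic_of_sum[OF U, of ?as bs] assms by auto
  have "isometric R (diagq R (map fst ps @ bs)) (diagq R (?as @ bs))"
    using Uc assms by (intro isometric_diagq_scale) auto
  from isometric_trans[OF this cs(3)] cs show ?thesis by auto
qed

end

section \<open>Regularity and values of diagonal forms\<close>

context field
begin

lemma regular_form_consq:
  assumes "a \<in> carrier R" "a \<noteq> \<zero>" "regular_form R p"
  shows "regular_form R (consq R a p)"
proof -
  have Q: "quadratic_form R p" using assms by (simp add: regular_form_def)
  have z: "qbilin R p x (vec_zero R (qdim p)) = \<zero>" if "x \<in> vecs R (qdim p)" for x
  proof -
    have "vec_smult R (qdim p) \<zero> x = vec_zero R (qdim p)"
      using that by (auto simp: vec_smult_def vec_zero_def fun_eq_iff vecs_D)
    then show ?thesis using qbilin_smult_right[OF Q zero_closed that that] Q that by simp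
  qed
  have "c = \<zero> \<and> x = vec_zero R (qdim p)"
    if c: "c \<in> carrier R" and x: "x \<in> vecs R (qdim p)"
      and h: "\<And>d y. d \<in> carrier R \<Longrightarrow> y \<in> vecs R (qdim p) \<Longrightarrow> a \<otimes> (c \<otimes> d) \<oplus> qbilin R p x y = \<zero>" for c x
  proof
    have "a \<otimes> c = \<zero>" using h[of \<one> "vec_zero R (qdim p)"] assms c z[OF x] by simp
    then show "c = \<zero>" using assms c integral by blast
    have "qbilin R p x y = \<zero>" if "y \<in> vecs R (qdim p)" for y
      using h[of \<zero> y] that assms c x Q by simp
    then show "x = vec_zero R (qdim p)" using assms(3) x by (simp add: regular_form_def)
  qed
  note key = this
  have "v = vec_zero R (Suc (qdim p))"
    if v: "v \<in> vecs R (Suc (qdim p))"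
      and h: "\<And>w. w \<in> vecs R (Suc (qdim p)) \<Longrightarrow> qbilin R (consq R a p) v w = \<zero>" for v
  proof -
    obtain c x where cx: "c \<in> carrier R" "x \<in> vecs R (qdim p)" "v = vcons (qdim p) c x"
      using v by (auto elim: vecs_SucE)
    have "c = \<zero> \<and> x = vec_zero R (qdim p)"
      using h[OF vcons_closed] cx assms(1) Q by (intro key) (auto simp: qbilin_consq)
    then show ?thesis by (simp add: cx vec_zero_Suc)
  qed
  then show ?thesis using assms(1) Q by (simp add: regular_form_def)
qed

lemma regular_form_diagq: "set us \<subseteq> carrier R - {\<zero>} \<Longrightarrow> regular_form R (diagq R us)"
proof (induction us)
  case Nil
  then show ?case by (auto simp: regular_form_def quadratic_form_def vecs_def vec_zero_def)
qed (auto intro!: regular_form_consq)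

text \<open>Separates the entries met by nonzero coordinates, listed in \<open>ps\<close> together
  with these coordinates, from the others in \<open>bs\<close>. The multiset equation allows both
  kinds to be interleaved in \<open>us\<close>.\<close>

lemma qeval_diagq_support:
  assumes "set us \<subseteq> carrier R" "x \<in> vecs R (length us)"
  shows "\<exists>ps bs. mset us = mset (map fst ps @ bs) \<and> set (map snd ps) \<subseteq> carrier R - {\<zero>} \<and>
    qeval R (diagq R us) x = foldr (\<oplus>) (map (\<lambda>(u, c). u \<otimes> (c \<otimes> c)) ps) \<zero> \<and>
    (ps = [] \<longrightarrow> x = vec_zero R (length us))"
  using assms
proof (induction us arbitrary: x)
  case Nil
  then have "x = vec_zero R 0" by (auto simp: vecs_def vec_zero_def)
  then show ?case by (intro exI[of _ "[]"]) (auto simp: qeval_def qbilin_def)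
next
  case (Cons a us)
  obtain c y where cy: "c \<in> carrier R" "y \<in> vecs R (length us)" "x = vcons (length us) c y"
    using Cons.prems(2) by (auto elim: vecs_SucE)
  obtain ps bs where ps: "mset us = mset (map fst ps @ bs)" "set (map snd ps) \<subseteq> carrier R - {\<zero>}"
    "qeval R (diagq R us) y = foldr (\<oplus>) (map (\<lambda>(u, c). u \<otimes> (c \<otimes> c)) ps) \<zero>"
    "ps = [] \<longrightarrow> y = vec_zero R (length us)"
    using Cons.IH[OF _ cy(2)] Cons.prems(1) by auto
  have q: "qeval R (diagq R (a # us)) x = a \<otimes> (c \<otimes> c) \<oplus> qeval R (diagq R us) y"
    using Cons.prems(1) cy qeval_consq[of a "diagq R us" c y] by simp
  show ?case
  proof (cases "c = \<zero>")
    case True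
    have "qeval R (diagq R us) y \<in> carrier R" using Cons.prems(1) cy by simp
    then have "qeval R (diagq R (a # us)) x = qeval R (diagq R us) y"
      using True q Cons.prems(1) by simp
    then show ?thesis using ps cy True
      by (intro exI[of _ ps] exI[of _ "a # bs"]) (auto simp: vec_zero_Suc)
  next
    case False
    then show ?thesis using ps cy q
      by (intro exI[of _ "(a, c) # ps"] exI[of _ bs]) auto
  qed
qed

end

section \<open>Witt decomposition and lower bounds for the Witt index\<close>

context field_not2
begin

lemma isometric_hyperbolic_sum:
  assumes "quadratic_form R p" "quadratic_form R q" "isometric R p q"
  shows "isometric R (orth_sum R (hyperbolic R m) p) (orth_sum R (hyperbolic R m) q)"
proof (induction m)
  case (Suc m)
  then show ?case unfolding orth_sum_hyperbolic_Suc using assms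
    by (intro isometric_consq) (auto simp: quadratic_form_hyperbolic_sum)
qed (use assms in \<open>simp add: orth_sum_zero_left\<close>)

lemma hyperbolic_sum_add:
  "orth_sum R (hyperbolic R m) (orth_sum R (hyperbolic R k) p) = orth_sum R (hyperbolic R (m + k)) p"
proof (induction m)
  case (Suc m)
  then show ?case by (simp only: add_Suc orth_sum_hyperbolic_Suc)
qed (simp add: orth_sum_zero_left)

text \<open>If a + b = 0, then -ab = a^2.\<close>

lemma hensel_units_nonzero: "hensel_units (carrier R - {\<zero>})"
  unfolding hensel_units_def
proof (intro conjI ballI)
  fix a b assume ab: "a \<in> carrier R - {\<zero>}" "b \<in> carrier R - {\<zero>}"
  show "a \<oplus> b \<in> carrier R - {\<zero>} \<or> (\<exists>c\<in>carrier R. c \<noteq> \<zero> \<and> c \<otimes> c = \<ominus> (a \<otimes> b))"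
  proof (cases "a \<oplus> b = \<zero>")
    case True
    then have "b = \<ominus> a" using ab minus_equality[of b a] by (simp add: a_comm)
    then show ?thesis using ab by (auto simp: r_minus)
  qed (use ab in auto)
qed (auto simp: integral_iff)

lemma isometric_split_hyperbolic:
  assumes U: "hensel_units U" and us: "set us \<subseteq> U"
    and ps: "mset us = mset (map fst ps @ bs)" "set (map snd ps) \<subseteq> U" "ps \<noteq> []"
      "foldr (\<oplus>) (map (\<lambda>(u, c). u \<otimes> (c \<otimes> c)) ps) \<zero> \<notin> U"
  shows "\<exists>cs. set cs \<subseteq> U \<and> length cs + 2 = length us \<and>
    isometric R (diagq R us) (orth_sum R (hyperbolic R 1) (diagq R cs))"
proof -
  have Uc: "U \<subseteq> carrier R - {\<zero>}" using U by (simp add: hensel_units_def)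
  have "set us = set (map fst ps @ bs)" using ps(1) by (rule mset_eq_setD)
  then have s: "set (map fst ps) \<subseteq> U" "set bs \<subseteq> U" using us by auto
  obtain cs where cs: "set cs \<subseteq> U" "length cs + 2 = length ps + length bs"
    "isometric R (diagq R (map fst ps @ bs)) (diagq R (\<one> # (\<ominus> \<one>) # cs))"
    using split_hyperbolic[OF U ps(3) s(1) ps(2) s(2) ps(4)] by blast
  have "length us = length ps + length bs" using mset_eq_length[OF ps(1)] by simp
  moreover have "isometric R (diagq R us) (diagq R (map fst ps @ bs))"
    using ps(1) us Uc by (intro isometric_diagq_perm) auto
  ultimately show ?thesis
    using isometric_trans[OF _ cs(3)] cs
    by (intro exI[of _ cs]) (auto simp: orth_sum_hyperbolic_Suc orth_sum_zero_left simp del: hyperbolic.simps(2))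
qed

text \<open>Each isotropic vector splits off a plane and leaves a list shorter by two.\<close>

lemma witt_decomposition:
  assumes "set us \<subseteq> carrier R - {\<zero>}"
  shows "\<exists>m cs. set cs \<subseteq> carrier R - {\<zero>} \<and> anisotropic R (diagq R cs) \<and>
    isometric R (diagq R us) (orth_sum R (hyperbolic R m) (diagq R cs))"
  using assms
proof (induction "length us" arbitrary: us rule: less_induct)
  case less
  show ?case
  proof (cases "anisotropic R (diagq R us)")
    case True
    then show ?thesis using less.prems
      by (intro exI[of _ 0] exI[of _ us]) (auto simp: orth_sum_zero_left isometric_refl)
  next
    case False
    then obtain x where x: "x \<in> vecs R (length us)" "qeval R (diagq R us) x = \<zero>" "x \<noteq> vec_zero R (length us)"
      by (auto simp: anisotropic_def)
    obtain ps bs where ps: "mset us = mset (map fst ps @ bs)" "set (map snd ps) \<subseteq> carrier R - {\<zero>}"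
      "\<zero> = foldr (\<oplus>) (map (\<lambda>(u, c). u \<otimes> (c \<otimes> c)) ps) \<zero>" "ps \<noteq> []"
      using qeval_diagq_support[of us x] less.prems x by auto
    obtain cs where cs: "set cs \<subseteq> carrier R - {\<zero>}" "length cs + 2 = length us"
      "isometric R (diagq R us) (orth_sum R (hyperbolic R 1) (diagq R cs))"
      using isometric_split_hyperbolic[OF hensel_units_nonzero less.prems ps(1,2,4)] ps(3) by auto
    obtain m ds where ds: "set ds \<subseteq> carrier R - {\<zero>}" "anisotropic R (diagq R ds)"
      "isometric R (diagq R cs) (orth_sum R (hyperbolic R m) (diagq R ds))"
      using less.hyps[of cs] cs by auto
    have "isometric R (orth_sum R (hyperbolic R 1) (diagq R cs))
        (orth_sum R (hyperbolic R 1) (orth_sum R (hyperbolic R m) (diagq R ds)))"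
      using cs ds by (intro isometric_hyperbolic_sum) (auto simp: quadratic_form_hyperbolic_sum subset_Diff_insert)
    then show ?thesis
      using ds isometric_trans[OF cs(3)] by (auto simp only: hyperbolic_sum_add)
  qed
qed

text \<open>The remaining form \<open>diagq R cs\<close> may still be isotropic; decomposing it
  further only adds planes.\<close>

lemma witt_index_ge:
  assumes "set us \<subseteq> carrier R" "set cs \<subseteq> carrier R - {\<zero>}"
    "isometric R (diagq R us) (orth_sum R (hyperbolic R m) (diagq R cs))"
  shows "m \<le> witt_index R (diagq R us)"
proof -
  obtain k ds where ds: "set ds \<subseteq> carrier R - {\<zero>}" "anisotropic R (diagq R ds)"
      "isometric R (diagq R cs) (orth_sum R (hyperbolic R k) (diagq R ds))"
    using witt_decomposition[OF assms(2)] by blast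
  have "isometric R (orth_sum R (hyperbolic R m) (diagq R cs))
      (orth_sum R (hyperbolic R m) (orth_sum R (hyperbolic R k) (diagq R ds)))"
    using assms(2) ds by (intro isometric_hyperbolic_sum) (auto simp: quadratic_form_hyperbolic_sum subset_Diff_insert)
  from isometric_trans[OF assms(3) this]
  have "isometric R (diagq R us) (orth_sum R (hyperbolic R (m + k)) (diagq R ds))"
    by (simp only: hyperbolic_sum_add)
  then have "witt_index R (diagq R us) = m + k"
    using ds assms(1) by (intro witt_index_eqI) (auto simp: regular_form_diagq)
  then show ?thesis by simp
qed

lemma witt_index_ge_pairs:
  assumes us: "mset us = mset (concat (map (\<lambda>(a, b). [a, b]) prs) @ cs)"
      "set us \<subseteq> carrier R - {\<zero>}"
    and prs: "\<And>a b. (a, b) \<in> set prs \<Longrightarrow> \<exists>c\<in>carrier R. c \<otimes> c = \<ominus> (a \<otimes> b)"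
  shows "length prs \<le> witt_index R (diagq R us)"
proof -
  have s: "set us = set (concat (map (\<lambda>(a, b). [a, b]) prs) @ cs)" using us(1) by (rule mset_eq_setD)
  have "isometric R (diagq R (concat (map (\<lambda>(a, b). [a, b]) prs) @ cs))
      (orth_sum R (hyperbolic R (length prs)) (diagq R cs))"
    if "set (concat (map (\<lambda>(a, b). [a, b]) prs) @ cs) \<subseteq> carrier R - {\<zero>}"
      "\<And>a b. (a, b) \<in> set prs \<Longrightarrow> \<exists>c\<in>carrier R. c \<otimes> c = \<ominus> (a \<otimes> b)"
    using that
  proof (induction prs)
    case Nil
    then show ?case by (simp add: orth_sum_zero_left isometric_refl)
  next
    case (Cons pr prs)
    obtain a b where pr: "pr = (a, b)" by (cases pr)
    let ?D = "diagq R (concat (map (\<lambda>(a, b). [a, b]) prs) @ cs)"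
    let ?H = "orth_sum R (hyperbolic R (length prs)) (diagq R cs)"
    have ab: "a \<in> carrier R" "b \<in> carrier R" "a \<noteq> \<zero>" "b \<noteq> \<zero>" using Cons.prems(1) by (auto simp: pr)
    have D: "quadratic_form R ?D" "quadratic_form R ?H"
    proof -
      have "set (concat (map (\<lambda>(a, b). [a, b]) prs) @ cs) \<subseteq> carrier R" "set cs \<subseteq> carrier R"
        using Cons.prems(1) by (simp_all only: list.map concat.simps set_append) blast+
      then show "quadratic_form R ?D" "quadratic_form R ?H"
        by (simp_all only: quadratic_form_diagq quadratic_form_hyperbolic_sum)
    qed
    obtain c where c: "c \<in> carrier R" "c \<otimes> c = \<ominus> (a \<otimes> b)" using Cons.prems(2)[of a b] pr by auto
    have "c \<noteq> \<zero>"
    proof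
      assume "c = \<zero>"
      then have "\<ominus> (a \<otimes> b) = \<zero>" using c by simp
      then have "a \<otimes> b = \<zero>" using ab by (metis m_closed minus_minus minus_zero)
      then show False using ab integral by blast
    qed
    then have 1: "isometric R (consq R a (consq R b ?D)) (consq R \<one> (consq R (\<ominus> \<one>) ?D))"
      using ab c D by (intro isometric_hyperbolic_pair[of a b c]) auto
    have "isometric R ?D ?H" using Cons by simp
    then have "isometric R (consq R \<one> (consq R (\<ominus> \<one>) ?D)) (consq R \<one> (consq R (\<ominus> \<one>) ?H))"
      using D by (intro isometric_consq) auto
    from isometric_trans[OF 1 this] show ?case
      by (simp add: pr orth_sum_hyperbolic_Suc del: hyperbolic.simps(2))
  qed
  from this[OF _ prs] have i: "isometric R (diagq R (concat (map (\<lambda>(a, b). [a, b]) prs) @ cs))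
      (orth_sum R (hyperbolic R (length prs)) (diagq R cs))"
    using us(2) s by simp
  have "isometric R (diagq R us) (diagq R (concat (map (\<lambda>(a, b). [a, b]) prs) @ cs))"
    using us by (intro isometric_diagq_perm) auto
  note iso = isometric_trans[OF this i]
  have "set us \<subseteq> carrier R" "set cs \<subseteq> carrier R - {\<zero>}"
    using us(2) s by (simp_all only: set_append) blast+
  then show ?thesis using iso by (rule witt_index_ge)
qed

text \<open>A plane can be split off as long as more than \<open>k\<close> entries are left. The
  numerical condition says that before the last of m \<ge> 1 splittings there are still
  \<open>length us - 2 * (m - 1)\<close>, hence more than \<open>k\<close>, entries, all of them in
  \<open>U\<close>.\<close>

lemma witt_index_ge_units:
  assumes U: "hensel_units U"
    and split: "\<And>us. set us \<subseteq> U \<Longrightarrow> k < length us \<Longrightarrow>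
      \<exists>ps bs. mset us = mset (map fst ps @ bs) \<and> set (map snd ps) \<subseteq> U \<and> ps \<noteq> [] \<and>
        foldr (\<oplus>) (map (\<lambda>(u, c). u \<otimes> (c \<otimes> c)) ps) \<zero> \<notin> U"
    and us: "set us \<subseteq> U" "k + 2 * m < length us + 2"
  shows "m \<le> witt_index R (diagq R us)"
proof -
  have Uc: "U \<subseteq> carrier R - {\<zero>}" using U by (simp add: hensel_units_def)
  have "\<exists>cs. set cs \<subseteq> U \<and> isometric R (diagq R us) (orth_sum R (hyperbolic R m) (diagq R cs))"
    using us
  proof (induction m arbitrary: us)
    case 0
    then show ?case by (intro exI[of _ us]) (simp add: orth_sum_zero_left isometric_refl)
  next
    case (Suc m)
    obtain ps bs where ps: "mset us = mset (map fst ps @ bs)" "set (map snd ps) \<subseteq> U" "ps \<noteq> []"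
        "foldr (\<oplus>) (map (\<lambda>(u, c). u \<otimes> (c \<otimes> c)) ps) \<zero> \<notin> U"
      using split[OF Suc.prems(1)] Suc.prems(2) by auto
    obtain cs where cs: "set cs \<subseteq> U" "length cs + 2 = length us"
      "isometric R (diagq R us) (orth_sum R (hyperbolic R 1) (diagq R cs))"
      using isometric_split_hyperbolic[OF U Suc.prems(1) ps] by blast
    obtain ds where ds: "set ds \<subseteq> U" "isometric R (diagq R cs) (orth_sum R (hyperbolic R m) (diagq R ds))"
      using Suc.IH[OF cs(1)] cs(2) Suc.prems(2) by auto
    have "isometric R (orth_sum R (hyperbolic R 1) (diagq R cs))
      (orth_sum R (hyperbolic R 1) (orth_sum R (hyperbolic R m) (diagq R ds)))"
      using cs ds Uc by (intro isometric_hyperbolic_sum) (auto simp: quadratic_form_hyperbolic_sum subset_iff)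
    from isometric_trans[OF cs(3) this] show ?case
      using ds(1) by (auto simp only: hyperbolic_sum_add plus_1_eq_Suc)
  qed
  then show ?thesis using us(1) Uc witt_index_ge by blast
qed

end

section \<open>Completions and Hensel's lemma\<close>

text \<open>A subset of a type class field as a ring record: computations use type class arithmetic,
  and only membership in \<open>A\<close> has to be tracked.\<close>

definition subring_of :: "'b::field set \<Rightarrow> 'b ring" where
  "subring_of A = ring_of_type_algebra\<lparr>carrier := A\<rparr>"

lemma subring_of_simps [simp]:
  "carrier (subring_of A) = A" "x \<otimes>\<^bsub>subring_of A\<^esub> y = x * y" "x \<oplus>\<^bsub>subring_of A\<^esub> y = x + y"
  "\<one>\<^bsub>subring_of A\<^esub> = 1" "\<zero>\<^bsub>subring_of A\<^esub> = 0"
  by (simp_all add: subring_of_def ring_of_type_algebra_def)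

locale type_subfield =
  fixes A :: "'b::field set"
  assumes one_mem: "1 \<in> A"
    and diff_mem: "x \<in> A \<Longrightarrow> y \<in> A \<Longrightarrow> x - y \<in> A"
    and divide_mem: "x \<in> A \<Longrightarrow> y \<in> A \<Longrightarrow> y \<noteq> 0 \<Longrightarrow> x / y \<in> A"
begin

lemma zero_mem: "0 \<in> A" using diff_mem[OF one_mem one_mem] by simp
lemma uminus_mem: "x \<in> A \<Longrightarrow> - x \<in> A" using diff_mem[OF zero_mem] by force
lemma add_mem: "x \<in> A \<Longrightarrow> y \<in> A \<Longrightarrow> x + y \<in> A" using diff_mem[OF _ uminus_mem] by force
lemma inverse_mem: "x \<in> A \<Longrightarrow> inverse x \<in> A"
  using divide_mem[OF one_mem] zero_mem by (cases "x = 0") (auto simp: field_simps)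
lemma mult_mem: "x \<in> A \<Longrightarrow> y \<in> A \<Longrightarrow> x * y \<in> A"
  using divide_mem[OF _ inverse_mem] zero_mem by (cases "y = 0") (auto simp: field_simps)
lemma sum_mem: "(\<And>i. i \<in> I \<Longrightarrow> f i \<in> A) \<Longrightarrow> sum f I \<in> A"
  by (induction I rule: infinite_finite_induct) (auto simp: zero_mem add_mem)
lemma power_mem: "x \<in> A \<Longrightarrow> x ^ n \<in> A"
  by (induction n) (auto simp: one_mem mult_mem)

lemmas mems [simp] = one_mem zero_mem uminus_mem add_mem diff_mem mult_mem inverse_mem power_mem

lemma div_mem [simp]: "x \<in> A \<Longrightarrow> y \<in> A \<Longrightarrow> x / y \<in> A"
  by (simp add: divide_inverse)

lemma field_subring_of: "field (subring_of A)"
proof -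
  have "cring (subring_of A)"
  proof (rule cringI)
    show "abelian_group (subring_of A)"
    proof (rule abelian_groupI)
      show "\<exists>y\<in>carrier (subring_of A). y \<oplus>\<^bsub>subring_of A\<^esub> x = \<zero>\<^bsub>subring_of A\<^esub>"
        if "x \<in> carrier (subring_of A)" for x
        using that by (intro bexI[of _ "- x"]) auto
    qed (auto simp: algebra_simps)
    show "Group.comm_monoid (subring_of A)"
      by (rule comm_monoidI) (auto simp: algebra_simps)
  qed (auto simp: algebra_simps)
  then interpret cring "subring_of A" .
  show ?thesis
  proof (rule cring_fieldI2)
    show "\<exists>b\<in>carrier (subring_of A). a \<otimes>\<^bsub>subring_of A\<^esub> b = \<one>\<^bsub>subring_of A\<^esub>"
      if "a \<in> carrier (subring_of A)" "a \<noteq> \<zero>\<^bsub>subring_of A\<^esub>" for a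
      using that by (intro bexI[of _ "inverse a"]) auto
  qed auto
qed

lemma a_inv_subring_of [simp]: "x \<in> A \<Longrightarrow> \<ominus>\<^bsub>subring_of A\<^esub> x = - x"
proof -
  interpret field "subring_of A" by (rule field_subring_of)
  assume "x \<in> A"
  then show ?thesis using minus_equality[of "- x" x] by simp
qed

lemma a_minus_subring_of [simp]: "x \<in> A \<Longrightarrow> y \<in> A \<Longrightarrow> x \<ominus>\<^bsub>subring_of A\<^esub> y = x - y"
  by (simp add: a_minus_def)

end

text \<open>The condition \<open>v 2 = 0\<close> means residue characteristic different from 2; the
  square roots of Hensel's lemma are found by dividing by 2.\<close>

locale valued_subfield = type_subfield A for A :: "'b::field set" +
  fixes v :: "'b \<Rightarrow> int"
  assumes val: "discrete_valuation (subring_of A) v"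
    and two_neq_zero: "(2::'b) \<noteq> 0"
    and val_two: "v 2 = 0"
begin

abbreviation K where "K \<equiv> subring_of A"

section \<open>Calculus of valuations\<close>

definition vge :: "int \<Rightarrow> 'b \<Rightarrow> bool" where "vge N x \<longleftrightarrow> x = 0 \<or> N \<le> v x"

lemma val_ge_iff: "val_ge K v N x \<longleftrightarrow> vge N x"
  by (simp add: val_ge_def vge_def)

lemma val_mult: "x \<in> A \<Longrightarrow> y \<in> A \<Longrightarrow> x \<noteq> 0 \<Longrightarrow> y \<noteq> 0 \<Longrightarrow> v (x * y) = v x + v y"
  and val_add: "x \<in> A \<Longrightarrow> y \<in> A \<Longrightarrow> x \<noteq> 0 \<Longrightarrow> y \<noteq> 0 \<Longrightarrow> x + y \<noteq> 0 \<Longrightarrow> min (v x) (v y) \<le> v (x + y)"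
  using val by (auto simp: discrete_valuation_def)

lemma val_one [simp]: "v 1 = 0"
  using val_mult[of 1 1] by simp

lemma val_minus [simp]: "x \<in> A \<Longrightarrow> v (- x) = v x"
proof -
  assume x: "x \<in> A"
  have "v (-1) = 0" using val_mult[of "-1" "-1"] by simp
  then show ?thesis using val_mult[of "-1" x] x by (cases "x = 0") auto
qed

lemma val_inverse: "x \<in> A \<Longrightarrow> x \<noteq> 0 \<Longrightarrow> v (inverse x) = - v x"
  using val_mult[of x "inverse x"] by simp

lemma val_divide: "x \<in> A \<Longrightarrow> y \<in> A \<Longrightarrow> x \<noteq> 0 \<Longrightarrow> y \<noteq> 0 \<Longrightarrow> v (x / y) = v x - v y"
  using val_mult[of x "inverse y"] val_inverse[of y] by (simp add: divide_inverse)

lemma vge_zero [simp]: "vge N 0" by (simp add: vge_def)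

lemma vge_val: "vge (v x) x" by (simp add: vge_def)

lemma vge_mono: "vge N x \<Longrightarrow> M \<le> N \<Longrightarrow> vge M x" by (auto simp: vge_def)

lemma vge_add: "x \<in> A \<Longrightarrow> y \<in> A \<Longrightarrow> vge N x \<Longrightarrow> vge N y \<Longrightarrow> vge N (x + y)"
  using val_add[of x y] by (cases "x = 0"; cases "y = 0"; cases "x + y = 0") (auto simp: vge_def)

lemma vge_minus: "x \<in> A \<Longrightarrow> vge N (- x) \<longleftrightarrow> vge N x" by (auto simp: vge_def)

lemma vge_diff: "x \<in> A \<Longrightarrow> y \<in> A \<Longrightarrow> vge N x \<Longrightarrow> vge N y \<Longrightarrow> vge N (x - y)"
  using vge_add[of x "- y" N] by (simp add: vge_minus)

lemma vge_mult: "x \<in> A \<Longrightarrow> y \<in> A \<Longrightarrow> vge M x \<Longrightarrow> vge N y \<Longrightarrow> vge (M + N) (x * y)"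
  using val_mult[of x y] by (auto simp: vge_def)

lemma vge_mult0: "x \<in> A \<Longrightarrow> y \<in> A \<Longrightarrow> vge 0 x \<Longrightarrow> vge N y \<Longrightarrow> vge N (x * y)"
  using vge_mult[of x y 0 N] by simp

lemma vge_sum: "(\<And>i. i \<in> I \<Longrightarrow> f i \<in> A \<and> vge N (f i)) \<Longrightarrow> vge N (sum f I)"
proof (induction I rule: infinite_finite_induct)
  case (insert x F)
  then show ?case using vge_add[of "f x" "sum f F" N] sum_mem[of F f] by auto
qed auto

text \<open>If x + y had value above v x, then so would x = (x + y) - y.\<close>

lemma val_add_dominant:
  assumes "x \<in> A" "y \<in> A" "x \<noteq> 0" "vge (v x + 1) y"
  shows "x + y \<noteq> 0 \<and> v (x + y) = v x"
proof -
  have vx: "vge (v x) (x + y)" using assms vge_mono[OF assms(4)] by (intro vge_add) (auto simp: vge_val)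
  have n: "\<not> vge (v x + 1) (x + y)"
  proof
    assume "vge (v x + 1) (x + y)"
    then have "vge (v x + 1) (x + y - y)" using assms by (intro vge_diff) auto
    then show False using assms by (simp add: vge_def)
  qed
  then have "x + y \<noteq> 0" by auto
  with vx n show ?thesis by (auto simp: vge_def)
qed

section \<open>Cauchy sequences modulo null sequences\<close>

abbreviation C where "C \<equiv> cauchy_ring K v"
abbreviation I where "I \<equiv> null_seqs K v"

lemma C_simps [simp]:
  "s \<otimes>\<^bsub>C\<^esub> t = (\<lambda>n. s n * t n)" "s \<oplus>\<^bsub>C\<^esub> t = (\<lambda>n. s n + t n)" "\<one>\<^bsub>C\<^esub> = (\<lambda>n. 1)" "\<zero>\<^bsub>C\<^esub> = (\<lambda>n. 0)"
  by (simp_all add: cauchy_ring_def)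

lemma C_carrier: "s \<in> carrier C \<longleftrightarrow>
    (\<forall>n. s n \<in> A) \<and> (\<forall>N. \<exists>M. \<forall>m\<ge>M. \<forall>n\<ge>M. vge N (s m - s n))"
proof -
  have "(\<forall>n. s n \<in> A) \<Longrightarrow> val_ge K v N (s m \<ominus>\<^bsub>K\<^esub> s n) = vge N (s m - s n)" for N m n
    by (simp add: val_ge_iff)
  then show ?thesis by (auto simp: cauchy_ring_def)
qed

lemma I_iff: "s \<in> I \<longleftrightarrow> (\<forall>n. s n \<in> A) \<and> (\<forall>N. \<exists>M. \<forall>n\<ge>M. vge N (s n))"
  by (simp add: null_seqs_def val_ge_iff)

lemma const_mem: "a \<in> A \<Longrightarrow> (\<lambda>n. a) \<in> carrier C"
  by (simp add: C_carrier)

lemma cauchy_bounded: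
  assumes "s \<in> carrier C"
  obtains B where "\<And>n. vge B (s n)"
proof -
  have s: "s n \<in> A" for n using assms by (simp add: C_carrier)
  obtain M where M: "\<And>m n. m \<ge> M \<Longrightarrow> n \<ge> M \<Longrightarrow> vge 0 (s m - s n)"
    using assms unfolding C_carrier by blast
  have fin: "\<exists>B. \<forall>n<k. vge B (s n)" for k
  proof (induction k)
    case (Suc k)
    then obtain B where "\<forall>n<k. vge B (s n)" by blast
    then have "\<forall>n<Suc k. vge (min B (v (s k))) (s n)"
      by (auto simp: less_Suc_eq vge_def)
    then show ?case by blast
  qed auto
  then obtain B where B: "\<And>n. n < M \<Longrightarrow> vge B (s n)" by blast
  have "vge (min B (min 0 (v (s M)))) (s n)" for n
  proof (cases "n < M")
    case True
    then show ?thesis using vge_mono[OF B] by simp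
  next
    case False
    have "vge (min 0 (v (s M))) (s n - s M + s M)"
      using False M[of n M] vge_val[of "s M"] s
      by (intro vge_add) (auto intro: vge_mono)
    then have "vge (min 0 (v (s M))) (s n)" by simp
    then show ?thesis by (rule vge_mono) linarith
  qed
  then show ?thesis using that by blast
qed

lemma add_C: assumes "s \<in> carrier C" "t \<in> carrier C" shows "(\<lambda>n. s n + t n) \<in> carrier C"
  unfolding C_carrier
proof (intro conjI allI)
  fix N
  obtain M M' where "\<And>m n. m \<ge> M \<Longrightarrow> n \<ge> M \<Longrightarrow> vge N (s m - s n)"
    "\<And>m n. m \<ge> M' \<Longrightarrow> n \<ge> M' \<Longrightarrow> vge N (t m - t n)"
    using assms unfolding C_carrier by meson
  then have "vge N ((s m - s n) + (t m - t n))" if "m \<ge> max M M'" "n \<ge> max M M'" for m n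
    using that assms by (intro vge_add) (auto simp: C_carrier)
  then show "\<exists>M. \<forall>m\<ge>M. \<forall>n\<ge>M. vge N (s m + t m - (s n + t n))"
    by (metis add_diff_add)
qed (use assms in \<open>auto simp: C_carrier\<close>)

lemma mult_C: assumes "s \<in> carrier C" "t \<in> carrier C" shows "(\<lambda>n. s n * t n) \<in> carrier C"
  unfolding C_carrier
proof (intro conjI allI)
  fix N
  have sA: "s n \<in> A" "t n \<in> A" for n using assms by (auto simp: C_carrier)
  obtain B where B: "\<And>n. vge B (s n)" using cauchy_bounded assms(1) by blast
  obtain B' where B': "\<And>n. vge B' (t n)" using cauchy_bounded assms(2) by blast
  obtain M M' where M: "\<And>m n. m \<ge> M \<Longrightarrow> n \<ge> M \<Longrightarrow> vge (N - B') (s m - s n)"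
    "\<And>m n. m \<ge> M' \<Longrightarrow> n \<ge> M' \<Longrightarrow> vge (N - B) (t m - t n)"
    using assms unfolding C_carrier by meson
  have "vge N (s m * t m - s n * t n)" if "m \<ge> max M M'" "n \<ge> max M M'" for m n
  proof -
    have "vge (B + (N - B)) (s m * (t m - t n))" using that B M sA by (intro vge_mult) auto
    moreover have "vge ((N - B') + B') ((s m - s n) * t n)" using that B' M sA by (intro vge_mult) auto
    ultimately have "vge N (s m * (t m - t n) + (s m - s n) * t n)" using sA by (intro vge_add) auto
    then show ?thesis by (simp add: algebra_simps)
  qed
  then show "\<exists>M. \<forall>m\<ge>M. \<forall>n\<ge>M. vge N (s m * t m - s n * t n)" by blast
qed (use assms in \<open>auto simp: C_carrier\<close>)

lemma cring_C: "cring C"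
proof (rule cringI)
  show "abelian_group C"
  proof (rule abelian_groupI)
    fix s assume s: "s \<in> carrier C"
    then have "(\<lambda>n. - 1 * s n) \<in> carrier C" by (intro mult_C const_mem) auto
    then show "\<exists>t\<in>carrier C. t \<oplus>\<^bsub>C\<^esub> s = \<zero>\<^bsub>C\<^esub>" by (intro bexI[of _ "\<lambda>n. - 1 * s n"]) auto
  qed (auto simp: add_C const_mem algebra_simps)
  show "Group.comm_monoid C"
    by (rule comm_monoidI) (auto simp: mult_C const_mem algebra_simps)
qed (auto simp: algebra_simps)

sublocale Ci: cring C by (rule cring_C)

lemma a_inv_C: "s \<in> carrier C \<Longrightarrow> \<ominus>\<^bsub>C\<^esub> s = (\<lambda>n. - s n)"
proof -
  assume s: "s \<in> carrier C"
  then have "(\<lambda>n. - 1 * s n) \<in> carrier C" by (intro mult_C const_mem) auto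
  then show ?thesis using Ci.minus_equality[of "\<lambda>n. - s n" s] s by auto
qed

lemma null_C: assumes "s \<in> I" shows "s \<in> carrier C"
  unfolding C_carrier
proof (intro conjI allI)
  fix N
  obtain M where "\<And>n. n \<ge> M \<Longrightarrow> vge N (s n)" using assms unfolding I_iff by blast
  then have "vge N (s m - s n)" if "m \<ge> M" "n \<ge> M" for m n
    using that assms by (intro vge_diff) (auto simp: I_iff)
  then show "\<exists>M. \<forall>m\<ge>M. \<forall>n\<ge>M. vge N (s m - s n)" by blast
qed (use assms in \<open>auto simp: I_iff\<close>)

lemma ideal_I: "ideal I C"
proof (rule idealI)
  show "ring C" by (rule Ci.ring_axioms)
  have mult: "(\<lambda>n. x n * a n) \<in> I" if a: "a \<in> I" and x: "x \<in> carrier C" for a x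
    unfolding I_iff
  proof (intro conjI allI)
    fix N
    have aA: "a n \<in> A" "x n \<in> A" for n using a x by (auto simp: I_iff C_carrier)
    obtain B where B: "\<And>n. vge B (x n)" using cauchy_bounded x by blast
    obtain M where M: "\<And>n. n \<ge> M \<Longrightarrow> vge (N - B) (a n)" using a unfolding I_iff by blast
    have "vge N (x n * a n)" if "n \<ge> M" for n
      using vge_mult[OF aA(2) aA(1) B M[OF that]] by simp
    then show "\<exists>M. \<forall>n\<ge>M. vge N (x n * a n)" by blast
  qed (use a x in \<open>auto simp: I_iff C_carrier\<close>)
  show "x \<otimes>\<^bsub>C\<^esub> a \<in> I" "a \<otimes>\<^bsub>C\<^esub> x \<in> I" if "a \<in> I" "x \<in> carrier C" for a x
    using mult[OF that] by (simp_all add: mult.commute)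
  show "subgroup I (add_monoid C)"
  proof
    show "I \<subseteq> carrier (add_monoid C)" using null_C by auto
    show "\<one>\<^bsub>add_monoid C\<^esub> \<in> I" by (simp add: I_iff)
    show "x \<otimes>\<^bsub>add_monoid C\<^esub> y \<in> I" if xy: "x \<in> I" "y \<in> I" for x y
    proof -
      have "\<exists>M. \<forall>n\<ge>M. vge N (x n + y n)" for N
      proof -
        obtain M M' where "\<And>n. n \<ge> M \<Longrightarrow> vge N (x n)" "\<And>n. n \<ge> M' \<Longrightarrow> vge N (y n)"
          using xy unfolding I_iff by meson
        then show ?thesis using xy by (intro exI[of _ "max M M'"]) (auto intro!: vge_add simp: I_iff)
      qed
      then show ?thesis using xy by (simp add: I_iff)
    qed
    show "inv\<^bsub>add_monoid C\<^esub> x \<in> I" if "x \<in> I" for x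
    proof -
      have "\<ominus>\<^bsub>C\<^esub> x = (\<lambda>n. - 1 * x n)" using a_inv_C[OF null_C[OF that]] by simp
      also have "\<dots> \<in> I" using that by (intro mult const_mem) auto
      finally show ?thesis by (simp add: a_inv_def)
    qed
  qed
qed

abbreviation L where "L \<equiv> completion K v"
abbreviation emb where "emb \<equiv> completion_embed K v"

lemma cring_L: "cring L"
  unfolding completion_def using ideal.quotient_is_cring[OF ideal_I cring_C] .

lemma coset_hom: "(+>\<^bsub>C\<^esub>) I \<in> ring_hom C L"
  unfolding completion_def by (rule ideal.rcos_ring_hom[OF ideal_I])

lemma L_carrierE:
  assumes "a \<in> carrier L" obtains s where "s \<in> carrier C" "a = I +>\<^bsub>C\<^esub> s"
  using assms by (auto simp: completion_def FactRing_def A_RCOSETS_def')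

lemma coset_eq_iff:
  assumes "s \<in> carrier C" "t \<in> carrier C"
  shows "I +>\<^bsub>C\<^esub> s = I +>\<^bsub>C\<^esub> t \<longleftrightarrow> (\<lambda>n. s n - t n) \<in> I"
  using Ci.quotient_eq_iff_same_a_r_cos[OF ideal_I assms] assms
  by (simp add: a_minus_def a_inv_C)

lemma L_zero: "\<zero>\<^bsub>L\<^esub> = I +>\<^bsub>C\<^esub> (\<lambda>n. 0)"
proof -
  interpret L: cring L by (rule cring_L)
  show ?thesis using ring_hom_zero[OF coset_hom Ci.ring_axioms L.ring_axioms] by simp
qed

lemma L_one: "\<one>\<^bsub>L\<^esub> = I +>\<^bsub>C\<^esub> (\<lambda>n. 1)"
  using ring_hom_one[OF coset_hom] by simp

lemma emb_closed [simp]: "a \<in> A \<Longrightarrow> emb a \<in> carrier L"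
  unfolding completion_embed_def by (rule ring_hom_closed[OF coset_hom const_mem])

lemma emb_mult: "a \<in> A \<Longrightarrow> b \<in> A \<Longrightarrow> emb (a * b) = emb a \<otimes>\<^bsub>L\<^esub> emb b"
  and emb_add: "a \<in> A \<Longrightarrow> b \<in> A \<Longrightarrow> emb (a + b) = emb a \<oplus>\<^bsub>L\<^esub> emb b"
  using ring_hom_mult[OF coset_hom const_mem const_mem] ring_hom_add[OF coset_hom const_mem const_mem]
  by (auto simp: completion_embed_def)

lemma emb_one: "emb 1 = \<one>\<^bsub>L\<^esub>" and emb_zero: "emb 0 = \<zero>\<^bsub>L\<^esub>"
  by (simp_all add: completion_embed_def L_one L_zero)

lemma emb_minus: "a \<in> A \<Longrightarrow> emb (- a) = \<ominus>\<^bsub>L\<^esub> emb a"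
proof -
  interpret L: cring L by (rule cring_L)
  assume "a \<in> A"
  then show ?thesis using emb_add[of "- a" a] by (intro L.minus_equality[symmetric]) (auto simp: emb_zero)
qed

lemma emb_eq_iff: "a \<in> A \<Longrightarrow> b \<in> A \<Longrightarrow> emb a = emb b \<longleftrightarrow> a = b"
proof
  assume ab: "a \<in> A" "b \<in> A" "emb a = emb b"
  then have "(\<lambda>n. a - b) \<in> I" by (simp add: completion_embed_def coset_eq_iff const_mem)
  then have "vge (v (a - b) + 1) (a - b)" unfolding I_iff by blast
  then show "a = b" by (simp add: vge_def)
qed simp

text \<open>A Cauchy sequence that is not a null sequence eventually has constant valuation, by the
  ultrametric inequality. Inverting it termwise from there on gives a Cauchy sequence again.\<close>

lemma field_L: "field L"
proof (rule cring.cring_fieldI2[OF cring_L])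
  show "\<zero>\<^bsub>L\<^esub> \<noteq> \<one>\<^bsub>L\<^esub>" using emb_eq_iff[of 0 1] by (simp add: emb_one emb_zero)
next
  fix a assume a: "a \<in> carrier L" "a \<noteq> \<zero>\<^bsub>L\<^esub>"
  then obtain s where s: "s \<in> carrier C" "a = I +>\<^bsub>C\<^esub> s" by (auto elim: L_carrierE)
  have sA: "s n \<in> A" for n using s by (simp add: C_carrier)
  have "s \<notin> I" using a(2) coset_eq_iff[OF s(1), of "\<lambda>n. 0"] s(2) by (auto simp: L_zero const_mem)
  then obtain N where N: "\<And>M. \<exists>n\<ge>M. \<not> vge N (s n)" using sA unfolding I_iff by blast
  obtain M where M: "\<And>m n. m \<ge> M \<Longrightarrow> n \<ge> M \<Longrightarrow> vge N (s m - s n)"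
    using s(1) unfolding C_carrier by blast
  obtain k where k: "k \<ge> M" "\<not> vge N (s k)" using N[of M] by auto
  define d where "d = v (s k)"
  have nz: "s n \<noteq> 0 \<and> v (s n) = d" if "n \<ge> M" for n
  proof -
    have "vge (v (s k) + 1) (s n - s k)"
    proof (rule vge_mono[OF M[OF that k(1)]])
      show "v (s k) + 1 \<le> N" using k(2) by (auto simp: vge_def)
    qed
    then have "s k + (s n - s k) \<noteq> 0 \<and> v (s k + (s n - s k)) = v (s k)"
      using k(2) sA by (intro val_add_dominant) auto
    then show ?thesis by (simp add: d_def)
  qed
  \<comment> \<open>The first terms are set to 0, because they may not be invertible; finitely many
    terms do not affect the class.\<close>
  define t where "t = (\<lambda>n. if n \<ge> M then inverse (s n) else 0)"
  have t: "t \<in> carrier C"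
    unfolding C_carrier
  proof (intro conjI allI)
    show "t n \<in> A" for n using sA by (simp add: t_def)
    fix N
    \<comment> \<open>Passing to inverses divides the difference of two terms by a product of value
      \<open>2 * d\<close>, which is made up for in advance.\<close>
    obtain M' where M': "\<And>m n. m \<ge> M' \<Longrightarrow> n \<ge> M' \<Longrightarrow> vge (N + 2 * d) (s m - s n)"
      using s(1) unfolding C_carrier by blast
    have "vge N (t m - t n)" if mn: "m \<ge> max M M'" "n \<ge> max M M'" for m n
    proof -
      have nz': "s m \<noteq> 0" "s n \<noteq> 0" "v (s m) = d" "v (s n) = d" using nz mn by auto
      have "vge (- d + (- d)) (inverse (s m) * inverse (s n))"
        using nz' sA by (intro vge_mult) (auto simp: vge_def val_inverse)
      then have "vge (- d + (- d) + (N + 2 * d)) (inverse (s m) * inverse (s n) * (s n - s m))"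
        using M'[of n m] mn sA by (intro vge_mult[of "inverse (s m) * inverse (s n)"]) auto
      moreover have "inverse (s m) * inverse (s n) * (s n - s m) = t m - t n"
        using nz' mn by (simp add: t_def field_simps)
      ultimately show ?thesis by simp
    qed
    then show "\<exists>M. \<forall>m\<ge>M. \<forall>n\<ge>M. vge N (t m - t n)" by blast
  qed
  have "(\<lambda>n. s n * t n - 1) \<in> I"
    unfolding I_iff
  proof (intro conjI allI)
    show "s n * t n - 1 \<in> A" for n using sA t by (simp add: C_carrier)
    show "\<exists>M. \<forall>n\<ge>M. vge N (s n * t n - 1)" for N
      using nz by (intro exI[of _ M]) (simp add: t_def)
  qed
  then have "I +>\<^bsub>C\<^esub> (\<lambda>n. s n * t n) = I +>\<^bsub>C\<^esub> (\<lambda>n. 1)"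
    using mult_C[OF s(1) t] by (simp add: coset_eq_iff const_mem)
  then have "a \<otimes>\<^bsub>L\<^esub> (I +>\<^bsub>C\<^esub> t) = \<one>\<^bsub>L\<^esub>"
    using ring_hom_mult[OF coset_hom s(1) t] s(2) by (simp add: L_one)
  moreover have "I +>\<^bsub>C\<^esub> t \<in> carrier L" by (rule ring_hom_closed[OF coset_hom t])
  ultimately show "\<exists>b\<in>carrier L. a \<otimes>\<^bsub>L\<^esub> b = \<one>\<^bsub>L\<^esub>" by blast
qed

sublocale L: field_not2 L
proof -
  interpret L: field L by (rule field_L)
  have "\<one>\<^bsub>L\<^esub> \<oplus>\<^bsub>L\<^esub> \<one>\<^bsub>L\<^esub> \<noteq> \<zero>\<^bsub>L\<^esub>"
    using emb_add[of 1 1] emb_eq_iff[of 2 0] two_neq_zero add_mem[of 1 1] by (simp add: emb_one emb_zero)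
  then show "field_not2 L" by unfold_locales
qed

text \<open>Newton's iteration for y^2 = w with the derivative 2y replaced by 2, which is harmless
  because all iterates are congruent to 1. The bound on the error improves by one in each
  step.\<close>

lemma hensel_square:
  assumes w: "w \<in> A" "vge 1 (w - 1)"
  shows "\<exists>c\<in>carrier L. c \<otimes>\<^bsub>L\<^esub> c = emb w"
proof -
  have two: "2 \<in> A" using add_mem[of 1 1] by simp
  have vh: "vge 0 (inverse 2)" using val_inverse[OF two two_neq_zero] val_two by (simp add: vge_def)
  define s where "s = rec_nat 1 (\<lambda>_ y. y + (w - y * y) * inverse 2)"
  have s0: "s 0 = 1" and sS: "s (Suc n) = s n + (w - s n * s n) * inverse 2" for n by (simp_all add: s_def)
  have sA: "s n \<in> A" for n by (induction n) (use w two in \<open>auto simp: s0 sS\<close>)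
  have inv: "vge 1 (s n - 1) \<and> vge (int n + 1) (w - s n * s n)" for n
  proof (induction n)
    case 0
    then show ?case using w by (simp add: s0)
  next
    case (Suc n)
    define e where "e = w - s n * s n"
    have eA: "e \<in> A" using sA w by (simp add: e_def)
    have e: "vge (int n + 1) e" "vge 1 (s n - 1)" using Suc by (auto simp: e_def)
    define h where "h = e * inverse 2"
    have hA: "h \<in> A" using eA two by (simp add: h_def)
    have he: "vge (int n + 1) h" using vge_mult0[of "inverse 2" e] vh e eA two by (simp add: h_def mult.commute)
    have h1: "vge 1 h" using he by (rule vge_mono) simp
    then have a: "vge 1 ((s n - 1) + h)" using e hA sA by (intro vge_add) auto
    have "vge ((int n + 1) + 1) (e * (1 - s n))"
      using e eA sA vge_minus[of "s n - 1" 1] by (intro vge_mult) auto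
    moreover have "vge ((int n + 1) + 1) (h * h)"
      using hA by (intro vge_mult[OF _ _ he h1]) auto
    ultimately have b: "vge (int (Suc n) + 1) (e * (1 - s n) - h * h)"
      using eA sA hA by (intro vge_diff) (auto simp: add_ac)
    have sh: "s (Suc n) = s n + h" by (simp add: sS h_def e_def)
    \<comment> \<open>With y = \<open>s n\<close> and h = e/2 the next error is e - 2yh - h^2. Both
      terms on the right are small: 1 - y has value at least 1, and so has h.\<close>
    have "w - s (Suc n) * s (Suc n) = e * (1 - s n) - h * h"
    proof -
      have eh: "e = h + h" using two_neq_zero by (simp add: h_def field_simps)
      have "w - (s n + h) * (s n + h) = e - s n * h - s n * h - h * h" by (simp add: e_def algebra_simps)
      also have "\<dots> = e * (1 - s n) - h * h" by (simp add: eh algebra_simps)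
      finally show ?thesis by (simp add: sh)
    qed
    then have "vge (int (Suc n) + 1) (w - s (Suc n) * s (Suc n))" using b by simp
    moreover have "vge 1 (s (Suc n) - 1)" using a by (simp add: sh algebra_simps)
    ultimately show ?case by simp
  qed
  have step: "vge (int n + 1) (s (n + k) - s n)" for n k
  proof (induction k)
    case (Suc k)
    have "vge (int (n + k) + 1) ((w - s (n + k) * s (n + k)) * inverse 2)"
      using vge_mult0[of "inverse 2" "w - s (n + k) * s (n + k)"] vh inv[of "n + k"] sA w two
      by (simp add: mult.commute)
    then have "vge (int n + 1) (s (n + Suc k) - s (n + k))"
      by (simp add: sS vge_mono)
    with Suc have "vge (int n + 1) ((s (n + Suc k) - s (n + k)) + (s (n + k) - s n))"
      using sA by (intro vge_add) auto
    then show ?case by simp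
  qed simp
  have s: "s \<in> carrier C"
    unfolding C_carrier
  proof (intro conjI allI)
    fix N
    have "vge N (s m - s n)" if mn: "m \<ge> nat N" "n \<ge> nat N" for m n
    proof -
      have "vge N (s m - s (nat N))" "vge N (s n - s (nat N))"
        using vge_mono[OF step[of "nat N" "m - nat N"], of N] vge_mono[OF step[of "nat N" "n - nat N"], of N] mn
        by simp_all
      then have "vge N ((s m - s (nat N)) - (s n - s (nat N)))"
        using vge_diff[of "s m - s (nat N)" "s n - s (nat N)" N] sA by simp
      then show ?thesis by simp
    qed
    then show "\<exists>M. \<forall>m\<ge>M. \<forall>n\<ge>M. vge N (s m - s n)" by blast
  qed (rule sA)
  have "(\<lambda>n. s n * s n - w) \<in> I"
    unfolding I_iff
  proof (intro conjI allI)
    fix N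
    have "vge N (s n * s n - w)" if "n \<ge> nat N" for n
    proof -
      have "vge N (w - s n * s n)" using inv[of n] that by (auto intro!: vge_mono[of "int n + 1"])
      then show ?thesis using vge_minus[of "w - s n * s n" N] sA w by simp
    qed
    then show "\<exists>M. \<forall>n\<ge>M. vge N (s n * s n - w)" by blast
  qed (use sA w in auto)
  then have "I +>\<^bsub>C\<^esub> (\<lambda>n. s n * s n) = emb w"
    using mult_C[OF s s] w by (simp add: completion_embed_def coset_eq_iff const_mem)
  then show ?thesis
    using ring_hom_mult[OF coset_hom s s] ring_hom_closed[OF coset_hom s]
    by (intro bexI[of _ "I +>\<^bsub>C\<^esub> s"]) auto
qed

end

section \<open>Units, residues and hyperbolic planes over the completion\<close>

context valued_subfield
begin

definition units :: "'b set" where "units = {a \<in> A. a \<noteq> 0 \<and> v a = 0}"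

lemma units_D: "a \<in> units \<Longrightarrow> a \<in> A" "a \<in> units \<Longrightarrow> a \<noteq> 0" "a \<in> units \<Longrightarrow> v a = 0"
  by (auto simp: units_def)

lemma unit_vge0: "a \<in> units \<Longrightarrow> vge 0 a" by (simp add: units_def vge_def)

lemma vge0_cases: "a \<in> A \<Longrightarrow> vge 0 a \<Longrightarrow> a \<notin> units \<Longrightarrow> vge 1 a"
  by (auto simp: units_def vge_def)

text \<open>Reduces hyperbolicity of a binary form over the completion to an identity in the ground
  field: -ab has to be a square times a 1-unit \<open>w\<close>, whose root exists by
  \<open>hensel_square\<close>.\<close>

lemma emb_square_root:
  assumes "a \<in> A" "b \<in> A" "d \<in> A" "w \<in> A" "vge 1 (w - 1)" "- (a * b) = d * d * w"
  shows "\<exists>c\<in>carrier L. c \<otimes>\<^bsub>L\<^esub> c = \<ominus>\<^bsub>L\<^esub> (emb a \<otimes>\<^bsub>L\<^esub> emb b)"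
proof -
  obtain c where c: "c \<in> carrier L" "c \<otimes>\<^bsub>L\<^esub> c = emb w" using hensel_square assms(4,5) by blast
  have "(emb d \<otimes>\<^bsub>L\<^esub> c) \<otimes>\<^bsub>L\<^esub> (emb d \<otimes>\<^bsub>L\<^esub> c) = (emb d \<otimes>\<^bsub>L\<^esub> emb d) \<otimes>\<^bsub>L\<^esub> (c \<otimes>\<^bsub>L\<^esub> c)"
    using c(1) assms(3) by (simp add: L.m_ac)
  also have "\<dots> = emb (d * d * w)" using c assms by (simp add: emb_mult)
  also have "\<dots> = \<ominus>\<^bsub>L\<^esub> (emb a \<otimes>\<^bsub>L\<^esub> emb b)"
    unfolding assms(6)[symmetric] using assms(1,2) by (simp add: emb_minus emb_mult)
  finally show ?thesis using c assms by (intro bexI[of _ "emb d \<otimes>\<^bsub>L\<^esub> c"]) auto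
qed

lemma emb_nonzero: "a \<in> A \<Longrightarrow> a \<noteq> 0 \<Longrightarrow> emb a \<noteq> \<zero>\<^bsub>L\<^esub>"
  using emb_eq_iff[of a 0] by (simp add: emb_zero)

text \<open>If a + b is not a unit, then -a/b is congruent to 1, so -ab = b^2 (-a/b) is a square in
  the completion.\<close>

lemma hensel_units_emb: "L.hensel_units (emb ` units)"
  unfolding L.hensel_units_def
proof (intro conjI ballI)
  show "emb ` units \<subseteq> carrier L - {\<zero>\<^bsub>L\<^esub>}"
    using units_D emb_nonzero by auto
  fix x y assume "x \<in> emb ` units" "y \<in> emb ` units"
  then obtain a b where ab: "a \<in> units" "b \<in> units" "x = emb a" "y = emb b" by blast
  note u = units_D[OF ab(1)] units_D[OF ab(2)]
  have "a * b \<in> units" using u by (simp add: units_def val_mult)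
  then show "x \<otimes>\<^bsub>L\<^esub> y \<in> emb ` units" using u by (simp add: ab flip: emb_mult)
  show "x \<oplus>\<^bsub>L\<^esub> y \<in> emb ` units \<or>
      (\<exists>c\<in>carrier L. c \<noteq> \<zero>\<^bsub>L\<^esub> \<and> c \<otimes>\<^bsub>L\<^esub> c = \<ominus>\<^bsub>L\<^esub> (x \<otimes>\<^bsub>L\<^esub> y))"
  proof (cases "a + b \<in> units")
    case True
    then show ?thesis using u by (simp add: ab flip: emb_add)
  next
    case False
    have "vge 1 (a + b)"
      using False u unit_vge0 ab by (intro vge0_cases vge_add) auto
    then have "vge (1 + - v b) ((a + b) * inverse b)"
      using u by (intro vge_mult) (auto simp: vge_def val_inverse)
    then have "vge 1 (- ((a + b) * inverse b))" using u by (simp add: vge_minus)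
    moreover have "- ((a + b) * inverse b) = - (a / b) - 1" using u by (simp add: field_simps)
    moreover have "- (a * b) = b * b * (- (a / b))" using u by simp
    ultimately obtain c where c: "c \<in> carrier L" "c \<otimes>\<^bsub>L\<^esub> c = \<ominus>\<^bsub>L\<^esub> (x \<otimes>\<^bsub>L\<^esub> y)"
      using emb_square_root[of a b b "- (a / b)"] u by (auto simp: ab)
    have "c \<noteq> \<zero>\<^bsub>L\<^esub>"
    proof
      assume "c = \<zero>\<^bsub>L\<^esub>"
      then have "emb (- (a * b)) = \<zero>\<^bsub>L\<^esub>" using c u by (simp add: ab emb_mult emb_minus)
      then show False using emb_nonzero[of "- (a * b)"] u by simp
    qed
    with c show ?thesis by blast
  qed
qed

lemma witt_index_pairs:
  assumes us: "mset us = mset (concat (map (\<lambda>(a, b). [a, b]) prs) @ cs)" "set us \<subseteq> A - {0}"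
    and prs: "\<And>a b. (a, b) \<in> set prs \<Longrightarrow> \<exists>d\<in>A. \<exists>w\<in>A. - (a * b) = d * d * w \<and> vge 1 (w - 1)"
  shows "length prs \<le> witt_index L (base_change emb (diagq K us))"
proof -
  have s: "set us = set (concat (map (\<lambda>(a, b). [a, b]) prs) @ cs)" using us(1) by (rule mset_eq_setD)
  let ?P = "map (\<lambda>(a, b). (emb a, emb b)) prs"
  have c: "concat (map (\<lambda>(a, b). [a, b]) ?P) = map emb (concat (map (\<lambda>(a, b). [a, b]) prs))"
    by (induction prs) auto
  have m: "mset (map emb us) = mset (concat (map (\<lambda>(a, b). [a, b]) ?P) @ map emb cs)"
    unfolding c map_append[symmetric] mset_map us(1) ..
  have "length ?P \<le> witt_index L (diagq L (map emb us))"
  proof (rule L.witt_index_ge_pairs[OF m])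
    show "set (map emb us) \<subseteq> carrier L - {\<zero>\<^bsub>L\<^esub>}"
      using us(2) emb_nonzero by auto
    fix a b assume "(a, b) \<in> set ?P"
    then obtain a' b' where ab: "(a', b') \<in> set prs" "a = emb a'" "b = emb b'" by auto
    have "a' \<in> set us" "b' \<in> set us" using ab(1) s by force+
    then have A: "a' \<in> A" "b' \<in> A" using us(2) by auto
    obtain d w where "d \<in> A" "w \<in> A" "- (a' * b') = d * d * w" "vge 1 (w - 1)"
      using prs[OF ab(1)] by blast
    then show "\<exists>c\<in>carrier L. c \<otimes>\<^bsub>L\<^esub> c = \<ominus>\<^bsub>L\<^esub> (a \<otimes>\<^bsub>L\<^esub> b)"
      unfolding ab(2,3) using A by (intro emb_square_root)
  qed
  then show ?thesis by (simp add: base_change_diagq[where L = L] emb_zero)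
qed

text \<open>An element of least positive value. The value group may be a proper subgroup of the
  integers, so v p can exceed 1; the last conclusion bridges the gap between value at least 1 and
  value at least v p.\<close>

lemma uniformizer:
  assumes "\<exists>x\<in>A - {0}. v x \<noteq> 0"
  obtains p where "p \<in> A" "p \<noteq> 0" "0 < v p" "\<And>x. x \<in> A \<Longrightarrow> vge 1 x \<Longrightarrow> vge (v p) x"
proof -
  obtain x where x: "x \<in> A" "x \<noteq> 0" "v x \<noteq> 0" using assms by auto
  have "\<exists>y\<in>A. y \<noteq> 0 \<and> 0 < v y"
    using x val_inverse[of x] by (intro bexI[of _ "if 0 < v x then x else inverse x"]) auto
  then have "\<exists>n y. y \<in> A \<and> y \<noteq> 0 \<and> 0 < v y \<and> nat (v y) = n" by blast
  then obtain y where y: "y \<in> A" "y \<noteq> 0" "0 < v y"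
    and min: "nat (v y) = (LEAST n. \<exists>y. y \<in> A \<and> y \<noteq> 0 \<and> 0 < v y \<and> nat (v y) = n)"
    using LeastI_ex[of "\<lambda>n. \<exists>y. y \<in> A \<and> y \<noteq> 0 \<and> 0 < v y \<and> nat (v y) = n"] by blast
  have "vge (v y) z" if z: "z \<in> A" "vge 1 z" for z
  proof (cases "z = 0")
    case False
    then have "0 < v z" using z by (simp add: vge_def)
    then have "nat (v y) \<le> nat (v z)" unfolding min using z False by (intro Least_le) auto
    then show ?thesis using \<open>0 < v z\<close> by (simp add: vge_def nat_le_eq_zle)
  qed simp
  with y that show ?thesis by blast
qed

text \<open>
  Reducing an isotropic vector of \<open>U \<perp> p U\<close>, with \<open>p\<close> a uniformizer, modulo \<open>p\<close> gives one of the reduction of \<open>U\<close>. So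
  the residue field has half the \<open>u\<close>-invariant, and the residue field itself is not needed.
\<close>

lemma isotropic_mod_uniformizer:
  assumes nontriv: "\<exists>x\<in>A - {0}. v x \<noteq> 0"
    and iso: "\<And>us. set us \<subseteq> A - {0} \<Longrightarrow> 2 * k < length us \<Longrightarrow>
      \<exists>c. (\<forall>i<length us. c i \<in> A) \<and> (\<exists>i<length us. c i \<noteq> 0) \<and> (\<Sum>i<length us. us ! i * (c i)\<^sup>2) = 0"
    and us: "set us \<subseteq> units" "k < length us"
  obtains a where "\<And>i. i < length us \<Longrightarrow> a i \<in> A \<and> vge 0 (a i)" "\<exists>i<length us. a i \<in> units"
    "vge 1 (\<Sum>i<length us. us ! i * (a i)\<^sup>2)"
proof -
  obtain p where p: "p \<in> A" "p \<noteq> 0" "0 < v p" "\<And>x. x \<in> A \<Longrightarrow> vge 1 x \<Longrightarrow> vge (v p) x"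
    using uniformizer[OF nontriv] by blast
  let ?N = "length us"
  let ?us = "us @ map ((*) p) us"
  have uA: "us ! i \<in> A" "us ! i \<noteq> 0" "vge 0 (us ! i)" if "i < ?N" for i
  proof -
    have "us ! i \<in> units" using us(1) nth_mem[OF that] by blast
    then show "us ! i \<in> A" "us ! i \<noteq> 0" "vge 0 (us ! i)" using units_D unit_vge0 by auto
  qed
  have "set ?us \<subseteq> A - {0}" using us(1) p units_D by auto
  then obtain c where c: "\<forall>i<length ?us. c i \<in> A" "\<exists>i<length ?us. c i \<noteq> 0"
      "(\<Sum>i<length ?us. ?us ! i * (c i)\<^sup>2) = 0"
    using iso[of ?us] us(2) by auto
  let ?S = "{i. i < length ?us \<and> c i \<noteq> 0}"
  \<comment> \<open>Dividing by a coordinate of minimal value makes all coordinates integral and one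
    of them a unit.\<close>
  define d where "d = Min ((\<lambda>i. v (c i)) ` ?S)"
  have "d \<in> (\<lambda>i. v (c i)) ` ?S" unfolding d_def using c(2) by (intro Min_in) auto
  then obtain j where j: "j < length ?us" "c j \<noteq> 0" "v (c j) = d" by auto
  have dmin: "vge d (c i)" if "i < length ?us" for i
    using that unfolding d_def vge_def by auto
  define e where "e = (\<lambda>i. c i / c j)"
  have eA: "e i \<in> A" "vge 0 (e i)" if "i < length ?us" for i
  proof -
    show "e i \<in> A" using c(1) that j by (simp add: e_def)
    have "vge (d + - d) (c i * inverse (c j))"
      using c(1) j dmin[OF that] that by (intro vge_mult) (auto simp: vge_def val_inverse)
    then show "vge 0 (e i)" by (simp add: e_def divide_inverse)
  qed
  have ej: "e j \<in> units" using eA[OF j(1)] j by (simp add: e_def units_def)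
  have tot: "(\<Sum>i<length ?us. ?us ! i * (e i)\<^sup>2) = 0"
  proof -
    have "(\<Sum>i<length ?us. ?us ! i * (e i)\<^sup>2) = (\<Sum>i<length ?us. ?us ! i * (c i)\<^sup>2) / (c j)\<^sup>2"
      unfolding sum_divide_distrib by (simp add: e_def power_divide)
    then show ?thesis using c(3) by simp
  qed
  define b where "b = (\<lambda>i. e (i + ?N))"
  have split: "(\<Sum>i<?N. us ! i * (e i)\<^sup>2) + p * (\<Sum>i<?N. us ! i * (b i)\<^sup>2) = 0"
  proof -
    have "(\<Sum>i<?N + ?N. ?us ! i * (e i)\<^sup>2) =
      (\<Sum>i<?N. ?us ! i * (e i)\<^sup>2) + (\<Sum>i<?N. ?us ! (i + ?N) * (e (i + ?N))\<^sup>2)"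
      by (simp add: lessThan_atLeast0 sum.atLeastLessThan_concat[symmetric, of 0 ?N "?N + ?N"]
          sum.shift_bounds_nat_ivl[of _ 0 ?N ?N, simplified])
    also have "(\<Sum>i<?N. ?us ! i * (e i)\<^sup>2) = (\<Sum>i<?N. us ! i * (e i)\<^sup>2)"
      by (intro sum.cong) (auto simp: nth_append)
    also have "(\<Sum>i<?N. ?us ! (i + ?N) * (e (i + ?N))\<^sup>2) = p * (\<Sum>i<?N. us ! i * (b i)\<^sup>2)"
      unfolding sum_distrib_left by (intro sum.cong) (auto simp: nth_append b_def)
    finally show ?thesis using tot by simp
  qed
  have eA': "e i \<in> A" "vge 0 (e i)" "b i \<in> A" "vge 0 (b i)" if "i < ?N" for i
    using eA[of i] eA[of "i + ?N"] that by (auto simp: b_def)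
  have SA: "(\<Sum>i<?N. us ! i * (e i)\<^sup>2) \<in> A" "(\<Sum>i<?N. us ! i * (b i)\<^sup>2) \<in> A"
    using uA eA' by (auto intro!: sum_mem)
  \<comment> \<open>If the first half has a unit coordinate, reducing modulo p discards the second
    half. Otherwise the first sum is divisible by p^2; dividing the relation by p leaves the second
    half, which then contains the unit coordinate.\<close>
  show ?thesis
  proof (cases "\<exists>i<?N. e i \<in> units")
    case True
    have "vge 0 (\<Sum>i<?N. us ! i * (b i)\<^sup>2)"
      using uA eA' by (intro vge_sum) (auto simp: power2_eq_square intro!: vge_mult0)
    then have "vge (v p + 0) (p * (\<Sum>i<?N. us ! i * (b i)\<^sup>2))"
      using SA p(1) vge_val by (intro vge_mult) auto
    then have "vge (v p) (- (\<Sum>i<?N. us ! i * (e i)\<^sup>2))"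
      using split by (simp add: eq_neg_iff_add_eq_0[symmetric] add.commute)
    then have "vge 1 (\<Sum>i<?N. us ! i * (e i)\<^sup>2)" using p(3) SA by (auto simp: vge_minus intro: vge_mono)
    then show ?thesis using that[of e] True eA' by blast
  next
    case False
    have "vge (v p) (e i)" if "i < ?N" for i
      using False eA'[OF that] that by (intro p(4) vge0_cases) auto
    then have "vge (v p + v p) (us ! i * (e i)\<^sup>2)" if "i < ?N" for i
      unfolding power2_eq_square using uA that eA' by (intro vge_mult0 vge_mult) auto
    then have "vge (v p + v p) (\<Sum>i<?N. us ! i * (e i)\<^sup>2)"
      using uA eA' by (intro vge_sum) auto
    then have "vge (v p + v p) (- (p * (\<Sum>i<?N. us ! i * (b i)\<^sup>2)))"
      using split by (simp add: eq_neg_iff_add_eq_0[symmetric])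
    then have "vge (v p + v p) (p * (\<Sum>i<?N. us ! i * (b i)\<^sup>2))" using SA p(1) by (simp add: vge_minus)
    then have "vge (v p) (\<Sum>i<?N. us ! i * (b i)\<^sup>2)"
      using SA p(1,2) val_mult[OF p(1) SA(2)] by (auto simp: vge_def)
    then have "vge 1 (\<Sum>i<?N. us ! i * (b i)\<^sup>2)" using p(3) by (auto intro: vge_mono)
    moreover have "\<exists>i<?N. b i \<in> units"
    proof -
      have "\<not> j < ?N" using False ej by auto
      then show ?thesis using j(1) ej by (intro exI[of _ "j - ?N"]) (auto simp: b_def)
    qed
    ultimately show ?thesis using that[of b] eA' by blast
  qed
qed

lemma foldr_emb: "set xs \<subseteq> A \<Longrightarrow> foldr (\<oplus>\<^bsub>L\<^esub>) (map emb xs) \<zero>\<^bsub>L\<^esub> = emb (sum_list xs) \<and> sum_list xs \<in> A"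
  by (induction xs) (auto simp: emb_zero emb_add)

text \<open>Forms over \<open>A\<close> with more than \<open>2 * k\<close> entries are isotropic,
  so a unit form with more than \<open>k\<close> entries has a zero modulo a uniformizer. This is
  the splitting condition of \<open>witt_index_ge_units\<close>.\<close>

lemma witt_index_units:
  assumes nontriv: "\<exists>x\<in>A - {0}. v x \<noteq> 0"
    and iso: "\<And>us. set us \<subseteq> A - {0} \<Longrightarrow> 2 * k < length us \<Longrightarrow>
      \<exists>c. (\<forall>i<length us. c i \<in> A) \<and> (\<exists>i<length us. c i \<noteq> 0) \<and> (\<Sum>i<length us. us ! i * (c i)\<^sup>2) = 0"
    and us: "set us \<subseteq> units" "k + 2 * m < length us + 2"
  shows "m \<le> witt_index L (base_change emb (diagq K us))"
proof -
  have "m \<le> witt_index L (diagq L (map emb us))"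
  proof (rule L.witt_index_ge_units[OF hensel_units_emb])
    show "set (map emb us) \<subseteq> emb ` units" using us by auto
    show "k + 2 * m < length (map emb us) + 2" using us by simp
    fix ws assume ws: "set ws \<subseteq> emb ` units" "k < length ws"
    have "ws \<in> lists (emb ` units)" using ws(1) by auto
    then obtain us where us: "set us \<subseteq> units" "ws = map emb us" unfolding lists_image by auto
    let ?N = "length us"
    obtain a where a: "\<And>i. i < ?N \<Longrightarrow> a i \<in> A \<and> vge 0 (a i)" "\<exists>i<?N. a i \<in> units"
        "vge 1 (\<Sum>i<?N. us ! i * (a i)\<^sup>2)"
      using isotropic_mod_uniformizer[OF nontriv iso us(1)] ws(2) us(2) by auto
    have uA: "us ! i \<in> A" "us ! i \<in> units" if "i < ?N" for i
    proof -
      show "us ! i \<in> units" using us(1) nth_mem[OF that] by blast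
      then show "us ! i \<in> A" using units_D by auto
    qed
    \<comment> \<open>Only unit coordinates may enter \<open>ps\<close>; leaving out the others
      changes the sum by an element of positive value.\<close>
    let ?J = "filter (\<lambda>i. a i \<in> units) [0..<?N]"
    define ps where "ps = map (\<lambda>i. (emb (us ! i), emb (a i))) ?J"
    define bs where "bs = map (\<lambda>i. emb (us ! i)) (filter (\<lambda>i. a i \<notin> units) [0..<?N])"
    have wsq: "ws = map (\<lambda>i. emb (us ! i)) [0..<?N]"
      unfolding us(2) by (rule nth_equalityI) simp_all
    have part: "mset [0..<?N] = mset ?J + mset (filter (\<lambda>i. a i \<notin> units) [0..<?N])"
      unfolding mset_filter by (rule multiset_partition)
    have m: "mset ws = mset (map fst ps @ bs)"
      unfolding wsq mset_map part ps_def bs_def map_map mset_append image_mset_union comp_def fst_conv ..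
    have s: "set (map snd ps) \<subseteq> emb ` units" by (auto simp: ps_def)
    have ne: "ps \<noteq> []" using a(2) by (auto simp: ps_def filter_empty_conv)
    let ?xs = "map (\<lambda>i. us ! i * (a i)\<^sup>2) ?J"
    have "map (\<lambda>(u, c). u \<otimes>\<^bsub>L\<^esub> (c \<otimes>\<^bsub>L\<^esub> c)) ps = map emb ?xs"
      using uA a(1) by (auto simp: ps_def emb_mult power2_eq_square)
    moreover have xs: "set ?xs \<subseteq> A" using uA a(1) by auto
    ultimately have f: "foldr (\<oplus>\<^bsub>L\<^esub>) (map (\<lambda>(u, c). u \<otimes>\<^bsub>L\<^esub> (c \<otimes>\<^bsub>L\<^esub> c)) ps) \<zero>\<^bsub>L\<^esub> = emb (sum_list ?xs)"
      using foldr_emb[OF xs] by presburger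
    have sl: "sum_list ?xs = (\<Sum>i\<in>{i. i < ?N \<and> a i \<in> units}. us ! i * (a i)\<^sup>2)"
      by (subst sum_list_distinct_conv_sum_set) (auto intro: sum.cong)
    have "vge 1 (\<Sum>i\<in>{i. i < ?N \<and> a i \<notin> units}. us ! i * (a i)\<^sup>2)"
    proof (rule vge_sum)
      fix i assume i: "i \<in> {i. i < ?N \<and> a i \<notin> units}"
      then have "vge 1 (a i)" using a(1) vge0_cases by auto
      then show "us ! i * (a i)\<^sup>2 \<in> A \<and> vge 1 (us ! i * (a i)\<^sup>2)"
        unfolding power2_eq_square using i uA a(1) unit_vge0 by (auto intro!: vge_mult0)
    qed
    moreover have "(\<Sum>i<?N. us ! i * (a i)\<^sup>2) = (\<Sum>i\<in>{i. i < ?N \<and> a i \<in> units}. us ! i * (a i)\<^sup>2)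
        + (\<Sum>i\<in>{i. i < ?N \<and> a i \<notin> units}. us ! i * (a i)\<^sup>2)"
      by (subst sum.union_disjoint[symmetric]) (auto intro!: sum.cong)
    moreover have "(\<Sum>i\<in>{i. i < ?N \<and> a i \<notin> units}. us ! i * (a i)\<^sup>2) \<in> A"
      using uA a(1) by (auto intro!: sum_mem)
    moreover have "(\<Sum>i<?N. us ! i * (a i)\<^sup>2) \<in> A" using uA a(1) by (auto intro!: sum_mem)
    ultimately have v1: "vge 1 (sum_list ?xs)" using vge_diff[OF _ _ a(3)] unfolding sl by force
    have "emb (sum_list ?xs) \<notin> emb ` units"
    proof
      assume "emb (sum_list ?xs) \<in> emb ` units"
      then obtain u where "u \<in> units" "emb (sum_list ?xs) = emb u" by auto
      then have "sum_list ?xs \<in> units" using emb_eq_iff foldr_emb[OF xs] units_D by metis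
      then show False using v1 by (auto simp: units_def vge_def)
    qed
    then show "\<exists>ps bs. mset ws = mset (map fst ps @ bs) \<and> set (map snd ps) \<subseteq> emb ` units \<and> ps \<noteq> [] \<and>
        foldr (\<oplus>\<^bsub>L\<^esub>) (map (\<lambda>(u, c). u \<otimes>\<^bsub>L\<^esub> (c \<otimes>\<^bsub>L\<^esub> c)) ps) \<zero>\<^bsub>L\<^esub> \<notin> emb ` units"
      by (intro exI[of _ ps] exI[of _ bs] conjI m s ne) (simp only: f not_False_eq_True)
  qed
  then show ?thesis by (simp add: base_change_diagq[where L = L] emb_zero)
qed

end

section \<open>Anisotropy over polynomial rings\<close>

text \<open>Entries and coordinates come from a commutative ring, because anisotropy is proved for
  polynomials, where specialising a variable is a total map. It passes to fractions by clearing
  denominators.\<close>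

definition qval :: "'b::comm_ring_1 list \<Rightarrow> 'b list \<Rightarrow> 'b" where
  "qval us cs = (\<Sum>(u, c)\<leftarrow>zip us cs. u * c\<^sup>2)"

definition aniso :: "'b::comm_ring_1 list \<Rightarrow> bool" where
  "aniso us \<longleftrightarrow> (\<forall>cs. length cs = length us \<longrightarrow> qval us cs = 0 \<longrightarrow> set cs \<subseteq> {0})"

lemma qval_Nil [simp]: "qval [] cs = 0"
  and qval_Cons [simp]: "qval (u # us) (c # cs) = u * c\<^sup>2 + qval us cs"
  by (simp_all add: qval_def)

lemma qval_append: "length as = length cs \<Longrightarrow> qval (as @ bs) (cs @ ds) = qval as cs + qval bs ds"
  by (simp add: qval_def)

lemma qval_scale: "length us = length cs \<Longrightarrow> qval (map ((*) t) us) cs = t * qval us cs"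
  by (induction us cs rule: list_induct2) (auto simp: algebra_simps)

lemma qval_smult: "length us = length cs \<Longrightarrow> qval us (map ((*) t) cs) = t\<^sup>2 * qval us cs"
  by (induction us cs rule: list_induct2) (auto simp: algebra_simps power2_eq_square)

lemma qval_hom:
  assumes "e 0 = 0" "\<And>x y. e (x + y) = e x + e y" "\<And>x y. e (x * y) = e x * e y"
    and "length us = length cs"
  shows "e (qval us cs) = qval (map e us) (map e cs)"
  using assms(4) by (induction us cs rule: list_induct2) (auto simp: assms power2_eq_square)

lemma aniso_scale:
  fixes us :: "'b::idom list"
  assumes "aniso us" "t \<noteq> 0"
  shows "aniso (map ((*) t) us)"
  using assms unfolding aniso_def by (auto simp: qval_scale)

lemma aniso_sublist:
  assumes "aniso (as @ us @ bs)"
  shows "aniso us"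
  unfolding aniso_def
proof (intro allI impI)
  fix cs assume cs: "length cs = length us" "qval us cs = 0"
  have z: "qval as (replicate (length as) 0) = 0" for as :: "'a list"
    by (induction as) auto
  have "qval (as @ us @ bs) (replicate (length as) 0 @ cs @ replicate (length bs) 0) = 0"
    using cs by (simp add: qval_append z)
  then have "set (replicate (length as) 0 @ cs @ replicate (length bs) 0) \<subseteq> {0}"
    using assms cs(1) unfolding aniso_def by (metis length_append length_replicate)
  then show "set cs \<subseteq> {0}" by simp
qed

text \<open>Infinite descent: applying \<open>e\<close> shows that the coordinates at
  \<open>as\<close> are divisible by t; after cancelling t the same holds for those at
  \<open>bs\<close>, and the divided vector is again a zero. So every coordinate is divisible by all
  powers of t and vanishes by \<open>krull\<close>.\<close>

lemma aniso_residue_forms: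
  fixes t :: "'b::idom"
  assumes e: "e 0 = 0" "\<And>x y. e (x + y) = e x + e y" "\<And>x y. e (x * y) = e x * e y" "e t = 0"
    and "t \<noteq> 0"
    and dvd: "\<And>p. e p = 0 \<Longrightarrow> t dvd p" and krull: "\<And>p. p \<noteq> 0 \<Longrightarrow> \<exists>n. \<not> t ^ n dvd p"
    and as: "aniso (map e as)" and bs: "aniso (map e bs)"
  shows "aniso (as @ map ((*) t) bs)"
  unfolding aniso_def
proof (intro allI impI)
  fix cs' assume len: "length cs' = length (as @ map ((*) t) bs)" and "qval (as @ map ((*) t) bs) cs' = 0"
  have quot: "\<exists>ds. cs = map ((*) t) ds" if "set (map e cs) \<subseteq> {0}" for cs
  proof -
    have "\<forall>c\<in>set cs. \<exists>d. c = t * d" using that dvd by (auto simp: dvd_def)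
    then show ?thesis by (simp add: ex_map_conv)
  qed
  have main: "length cs = length as \<Longrightarrow> length ds = length bs \<Longrightarrow>
      qval as cs + t * qval bs ds = 0 \<Longrightarrow> \<forall>c\<in>set cs \<union> set ds. t ^ n dvd c" for n cs ds
  proof (induction n arbitrary: cs ds)
    case (Suc n)
    have "e (qval as cs) + e t * e (qval bs ds) = 0"
      using arg_cong[OF Suc.prems(3), of e] by (simp add: e)
    then have "qval (map e as) (map e cs) = 0"
      using qval_hom[of e as cs] Suc.prems(1) e by simp
    then have "set (map e cs) \<subseteq> {0}" using as Suc.prems(1) unfolding aniso_def by (metis length_map)
    then obtain cs1 where cs1: "cs = map ((*) t) cs1" using quot by blast
    have "t * (t * qval as cs1 + qval bs ds) = 0"
      using Suc.prems cs1 by (simp add: qval_smult power2_eq_square algebra_simps)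
    then have q1: "t * qval as cs1 + qval bs ds = 0" using \<open>t \<noteq> 0\<close> by simp
    have "e (t * qval as cs1 + qval bs ds) = 0" by (simp only: q1 e(1))
    then have "e (qval bs ds) = 0" by (simp add: e)
    then have "qval (map e bs) (map e ds) = 0"
      using qval_hom[of e bs ds] Suc.prems(2) e by simp
    then have "set (map e ds) \<subseteq> {0}" using bs Suc.prems(2) unfolding aniso_def by (metis length_map)
    then obtain ds1 where ds1: "ds = map ((*) t) ds1" using quot by blast
    have "t * (qval as cs1 + t * qval bs ds1) = 0"
      using q1 Suc.prems ds1 by (simp add: qval_smult power2_eq_square algebra_simps)
    then have "qval as cs1 + t * qval bs ds1 = 0" using \<open>t \<noteq> 0\<close> by simp
    then have "\<forall>c\<in>set cs1 \<union> set ds1. t ^ n dvd c"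
      using Suc.prems cs1 ds1 by (intro Suc.IH) auto
    then show ?case by (auto simp: cs1 ds1 mult_dvd_mono)
  qed simp
  define cs ds where "cs = take (length as) cs'" and "ds = drop (length as) cs'"
  have "cs' = cs @ ds" "length cs = length as" "length ds = length bs"
    using len by (auto simp: cs_def ds_def)
  moreover from this have "qval as cs + t * qval bs ds = 0"
    using \<open>qval (as @ map ((*) t) bs) cs' = 0\<close> by (simp add: qval_append qval_scale)
  ultimately have "\<forall>n. \<forall>c\<in>set cs'. t ^ n dvd c" using main[of cs ds] by auto
  then show "set cs' \<subseteq> {0}" using krull by blast
qed

section \<open>Specialisation of polynomials in several variables\<close>

lemma mpoly_induct [case_names single add]:
  fixes p :: "'k \<Rightarrow>\<^sub>0 'b::comm_monoid_add"
  assumes single: "\<And>m c. P (Poly_Mapping.single m c)" and add: "\<And>p q. P p \<Longrightarrow> P q \<Longrightarrow> P (p + q)"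
  shows "P p"
proof -
  have z: "P 0" using single[of undefined 0] by (simp only: single_zero)
  have "P (\<Sum>m\<in>F. Poly_Mapping.single m (poly_mapping.lookup p m))" if "finite F" for F
    using that by (induction F rule: finite_induct) (auto simp: z intro: single add)
  moreover have "p = (\<Sum>m\<in>Poly_Mapping.keys p. Poly_Mapping.single m (poly_mapping.lookup p m))"
    by (rule poly_mapping_eqI)
       (auto simp: lookup_sum lookup_single when_def in_keys_iff sum.delta)
  ultimately show ?thesis by (metis finite_keys)
qed

text \<open>The universal map out of a monoid algebra: \<open>g\<close> acts on coefficients and
  \<open>f\<close>, multiplicative in the exponents, on monomials. It yields both the specialisation
  of a variable and the change of coefficients.\<close>

definition mp_hom :: "('b::zero \<Rightarrow> 'c::comm_ring_1) \<Rightarrow> ('k \<Rightarrow> 'c) \<Rightarrow> ('k \<Rightarrow>\<^sub>0 'b) \<Rightarrow> 'c" where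
  "mp_hom g f p = (\<Sum>m\<in>Poly_Mapping.keys p. g (poly_mapping.lookup p m) * f m)"

context
  fixes g :: "'b::comm_ring_1 \<Rightarrow> 'c::comm_ring_1" and f :: "'k::comm_monoid_add \<Rightarrow> 'c"
  assumes g: "g 0 = 0" "g 1 = 1" "\<And>x y. g (x + y) = g x + g y" "\<And>x y. g (x * y) = g x * g y"
    and f: "f 0 = 1" "\<And>m n. f (m + n) = f m * f n"
begin

lemma mp_hom_superset:
  "finite F \<Longrightarrow> Poly_Mapping.keys p \<subseteq> F \<Longrightarrow> mp_hom g f p = (\<Sum>m\<in>F. g (poly_mapping.lookup p m) * f m)"
  unfolding mp_hom_def by (rule sum.mono_neutral_left) (auto simp: in_keys_iff g)

lemma mp_hom_single: "mp_hom g f (Poly_Mapping.single m c) = g c * f m"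
  by (subst mp_hom_superset[of "{m}"]) auto

lemma mp_hom_zero: "mp_hom g f 0 = 0"
  by (simp add: mp_hom_def)

lemma mp_hom_one: "mp_hom g f 1 = 1"
  unfolding single_one[symmetric] mp_hom_single by (simp add: g f)

lemma mp_hom_add: "mp_hom g f (p + q) = mp_hom g f p + mp_hom g f q"
proof -
  let ?F = "Poly_Mapping.keys p \<union> Poly_Mapping.keys q"
  have "Poly_Mapping.keys (p + q) \<subseteq> ?F" by (rule keys_add)
  then show ?thesis
    by (simp add: mp_hom_superset[of ?F] Poly_Mapping.lookup_add g distrib_right sum.distrib)
qed

lemma mp_hom_mult: "mp_hom g f (p * q) = mp_hom g f p * mp_hom g f q"
proof (induction p rule: mpoly_induct)
  case (single m c)
  show ?case
    by (induction q rule: mpoly_induct)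
       (auto simp: mult_single mp_hom_single mp_hom_add g f algebra_simps)
qed (auto simp: mp_hom_add algebra_simps)

end

definition var :: "nat \<Rightarrow> 'a::comm_ring_1 mpoly" where
  "var a = Poly_Mapping.single (Poly_Mapping.single a 1) 1"

definition cst :: "'b::comm_ring_1 \<Rightarrow> (nat \<Rightarrow>\<^sub>0 nat) \<Rightarrow>\<^sub>0 'b" where
  "cst c = Poly_Mapping.single 0 c"

lemma cst_hom: "cst 0 = 0" "cst 1 = 1" "cst (x + y) = cst x + cst y" "cst (x * y) = cst x * cst y"
  by (simp_all add: cst_def Poly_Mapping.single_add mult_single)

text \<open>The variable is set to zero inside the same polynomial ring, so that specialisations in
  several variables can follow each other without a change of type.\<close>

definition eval_zero :: "nat \<Rightarrow> 'a::comm_ring_1 mpoly \<Rightarrow> 'a mpoly" where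
  "eval_zero a = mp_hom cst (\<lambda>m. if poly_mapping.lookup m a = 0 then Poly_Mapping.single m 1 else 0)"

lemma eval_zero_aux:
  fixes a :: nat
  defines "f \<equiv> (\<lambda>m. if poly_mapping.lookup m a = 0 then Poly_Mapping.single m 1 else 0) :: _ \<Rightarrow> 'a::comm_ring_1 mpoly"
  shows "f 0 = 1" "f (m + n) = f m * f n"
  by (auto simp: f_def Poly_Mapping.lookup_add mult_single)

lemma eval_zero_hom:
  "eval_zero a 0 = 0" "eval_zero a (p + q) = eval_zero a p + eval_zero a q"
  "eval_zero a (p * q) = eval_zero a p * eval_zero a q" "eval_zero a 1 = 1"
  unfolding eval_zero_def
  by (rule mp_hom_zero mp_hom_add mp_hom_mult mp_hom_one; rule cst_hom eval_zero_aux)+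

lemma eval_zero_single:
  "eval_zero a (Poly_Mapping.single m c) = (if poly_mapping.lookup m a = 0 then Poly_Mapping.single m c else 0)"
  unfolding eval_zero_def mp_hom_single[where g = cst, OF cst_hom eval_zero_aux]
  by (auto simp: mult_single cst_def)

lemma eval_zero_var: "eval_zero a (var b) = (if a = b then 0 else var b)"
  by (simp add: var_def eval_zero_single lookup_single when_def)

lemma lookup_eval_zero: "poly_mapping.lookup (eval_zero a p) m = (if poly_mapping.lookup m a = 0 then poly_mapping.lookup p m else 0)"
  by (induction p rule: mpoly_induct)
     (auto simp: eval_zero_single eval_zero_hom Poly_Mapping.lookup_add lookup_single when_def)

text \<open>Every monomial of p contains the variable, and lowering its exponent by one in each of
  them gives the quotient.\<close>

lemma var_dvd_of_eval_zero:
  assumes "eval_zero a p = 0"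
  shows "var a dvd p"
proof -
  let ?q = "\<Sum>m\<in>Poly_Mapping.keys p. Poly_Mapping.single (m - Poly_Mapping.single a 1) (poly_mapping.lookup p m)"
  have pos: "poly_mapping.lookup m a > 0" if "m \<in> Poly_Mapping.keys p" for m
    using lookup_eval_zero[of a p m] that assms by (auto simp: in_keys_iff split: if_splits)
  have m: "Poly_Mapping.single a 1 + (m - Poly_Mapping.single a 1) = m" if "m \<in> Poly_Mapping.keys p" for m
    using pos[OF that] by (intro poly_mapping_eqI) (auto simp: Poly_Mapping.lookup_add lookup_minus lookup_single when_def)
  have "var a * ?q = (\<Sum>m\<in>Poly_Mapping.keys p. Poly_Mapping.single m (poly_mapping.lookup p m))"
    unfolding sum_distrib_left var_def by (intro sum.cong) (auto simp: mult_single m simp del: One_nat_def)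
  also have "\<dots> = p"
    by (rule poly_mapping_eqI)
       (auto simp: lookup_sum lookup_single when_def in_keys_iff sum.delta)
  finally show ?thesis by (metis dvd_triv_left)
qed

lemma var_power: "var a ^ n = (Poly_Mapping.single (Poly_Mapping.single a n) 1 :: 'a::comm_ring_1 mpoly)"
  by (induction n) (auto simp: var_def mult_single Poly_Mapping.single_add[symmetric])

lemma var_power_not_dvd:
  assumes "p \<noteq> 0"
  shows "\<exists>n. \<not> var a ^ n dvd p"
proof -
  obtain m where m: "m \<in> Poly_Mapping.keys p" using assms keys_eq_empty by blast
  have "\<not> var a ^ Suc (poly_mapping.lookup m a) dvd p"
  proof
    assume "var a ^ Suc (poly_mapping.lookup m a) dvd p"
    then obtain q where "p = var a ^ Suc (poly_mapping.lookup m a) * q" by (auto simp: dvd_def)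
    then have "m \<in> Poly_Mapping.keys (var a ^ Suc (poly_mapping.lookup m a) * q)" using m by simp
    then obtain k l where kl: "m = k + l" "k \<in> Poly_Mapping.keys (var a ^ Suc (poly_mapping.lookup m a) :: 'a mpoly)"
      using keys_mult[of "var a ^ Suc (poly_mapping.lookup m a)" q] by blast
    then have "k = Poly_Mapping.single a (Suc (poly_mapping.lookup m a))"
      unfolding var_power by (auto split: if_splits)
    with kl have "m = Poly_Mapping.single a (Suc (poly_mapping.lookup m a)) + l" by simp
    then have "poly_mapping.lookup m a = poly_mapping.lookup (Poly_Mapping.single a (Suc (poly_mapping.lookup m a)) + l) a" by simp
    then show False by (simp add: Poly_Mapping.lookup_add)
  qed
  then show ?thesis by blast
qed

lemma var_nonzero: "var a \<noteq> (0 :: 'a::comm_ring_1 mpoly)"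
proof
  assume "var a = (0 :: 'a mpoly)"
  then have "poly_mapping.lookup (var a :: 'a mpoly) (Poly_Mapping.single a 1) = 0" by simp
  then show False by (simp add: var_def)
qed

lemma aniso_var:
  fixes as bs :: "'a::idom mpoly list"
  assumes "aniso (map (eval_zero a) as)" "aniso (map (eval_zero a) bs)"
  shows "aniso (as @ map ((*) (var a)) bs)"
  by (rule aniso_residue_forms[of "eval_zero a"])
     (use assms in \<open>auto simp: eval_zero_hom eval_zero_var var_nonzero var_dvd_of_eval_zero var_power_not_dvd\<close>)

text \<open>The order on exponents is linear and compatible with addition, so a sum of two exponents
  that are at most m equals m + m only if both are m.\<close>

lemma lookup_square_top:
  fixes p :: "'a::comm_ring_1 mpoly"
  assumes "\<And>k. k \<in> Poly_Mapping.keys p \<Longrightarrow> k \<le> m"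
  shows "poly_mapping.lookup (p * p) (m + m) = poly_mapping.lookup p m * poly_mapping.lookup p m"
proof -
  have z: "poly_mapping.lookup p l * (poly_mapping.lookup p q when m + m = l + q) = (poly_mapping.lookup p m * poly_mapping.lookup p m when l = m \<and> q = m)" for l q
  proof (cases "poly_mapping.lookup p l = 0 \<or> poly_mapping.lookup p q = 0")
    case True
    then show ?thesis by (auto simp: when_def)
  next
    case False
    then have "l \<le> m" "q \<le> m" using assms by (auto simp: in_keys_iff)
    then have "m + m = l + q \<longleftrightarrow> l = m \<and> q = m"
      by (metis add_less_le_mono add_le_less_mono order.not_eq_order_implies_strict less_irrefl)
    then show ?thesis by (auto simp: when_def)
  qed
  have inner: "(\<Sum>q. poly_mapping.lookup p q when m + m = l + q) = (poly_mapping.lookup p m when l = m)" if "poly_mapping.lookup p l \<noteq> 0" for l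
  proof -
    have "(poly_mapping.lookup p q when m + m = l + q) = (poly_mapping.lookup p m when l = m when q = m)" for q
    proof (cases "poly_mapping.lookup p q = 0")
      case True
      then show ?thesis by (auto simp: when_def)
    next
      case False
      with that have "l \<le> m" "q \<le> m" using assms by (auto simp: in_keys_iff)
      then have "m + m = l + q \<longleftrightarrow> l = m \<and> q = m"
        by (metis add_less_le_mono add_le_less_mono order.not_eq_order_implies_strict less_irrefl)
      then show ?thesis by (auto simp: when_def)
    qed
    then show ?thesis by simp
  qed
  have "poly_mapping.lookup p l * (\<Sum>q. poly_mapping.lookup p q when m + m = l + q) = (poly_mapping.lookup p m * poly_mapping.lookup p m when l = m)" for l
    using inner[of l] by (cases "poly_mapping.lookup p l = 0") (auto simp: when_def)
  then show ?thesis by (simp add: lookup_mult)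
qed

lemma lookup_cst_mult: "poly_mapping.lookup (cst c * p) m = c * poly_mapping.lookup p m"
  by (induction p rule: mpoly_induct)
     (auto simp: cst_def mult_single lookup_single when_def Poly_Mapping.lookup_add algebra_simps)

text \<open>Let m be the largest monomial in any of the coordinates. The coefficient of the value at
  m + m is the value of the form at the coefficients of m, so these would be a nontrivial zero over
  the constants.\<close>

lemma aniso_cst:
  fixes us :: "'a::idom list"
  assumes "aniso us"
  shows "aniso (map cst us)"
  unfolding aniso_def
proof (intro allI impI, rule ccontr)
  fix cs :: "'a mpoly list"
  assume cs: "length cs = length (map cst us)" "qval (map cst us) cs = 0" "\<not> set cs \<subseteq> {0}"
  let ?M = "\<Union>c\<in>set cs. Poly_Mapping.keys c"
  have fin: "finite ?M" by simp
  have ne: "?M \<noteq> {}" using cs(3) by auto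
  define m where "m = Max ?M"
  have top: "k \<le> m" if "c \<in> set cs" "k \<in> Poly_Mapping.keys c" for c k
    unfolding m_def using that fin by (intro Max_ge) auto
  have "poly_mapping.lookup (qval (map cst us) cs) (m + m) = qval us (map (\<lambda>c. poly_mapping.lookup c m) cs)"
  proof -
    have "length us = length cs" using cs(1) by simp
    then show ?thesis using top
    proof (induction us cs rule: list_induct2)
      case (Cons x xs y ys)
      have "poly_mapping.lookup (y * y) (m + m) = poly_mapping.lookup y m * poly_mapping.lookup y m"
        by (rule lookup_square_top) (use Cons.prems in auto)
      moreover have "poly_mapping.lookup (qval (map cst xs) ys) (m + m) =
          qval xs (map (\<lambda>c. poly_mapping.lookup c m) ys)"
        by (rule Cons.IH) (use Cons.prems in auto)
      ultimately show ?case by (simp add: Poly_Mapping.lookup_add lookup_cst_mult power2_eq_square)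
    qed simp
  qed
  then have "qval us (map (\<lambda>c. poly_mapping.lookup c m) cs) = 0" using cs(2) by simp
  then have "set (map (\<lambda>c. poly_mapping.lookup c m) cs) \<subseteq> {0}"
    using assms cs(1) unfolding aniso_def by (metis length_map)
  then have "m \<notin> ?M" by (auto simp: in_keys_iff)
  then show False using Max_in[OF fin ne] by (simp add: m_def)
qed

lemma common_denominator:
  fixes cs :: "'b::idom fract list"
  shows "\<exists>d ps. d \<noteq> 0 \<and> length ps = length cs \<and> map ((*) (Fraction_Field.Fract d 1)) cs = map (\<lambda>p. Fraction_Field.Fract p 1) ps"
proof (induction cs)
  case Nil
  show ?case by (intro exI[of _ 1] exI[of _ "[]"]) auto
next
  case (Cons c cs)
  then obtain d ps where d: "d \<noteq> 0" "length ps = length cs"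
    "map ((*) (Fraction_Field.Fract d 1)) cs = map (\<lambda>p. Fraction_Field.Fract p 1) ps" by blast
  obtain a b where c: "c = Fraction_Field.Fract a b" "b \<noteq> 0" by (cases c rule: Fract_cases) auto
  have "map ((*) (Fraction_Field.Fract (b * d) 1)) cs = map ((*) (Fraction_Field.Fract b 1)) (map ((*) (Fraction_Field.Fract d 1)) cs)"
    by (simp add: mult.assoc[symmetric])
  also have "\<dots> = map (\<lambda>p. Fraction_Field.Fract p 1) (map ((*) b) ps)" by (simp add: d(3))
  finally show ?case using c d
    by (intro exI[of _ "b * d"] exI[of _ "(a * d) # map ((*) b) ps"]) (auto simp: eq_fract)
qed

lemma aniso_fract:
  fixes us :: "'b::idom list"
  assumes "aniso us"
  shows "aniso (map (\<lambda>p. Fraction_Field.Fract p 1) us)"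
  unfolding aniso_def
proof (intro allI impI)
  fix cs :: "'b fract list"
  assume cs: "length cs = length (map (\<lambda>p. Fraction_Field.Fract p 1) us)"
    "qval (map (\<lambda>p. Fraction_Field.Fract p 1) us) cs = 0"
  let ?i = "\<lambda>p. Fraction_Field.Fract p 1"
  obtain d ps where d: "d \<noteq> 0" "length ps = length cs" "map ((*) (?i d)) cs = map ?i ps"
    using common_denominator by blast
  have "?i (qval us ps) = qval (map ?i us) (map ?i ps)"
    using cs d by (intro qval_hom) (auto simp: Zero_fract_def)
  also have "\<dots> = 0" using cs d(3)[symmetric] by (simp add: qval_smult)
  finally have "qval us ps = 0" by (simp add: Zero_fract_def eq_fract)
  then have "set ps \<subseteq> {0}" using assms cs d unfolding aniso_def by (metis length_map)
  then have "set (map ?i ps) \<subseteq> {0}" by (auto simp: Zero_fract_def)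
  then have "set (map ((*) (?i d)) cs) \<subseteq> {0}" unfolding d(3) .
  moreover have "?i d \<noteq> 0" using d(1) by (simp add: Zero_fract_def eq_fract)
  ultimately show "set cs \<subseteq> {0}" by auto
qed

section \<open>Occurring variables and the global form\<close>

lemma eval_zero_id:
  assumes "a \<notin> poly_vars p"
  shows "eval_zero a p = p"
proof (rule poly_mapping_eqI)
  fix k
  have "poly_mapping.lookup p k = 0" if "poly_mapping.lookup k a \<noteq> 0"
    using assms that unfolding poly_vars_def by (metis UN_I in_keys_iff)
  then show "poly_mapping.lookup (eval_zero a p) k = poly_mapping.lookup p k"
    by (simp add: lookup_eval_zero)
qed

lemma poly_vars_cst: "poly_vars (cst c) = {}"
  by (auto simp: poly_vars_def cst_def split: if_splits)

lemma poly_vars_var: "poly_vars (var a :: 'a::comm_ring_1 mpoly) = {a}"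
  by (auto simp: poly_vars_def var_def split: if_splits)

lemma keys_add_nat: "Poly_Mapping.keys (m + n :: nat \<Rightarrow>\<^sub>0 nat) = Poly_Mapping.keys m \<union> Poly_Mapping.keys n"
  by (auto simp: in_keys_iff Poly_Mapping.lookup_add)

lemma poly_vars_add: "poly_vars (p + q) \<subseteq> poly_vars p \<union> poly_vars q"
  using keys_add[of p q] by (auto simp: poly_vars_def)

lemma poly_vars_mult: "poly_vars (p * q) \<subseteq> poly_vars p \<union> poly_vars (q :: 'a::comm_ring_1 mpoly)"
proof
  fix a assume "a \<in> poly_vars (p * q)"
  then obtain m where m: "m \<in> Poly_Mapping.keys (p * q)" "a \<in> Poly_Mapping.keys m" by (auto simp: poly_vars_def)
  then obtain k l where "m = k + l" "k \<in> Poly_Mapping.keys p" "l \<in> Poly_Mapping.keys q"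
    using keys_mult[of p q] by blast
  with m(2) show "a \<in> poly_vars p \<union> poly_vars q" by (auto simp: poly_vars_def keys_add_nat)
qed

lemma poly_vars_uminus: "poly_vars (- p) = poly_vars (p :: 'a::comm_ring_1 mpoly)"
  by (simp add: poly_vars_def in_keys_iff set_eq_iff)

text \<open>The tensor product of the diagonal form \<open>us\<close> with j binary forms, the k-th
  having the entries 1 and \<open>var k\<close>.\<close>

fun multi_double :: "'a::comm_ring_1 list \<Rightarrow> nat \<Rightarrow> 'a mpoly list" where
  "multi_double us 0 = map cst us"
| "multi_double us (Suc j) = multi_double us j @ map ((*) (var (Suc j))) (multi_double us j)"

lemma length_multi_double: "length (multi_double us j) = length us * 2 ^ j"
  by (induction j) auto

lemma poly_vars_multi_double: "p \<in> set (multi_double us j) \<Longrightarrow> poly_vars p \<subseteq> {1..j}"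
proof (induction j arbitrary: p)
  case (Suc j)
  from Suc.prems consider "p \<in> set (multi_double us j)" | q where "q \<in> set (multi_double us j)" "p = var (Suc j) * q"
    by auto
  then show ?case
  proof cases
    case 1
    then show ?thesis using Suc.IH[of p] by auto
  next
    case 2
    have "poly_vars q \<subseteq> {1..Suc j}" using Suc.IH[OF 2(1)] by auto
    moreover have "poly_vars p \<subseteq> insert (Suc j) (poly_vars q)"
      using poly_vars_mult[of "var (Suc j)" q] by (simp add: 2(2) poly_vars_var)
    ultimately show ?thesis by auto
  qed
qed (auto simp: poly_vars_cst)

lemma aniso_multi_double:
  fixes us :: "'a::idom list"
  assumes "aniso us"
  shows "aniso (multi_double us j)"
proof (induction j)
  case (Suc j)
  have "map (eval_zero (Suc j)) (multi_double us j) = multi_double us j"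
    using poly_vars_multi_double[of _ us j] by (intro map_idI eval_zero_id) fastforce
  then show ?case using Suc aniso_var[of "Suc j" "multi_double us j" "multi_double us j"] by simp
qed (simp add: assms aniso_cst)

text \<open>At x = 0 the two residue forms are F with factors 1, -z and F with factors -1, z(z - 1).
  Each of these has residue forms F or -F at z = 0, where z - 1 becomes -1.\<close>

lemma aniso_LGP_form:
  fixes F :: "'a::idom mpoly list"
  assumes F: "aniso F" "\<And>p. p \<in> set F \<Longrightarrow> a \<notin> poly_vars p \<and> b \<notin> poly_vars p" and "a \<noteq> b"
  defines "x \<equiv> var a" and "z \<equiv> var b"
  shows "aniso ((F @ map ((*) (- z)) F) @ map ((*) x) (map ((*) (- 1)) F @ map ((*) ((z - 1) * (z - x\<^sup>2))) F))"
  unfolding x_def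
proof (rule aniso_var)
  have ea: "eval_zero a p = p" and eb: "eval_zero b p = p" if "p \<in> set F" for p
    using F(2)[OF that] by (auto intro: eval_zero_id)
  have neg: "eval_zero c (- p) = - eval_zero c p" for c and p :: "'a mpoly"
    using eval_zero_hom(2)[of c p "- p"] by (simp add: eval_zero_hom eq_neg_iff_add_eq_0 add.commute)
  have diff: "eval_zero c (p - q) = eval_zero c p - eval_zero c q" for c and p q :: "'a mpoly"
    using eval_zero_hom(2)[of c p "- q"] by (simp add: neg)
  note hom = eval_zero_hom neg diff eval_zero_var
  have aF: "aniso (map ((*) (- 1)) F)" using aniso_scale[OF F(1), of "- 1"] by simp
  have "aniso (F @ map ((*) z) (map ((*) (- 1)) F))"
    unfolding z_def
  proof (rule aniso_var)
    have "map (eval_zero b) F = F" using eb by (intro map_idI)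
    then show "aniso (map (eval_zero b) F)" using F(1) by (simp only:)
    have "map (eval_zero b) (map ((*) (- 1)) F) = map ((*) (- 1)) F"
      using eb by (simp add: hom)
    then show "aniso (map (eval_zero b) (map ((*) (- 1)) F))" using aF by (simp only:)
  qed
  moreover have "map (eval_zero a) (F @ map ((*) (- z)) F) = F @ map ((*) z) (map ((*) (- 1)) F)"
    using ea \<open>a \<noteq> b\<close> by (simp add: hom z_def map_idI)
  ultimately show "aniso (map (eval_zero a) (F @ map ((*) (- z)) F))" by (simp only:)
  have "aniso (map ((*) (- 1)) F @ map ((*) z) (map ((*) (z - 1)) F))"
    unfolding z_def
  proof (rule aniso_var)
    have "map (eval_zero b) (map ((*) (- 1)) F) = map ((*) (- 1)) F"
      using eb by (simp add: hom)
    then show "aniso (map (eval_zero b) (map ((*) (- 1)) F))" using aF by (simp only:)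
    have "map (eval_zero b) (map ((*) (var b - 1)) F) = map ((*) (- 1)) F"
      using eb by (simp add: hom)
    then show "aniso (map (eval_zero b) (map ((*) (var b - 1)) F))" using aF by (simp only:)
  qed
  moreover have "map (eval_zero a) (map ((*) (- 1)) F @ map ((*) ((z - 1) * (z - (var a)\<^sup>2))) F) =
      map ((*) (- 1)) F @ map ((*) z) (map ((*) (z - 1)) F)"
    using ea \<open>a \<noteq> b\<close> by (simp add: hom z_def power2_eq_square ac_simps)
  ultimately show "aniso (map (eval_zero a) (map ((*) (- 1)) F @ map ((*) ((z - 1) * (z - (var a)\<^sup>2))) F))"
    by (simp only:)
qed

section \<open>Springer's theorem for simple extensions\<close>

context type_subfield
begin

text \<open>Polynomials over \<open>A\<close> are kept inside those over the ambient field, so that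
  they can be evaluated at elements \<theta> outside \<open>A\<close>.\<close>

definition polys :: "'b poly set" where
  "polys = {p. \<forall>n. Polynomial.coeff p n \<in> A}"

lemma polys_0 [simp]: "0 \<in> polys" and polys_1 [simp]: "1 \<in> polys"
  by (auto simp: polys_def coeff_1)

lemma polys_add [simp]: "p \<in> polys \<Longrightarrow> q \<in> polys \<Longrightarrow> p + q \<in> polys"
  and polys_diff [simp]: "p \<in> polys \<Longrightarrow> q \<in> polys \<Longrightarrow> p - q \<in> polys"
  by (auto simp: polys_def)

lemma polys_mult [simp]: "p \<in> polys \<Longrightarrow> q \<in> polys \<Longrightarrow> p * q \<in> polys"
  unfolding polys_def by (auto simp: Polynomial.coeff_mult intro!: sum_mem)

lemma polys_power [simp]: "p \<in> polys \<Longrightarrow> p ^ n \<in> polys"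
  by (induction n) auto

lemma polys_const [simp]: "c \<in> A \<Longrightarrow> [:c:] \<in> polys"
  by (auto simp: polys_def coeff_pCons split: nat.splits)

lemma polys_monom [simp]: "c \<in> A \<Longrightarrow> Polynomial.monom c n \<in> polys"
  by (auto simp: polys_def)

lemma polys_sum: "(\<And>i. i \<in> I \<Longrightarrow> f i \<in> polys) \<Longrightarrow> sum f I \<in> polys"
  by (induction I rule: infinite_finite_induct) auto

lemma polys_division:
  assumes f: "f \<in> polys" "f \<noteq> 0" and "p \<in> polys"
  shows "\<exists>q\<in>polys. \<exists>r\<in>polys. p = f * q + r \<and> (r = 0 \<or> Polynomial.degree r < Polynomial.degree f)"
  using assms(3)
proof (induction "Polynomial.degree p" arbitrary: p rule: less_induct)
  case less
  let ?df = "Polynomial.degree f" and ?dp = "Polynomial.degree p"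
  show ?case
  proof (cases "p = 0 \<or> ?dp < ?df")
    case True
    then show ?thesis using less.prems by (intro bexI[of _ 0] bexI[of _ p]) auto
  next
    case False
    define c where "c = Polynomial.lead_coeff p / Polynomial.lead_coeff f"
    define t where "t = Polynomial.monom c (?dp - ?df)"
    have cA: "c \<in> A" using f less.prems by (simp add: c_def polys_def)
    have c0: "c \<noteq> 0" using False f by (simp add: c_def)
    define p' where "p' = p - t * f"
    have p': "p' \<in> polys" using less.prems f cA by (simp add: p'_def t_def)
    have dt: "Polynomial.degree (t * f) = ?dp"
      using c0 f False by (simp add: t_def degree_mult_eq degree_monom_eq)
    have "Polynomial.coeff (t * f) ?dp = c * Polynomial.lead_coeff f"
      using False by (simp add: t_def coeff_monom_mult)
    then have "Polynomial.coeff p' ?dp = 0" using f by (simp add: p'_def c_def)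
    moreover have "Polynomial.degree p' \<le> ?dp"
      unfolding p'_def using dt by (intro degree_diff_le) auto
    ultimately have lt: "p' = 0 \<or> Polynomial.degree p' < ?dp"
      by (metis le_neq_implies_less leading_coeff_0_iff)
    have "\<exists>q\<in>polys. \<exists>r\<in>polys. p' = f * q + r \<and> (r = 0 \<or> Polynomial.degree r < ?df)"
    proof (cases "p' = 0")
      case True
      then show ?thesis by (intro bexI[of _ 0]) auto
    qed (use less.hyps[of p'] lt p' in auto)
    then obtain q r where "q \<in> polys" "r \<in> polys" "p' = f * q + r" "r = 0 \<or> Polynomial.degree r < ?df"
      by blast
    then show ?thesis using cA
      by (intro bexI[of _ "q + t"] bexI[of _ r]) (auto simp: p'_def t_def algebra_simps)
  qed
qed

text \<open>Division with remainder by f can be done over \<open>A\<close>; the remainder is a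
  multiple of f of smaller degree, hence zero.\<close>

lemma polys_cofactor:
  assumes "f \<in> polys" "f \<noteq> 0" "f * g \<in> polys"
  shows "g \<in> polys"
proof -
  obtain q r where qr: "q \<in> polys" "f * g = f * q + r" "r = 0 \<or> Polynomial.degree r < Polynomial.degree f"
    using polys_division[OF assms] by blast
  have r: "r = f * (g - q)" using qr(2) by (simp add: algebra_simps)
  have "r = 0"
  proof (rule ccontr)
    assume "r \<noteq> 0"
    then show False using qr(3) r assms(2) by (simp add: degree_mult_eq)
  qed
  then show ?thesis using r assms(2) qr(1) by simp
qed

text \<open>A greatest common divisor with Bezout coefficients \<open>s\<close> and cofactors
  \<open>b\<close>, found as a nonzero element of least degree in the ideal generated by the
  \<open>r i\<close>.\<close>

lemma polys_ideal_generator: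
  fixes n :: nat
  assumes r: "\<And>i. i < n \<Longrightarrow> r i \<in> polys" and "\<exists>i<n. r i \<noteq> 0"
  shows "\<exists>g s b. g \<in> polys \<and> g \<noteq> 0 \<and> g = (\<Sum>i<n. s i * r i) \<and>
    (\<forall>i<n. s i \<in> polys \<and> b i \<in> polys \<and> r i = g * b i)"
proof -
  define J where "J = {\<Sum>i<n. s i * r i | s. \<forall>i<n. s i \<in> polys}"
  have JI: "(\<Sum>i<n. s i * r i) \<in> J" if "\<And>i. i < n \<Longrightarrow> s i \<in> polys" for s
    using that by (auto simp: J_def)
  have Jsub: "J \<subseteq> polys" using r by (auto simp: J_def intro!: polys_sum)
  have rJ: "r j \<in> J" if "j < n" for j
  proof -
    have "(\<Sum>i<n. (if i = j then 1 else 0) * r i) = (\<Sum>i\<in>{j}. r j)"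
      using that by (intro sum.mono_neutral_cong_right) auto
    then show ?thesis using JI[of "\<lambda>i. if i = j then 1 else 0"] by simp
  qed
  have Jdiff: "x - g * q \<in> J" if x: "x \<in> J" and g: "g \<in> J" and q: "q \<in> polys" for x g q
  proof -
    obtain s t where "\<forall>i<n. s i \<in> polys" "x = (\<Sum>i<n. s i * r i)" "\<forall>i<n. t i \<in> polys" "g = (\<Sum>i<n. t i * r i)"
      using x g by (auto simp: J_def)
    note st = this
    have "x - g * q = (\<Sum>i<n. (s i - q * t i) * r i)"
      unfolding st(2,4) by (simp add: sum_subtractf sum_distrib_left sum_distrib_right algebra_simps)
    then show ?thesis using JI[of "\<lambda>i. s i - q * t i"] q st(1,3) by simp
  qed
  have "\<exists>k g. g \<in> J \<and> g \<noteq> 0 \<and> Polynomial.degree g = k" using assms(2) rJ by blast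
  then obtain g where g: "g \<in> J" "g \<noteq> 0"
    and min: "Polynomial.degree g = (LEAST k. \<exists>g. g \<in> J \<and> g \<noteq> 0 \<and> Polynomial.degree g = k)"
    using LeastI_ex[of "\<lambda>k. \<exists>g. g \<in> J \<and> g \<noteq> 0 \<and> Polynomial.degree g = k"] by blast
  have min': "Polynomial.degree g \<le> Polynomial.degree h" if "h \<in> J" "h \<noteq> 0" for h
    unfolding min using that by (intro Least_le) auto
  have "\<exists>b\<in>polys. x = g * b" if x: "x \<in> J" for x
  proof -
    obtain q t where qt: "q \<in> polys" "x = g * q + t" "t = 0 \<or> Polynomial.degree t < Polynomial.degree g"
      using polys_division[of g x] g x Jsub by blast
    have "t \<in> J" using Jdiff[OF x g(1) qt(1)] qt(2) by simp
    then have "t = 0" using qt(3) min'[of t] by fastforce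
    then show ?thesis using qt by auto
  qed
  then have "\<forall>i. \<exists>b. i < n \<longrightarrow> b \<in> polys \<and> r i = g * b" using rJ by blast
  then obtain b where b: "\<And>i. i < n \<Longrightarrow> b i \<in> polys \<and> r i = g * b i" by metis
  obtain s where "\<forall>i<n. s i \<in> polys" "g = (\<Sum>i<n. s i * r i)" using g(1) by (auto simp: J_def)
  note s = this
  show ?thesis
  proof (intro exI conjI allI impI)
    show "g \<in> polys" using g(1) Jsub by blast
    show "g = (\<Sum>i<n. s i * r i)" by (rule s(2))
    show "g \<noteq> 0" by (rule g(2))
    show "s i \<in> polys" "b i \<in> polys" "r i = g * b i" if "i < n" for i
      using that s(1) b by simp_all
  qed
qed

definition aniso_over :: "nat \<Rightarrow> (nat \<Rightarrow> 'b) \<Rightarrow> bool" where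
  "aniso_over n u \<longleftrightarrow> (\<forall>c. (\<forall>i<n. c i \<in> A) \<longrightarrow> (\<Sum>i<n. u i * (c i)\<^sup>2) = 0 \<longrightarrow> (\<forall>i<n. c i = 0))"

lemma aniso_overD:
  assumes "aniso_over n u" "\<And>i. i < n \<Longrightarrow> c i \<in> A" "(\<Sum>i<n. u i * (c i)\<^sup>2) = 0" "j < n"
  shows "c j = 0"
  using assms unfolding aniso_over_def by auto

text \<open>The coefficients in the largest occurring degree e cannot cancel, because they would
  form a nontrivial zero of the anisotropic form. Hence the value has even degree.\<close>

lemma degree_value:
  assumes u: "aniso_over n u" and b: "\<And>i. i < n \<Longrightarrow> b i \<in> polys" and nz: "\<exists>i<n. b i \<noteq> 0"
    and d: "\<And>i. i < n \<Longrightarrow> b i = 0 \<or> Polynomial.degree (b i) < d"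
  obtains e where "e < d" "(\<Sum>i<n. [:u i:] * (b i)\<^sup>2) \<noteq> 0"
    "Polynomial.degree (\<Sum>i<n. [:u i:] * (b i)\<^sup>2) = 2 * e"
proof -
  let ?I = "{i. i < n \<and> b i \<noteq> 0}"
  let ?Q = "\<Sum>i<n. [:u i:] * (b i)\<^sup>2"
  define e where "e = Max ((\<lambda>i. Polynomial.degree (b i)) ` ?I)"
  have "e \<in> (\<lambda>i. Polynomial.degree (b i)) ` ?I" unfolding e_def using nz by (intro Max_in) auto
  then obtain j where j: "j < n" "b j \<noteq> 0" "Polynomial.degree (b j) = e" by auto
  have le: "Polynomial.degree (b i) \<le> e" if "i < n" for i
  proof (cases "b i = 0")
    case False
    then show ?thesis unfolding e_def using that by (intro Max_ge) auto
  qed simp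
  have c2: "Polynomial.coeff ((b i)\<^sup>2) (2 * e) = (Polynomial.coeff (b i) e)\<^sup>2" if "i < n" for i
  proof (cases "Polynomial.degree (b i) = e")
    case True
    then show ?thesis by (simp add: power2_eq_square mult_2 coeff_mult_degree_sum[of "b i" "b i", symmetric, unfolded True])
  next
    case False
    then have lt: "Polynomial.degree (b i) < e" using le[OF that] by simp
    then have "Polynomial.degree ((b i)\<^sup>2) < 2 * e"
      using degree_mult_le[of "b i" "b i"] by (simp add: power2_eq_square)
    then show ?thesis using lt by (simp add: Polynomial.coeff_eq_0)
  qed
  have "Polynomial.coeff ?Q (2 * e) = (\<Sum>i<n. u i * (Polynomial.coeff (b i) e)\<^sup>2)"
    by (simp add: Polynomial.coeff_sum c2)
  also have "\<dots> \<noteq> 0"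
  proof
    assume z: "(\<Sum>i<n. u i * (Polynomial.coeff (b i) e)\<^sup>2) = 0"
    have "Polynomial.coeff (b j) e = 0"
      by (rule aniso_overD[OF u _ z j(1)]) (use b in \<open>auto simp: polys_def\<close>)
    then show False using j by auto
  qed
  finally have nzc: "Polynomial.coeff ?Q (2 * e) \<noteq> 0" .
  have "Polynomial.degree ?Q \<le> 2 * e"
  proof (rule degree_sum_le)
    fix i assume "i \<in> {..<n}"
    then show "Polynomial.degree ([:u i:] * (b i)\<^sup>2) \<le> 2 * e"
      using le[of i] degree_mult_le[of "b i" "b i"] degree_smult_le[of "u i" "(b i)\<^sup>2"]
      by (simp add: power2_eq_square)
  qed simp
  then have "Polynomial.degree ?Q = 2 * e" using le_degree[OF nzc] by simp
  moreover have "e < d" using d[OF j(1)] j by simp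
  moreover have "?Q \<noteq> 0" using nzc by auto
  ultimately show ?thesis using that by blast
qed

text \<open>
  Springer's argument: an odd degree polynomial \<open>f\<close> dividing a value \<open>\<Sum> u\<^sub>i a\<^sub>i\<^sup>2\<close> at polynomials that are jointly
  coprime to \<open>f\<close> can be replaced by the cofactor, which again has odd, but smaller, degree.
\<close>

lemma springer_polynomials:
  assumes u: "aniso_over n u" "\<And>i. i < n \<Longrightarrow> u i \<in> A"
    and "odd (Polynomial.degree f)" "f \<in> polys" "\<And>i. i < n \<Longrightarrow> a i \<in> polys"
    and "f dvd (\<Sum>i<n. [:u i:] * (a i)\<^sup>2)"
    and "\<And>i. i < n \<Longrightarrow> s i \<in> polys" "e \<in> polys" "e * f + (\<Sum>i<n. s i * a i) = 1"
  shows False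
  using assms(3-)
proof (induction "Polynomial.degree f" arbitrary: f a s e rule: less_induct)
  case less
  note f = less.prems(1,2) and a = less.prems(3) and dvd = less.prems(4) and s = less.prems(5) and e = less.prems(6,7)
  have f0: "f \<noteq> 0" using f by auto
  let ?d = "Polynomial.degree f"
  \<comment> \<open>Reducing the arguments modulo f keeps the degree of the value below twice that
    of f.\<close>
  have "\<forall>i. \<exists>q r. i < n \<longrightarrow> q \<in> polys \<and> r \<in> polys \<and> a i = f * q + r \<and> (r = 0 \<or> Polynomial.degree r < ?d)"
    using polys_division[OF f(2) f0] a by blast
  then obtain q r where qr: "\<And>i. i < n \<Longrightarrow> q i \<in> polys \<and> r i \<in> polys \<and> a i = f * q i + r i \<and>
      (r i = 0 \<or> Polynomial.degree (r i) < ?d)" by metis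
  define e' where "e' = e + (\<Sum>i<n. s i * q i)"
  have one: "e' * f + (\<Sum>i<n. s i * r i) = 1"
  proof -
    have "(\<Sum>i<n. s i * a i) = (\<Sum>i<n. s i * q i) * f + (\<Sum>i<n. s i * r i)"
      unfolding sum_distrib_right sum.distrib[symmetric] using qr
      by (intro sum.cong) (auto simp: algebra_simps)
    then show ?thesis using e(2) by (simp add: e'_def algebra_simps)
  qed
  have dvd_r: "f dvd (\<Sum>i<n. [:u i:] * (r i)\<^sup>2)"
  proof -
    have eq: "(\<Sum>i<n. [:u i:] * (a i)\<^sup>2) = f * (\<Sum>i<n. [:u i:] * (f * (q i)\<^sup>2 + 2 * (q i) * (r i))) + (\<Sum>i<n. [:u i:] * (r i)\<^sup>2)"
      unfolding sum_distrib_left sum.distrib[symmetric] using qr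
      by (intro sum.cong refl) (auto simp: power2_eq_square algebra_simps simp del: mult_pCons_left)
    show ?thesis using dvd unfolding eq by (simp only: dvd_add_right_iff[OF dvd_triv_left])
  qed
  have rp: "\<And>i. i < n \<Longrightarrow> r i \<in> polys" using qr by simp
  have "\<exists>i<n. r i \<noteq> 0"
  proof (rule ccontr)
    assume "\<not> (\<exists>i<n. r i \<noteq> 0)"
    then have "e' * f = 1" using one by simp
    then have "f dvd 1" by (metis dvd_triv_right)
    then show False using f(1) dvd_imp_degree_le[of f 1] by simp
  qed
  \<comment> \<open>The quotients \<open>b\<close> by the greatest common divisor are coprime among
    themselves, so the next descent step can take 0 for \<open>e\<close>.\<close>
  then obtain g t b where g: "g \<in> polys" "g \<noteq> 0" and t2: "g = (\<Sum>i<n. t i * r i)"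
    and tb': "\<forall>i<n. t i \<in> polys \<and> b i \<in> polys \<and> r i = g * b i"
    using polys_ideal_generator[of n r, OF rp] by blast
  have t: "\<And>i. i < n \<Longrightarrow> t i \<in> polys" "g = (\<Sum>i<n. t i * r i)"
    and b: "\<And>i. i < n \<Longrightarrow> b i \<in> polys \<and> r i = g * b i"
    using tb' t2 by auto
  let ?Q = "\<Sum>i<n. [:u i:] * (b i)\<^sup>2"
  have tb: "(\<Sum>i<n. t i * b i) = 1"
  proof -
    have "g * (\<Sum>i<n. t i * b i) = (\<Sum>i<n. t i * r i)"
      unfolding sum_distrib_left using b by (intro sum.cong) (auto simp: algebra_simps)
    then show ?thesis using t(2) g(2) by simp
  qed
  have Qr: "(\<Sum>i<n. [:u i:] * (r i)\<^sup>2) = g\<^sup>2 * ?Q"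
    unfolding sum_distrib_left using b
    by (intro sum.cong refl) (auto simp: power_mult_distrib algebra_simps simp del: mult_pCons_left)
  define w where "w = (\<Sum>i<n. s i * b i)"
  \<comment> \<open>This makes g invertible modulo f. Since f divides g^2 times the value at
    \<open>b\<close>, it divides that value.\<close>
  have gw: "e' * f + g * w = 1"
  proof -
    have "(\<Sum>i<n. s i * r i) = g * w"
      unfolding w_def sum_distrib_left using b by (intro sum.cong) (auto simp: algebra_simps)
    then show ?thesis using one by simp
  qed
  have "f dvd ?Q"
  proof -
    have "?Q = (e' * f + g * w)\<^sup>2 * ?Q" using gw by simp
    also have "\<dots> = f * ((e' * e' * f + 2 * e' * g * w) * ?Q) + w\<^sup>2 * (g\<^sup>2 * ?Q)"
      by (simp add: power2_eq_square algebra_simps)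
    finally have eq: "?Q = f * ((e' * e' * f + 2 * e' * g * w) * ?Q) + w\<^sup>2 * (g\<^sup>2 * ?Q)" .
    have "f dvd f * ((e' * e' * f + 2 * e' * g * w) * ?Q) + w\<^sup>2 * (g\<^sup>2 * ?Q)"
      using dvd_r unfolding Qr by (rule dvd_add[OF dvd_triv_left dvd_mult])
    then show ?thesis unfolding eq[symmetric] .
  qed
  then obtain G where G: "?Q = f * G" by (auto simp: dvd_def)
  have bd: "b i = 0 \<or> Polynomial.degree (b i) < ?d" if "i < n" for i
  proof (cases "b i = 0")
    case False
    then have "Polynomial.degree (r i) = Polynomial.degree g + Polynomial.degree (b i)" "r i \<noteq> 0"
      using b[OF that] g by (auto simp: degree_mult_eq)
    then show ?thesis using qr[OF that] by auto
  qed simp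
  have bnz: "\<exists>i<n. b i \<noteq> 0"
  proof (rule ccontr)
    assume "\<not> (\<exists>i<n. b i \<noteq> 0)"
    then have "(\<Sum>i<n. t i * b i) = 0" by simp
    with tb show False by simp
  qed
  obtain k where k: "k < ?d" "?Q \<noteq> 0" "Polynomial.degree ?Q = 2 * k"
    using degree_value[OF u(1) _ bnz bd] b by blast
  \<comment> \<open>As k is below the odd degree of f, the cofactor \<open>G\<close> has odd degree
    smaller than that of f.\<close>
  have dG: "2 * k = ?d + Polynomial.degree G" using k G f0 by (metis degree_mult_eq mult_zero_right)
  have Gp: "G \<in> polys"
  proof (rule polys_cofactor[OF f(2) f0])
    show "f * G \<in> polys" unfolding G[symmetric] using b u(2) by (intro polys_sum polys_mult) auto
  qed
  show False
  proof (rule less.hyps[of G b t 0])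
    show "Polynomial.degree G < ?d" using dG k(1) by simp
    show "odd (Polynomial.degree G)" using dG f(1) by presburger
    show "G dvd ?Q" unfolding G by simp
  qed (use Gp b t tb in auto)
qed

text \<open>Suppose that \<open>a j\<close> does not vanish at \<theta>. Then neither does the
  greatest common divisor g of f and the \<open>a i\<close>, so \<theta> is a root of f/g, which
  \<open>min\<close> makes divisible by f. Hence g is constant, and f is coprime to the
  \<open>a i\<close>, as \<open>springer_polynomials\<close> requires.\<close>

theorem springer_simple_extension:
  assumes u: "aniso_over n u" "\<And>i. i < n \<Longrightarrow> u i \<in> A"
    and f: "f \<in> polys" "odd (Polynomial.degree f)" "poly f \<theta> = 0"
    and min: "\<And>p. p \<in> polys \<Longrightarrow> poly p \<theta> = 0 \<Longrightarrow> f dvd p"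
    and a: "\<And>i. i < n \<Longrightarrow> a i \<in> polys" "(\<Sum>i<n. u i * (poly (a i) \<theta>)\<^sup>2) = 0" and "j < n"
  shows "poly (a j) \<theta> = 0"
proof (rule ccontr)
  assume nz: "poly (a j) \<theta> \<noteq> 0"
  have f0: "f \<noteq> 0" using f by auto
  define r where "r = (\<lambda>i. if i < n then a i else f)"
  have rp: "r i \<in> polys" for i using a f by (simp add: r_def)
  have "\<exists>i<Suc n. r i \<noteq> 0" using f0 by (intro exI[of _ n]) (simp add: r_def)
  then obtain g s b where g': "g \<in> polys" "g \<noteq> 0" "g = (\<Sum>i<Suc n. s i * r i)"
    "\<forall>i<Suc n. s i \<in> polys \<and> b i \<in> polys \<and> r i = g * b i"
    using polys_ideal_generator[of "Suc n" r, OF rp] by blast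
  have gs: "\<And>i. i < Suc n \<Longrightarrow> s i \<in> polys" and gb: "\<And>i. i < Suc n \<Longrightarrow> b i \<in> polys \<and> r i = g * b i"
    using g'(4) by blast+
  note g = g'(1,2) gs g'(3) gb
  have fg: "f = g * b n" "b n \<in> polys" using g(5)[of n] by (auto simp: r_def)
  have "poly g \<theta> \<noteq> 0"
  proof
    assume "poly g \<theta> = 0"
    moreover have "a j = g * b j" using g(5)[of j] \<open>j < n\<close> by (auto simp: r_def)
    ultimately show False using nz by simp
  qed
  then have "f dvd b n" using f(3) fg by (intro min) auto
  then obtain w where w: "b n = f * w" by (auto simp: dvd_def)
  have "f * (g * w) = f * 1" using fg(1) w by (simp add: algebra_simps)
  then have gw: "g * w = 1" using f0 by (metis mult_left_cancel)
  have wp: "w \<in> polys" by (rule polys_cofactor[OF g(1,2)]) (simp add: gw)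
  have "f dvd (\<Sum>i<n. [:u i:] * (a i)\<^sup>2)"
  proof (rule min)
    show "(\<Sum>i<n. [:u i:] * (a i)\<^sup>2) \<in> polys" using a u by (intro polys_sum polys_mult) auto
    show "poly (\<Sum>i<n. [:u i:] * (a i)\<^sup>2) \<theta> = 0" using a(2) by (simp add: poly_sum)
  qed
  moreover have "(w * s n) * f + (\<Sum>i<n. (w * s i) * a i) = 1"
  proof -
    have "g = s n * f + (\<Sum>i<n. s i * a i)" using g(4) by (simp add: r_def)
    note eq = this
    have "(w * s n) * f + (\<Sum>i<n. (w * s i) * a i) = w * (s n * f + (\<Sum>i<n. s i * a i))"
      by (simp only: distrib_left sum_distrib_left mult.assoc)
    also have "\<dots> = w * g" unfolding eq[symmetric] ..
    also have "\<dots> = 1" using gw by (simp only: mult.commute[of w g])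
    finally show ?thesis .
  qed
  ultimately show False
    using springer_polynomials[OF u f(2,1), of a "\<lambda>i. w * s i" "w * s n"] a(1) g(3) wp by auto
qed

end

section \<open>Rational functions over subfields and odd degree extensions\<close>

lemma mpoly_sum_single: "p = (\<Sum>m\<in>Poly_Mapping.keys p. Poly_Mapping.single m (poly_mapping.lookup p m))"
  by (rule poly_mapping_eqI) (auto simp: lookup_sum lookup_single when_def in_keys_iff sum.delta)

text \<open>Coefficients and variables are restricted by sets inside one type: enlarging the field
  of constants is then an inclusion of sets.\<close>

definition mpolys :: "'b::field set \<Rightarrow> nat set \<Rightarrow> 'b mpoly set" where
  "mpolys M S = {p. poly_vars p \<subseteq> S \<and> (\<forall>m. poly_mapping.lookup p m \<in> M)}"

abbreviation to_fr :: "'b::idom \<Rightarrow> 'b fract" where "to_fr p \<equiv> Fraction_Field.Fract p 1"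

lemma to_fr_hom: "to_fr 0 = 0" "to_fr 1 = 1" "to_fr (x + y) = to_fr x + to_fr y"
  "to_fr (x * y) = to_fr x * to_fr y" "to_fr x = to_fr y \<longleftrightarrow> x = y"
  by (simp_all add: Zero_fract_def One_fract_def eq_fract)

lemma to_fr_eq_0: "to_fr x = 0 \<longleftrightarrow> x = 0"
  using to_fr_hom(5)[of x 0] by (simp add: to_fr_hom)

lemma to_fr_sum: "to_fr (sum f I) = (\<Sum>i\<in>I. to_fr (f i))"
  by (induction I rule: infinite_finite_induct) (simp_all add: to_fr_hom(1,3) del: add_fract)

definition ratfuns :: "'b::field set \<Rightarrow> nat set \<Rightarrow> 'b mpoly fract set" where
  "ratfuns M S = {Fraction_Field.Fract p q | p q. q \<noteq> 0 \<and> p \<in> mpolys M S \<and> q \<in> mpolys M S}"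

lemma poly_map_poly_hom:
  assumes "h 0 = 0" "\<And>x y. h (x + y) = h x + h y" "\<And>x y. h (x * y) = h x * h y"
  shows "poly (map_poly h p) (h x) = h (poly p x)"
  by (induction p) (auto simp: map_poly_pCons assms)

lemma map_poly_hom_mult:
  assumes "h 0 = 0" "\<And>x y. h (x + y) = h x + h y" "\<And>x y. h (x * y) = h x * h y"
  shows "map_poly h (p * q) = map_poly h p * map_poly h q"
proof (rule poly_eqI)
  fix n
  have s: "h (sum f I) = (\<Sum>i\<in>I. h (f i))" for f and I :: "nat set"
    by (induction I rule: infinite_finite_induct) (auto simp: assms)
  show "Polynomial.coeff (map_poly h (p * q)) n = Polynomial.coeff (map_poly h p * map_poly h q) n"
    by (simp add: coeff_map_poly assms Polynomial.coeff_mult s)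
qed

context type_subfield
begin

lemma mpolys_cst [simp]: "c \<in> A \<Longrightarrow> cst c \<in> mpolys A S"
  by (auto simp: mpolys_def poly_vars_cst) (auto simp: cst_def lookup_single when_def)

lemma mpolys_0 [simp]: "0 \<in> mpolys A S" and mpolys_1 [simp]: "1 \<in> mpolys A S"
  using mpolys_cst[of 0] mpolys_cst[of 1] by (simp_all add: cst_hom)

lemma mpolys_single: "Poly_Mapping.keys m \<subseteq> S \<Longrightarrow> c \<in> A \<Longrightarrow> Poly_Mapping.single m c \<in> mpolys A S"
  by (auto simp: mpolys_def poly_vars_def lookup_single when_def split: if_splits)

lemma mpolys_var: "a \<in> S \<Longrightarrow> var a \<in> mpolys A S"
  unfolding var_def by (rule mpolys_single) auto

lemma mpolys_add [simp]: "p \<in> mpolys A S \<Longrightarrow> q \<in> mpolys A S \<Longrightarrow> p + q \<in> mpolys A S"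
  using poly_vars_add[of p q] by (auto simp: mpolys_def Poly_Mapping.lookup_add)

lemma mpolys_sum: "(\<And>i. i \<in> I \<Longrightarrow> f i \<in> mpolys A S) \<Longrightarrow> sum f I \<in> mpolys A S"
  by (induction I rule: infinite_finite_induct) auto

lemma mpolys_uminus [simp]: "p \<in> mpolys A S \<Longrightarrow> - p \<in> mpolys A S"
  by (auto simp: mpolys_def poly_vars_uminus)

lemma mpolys_diff [simp]: "p \<in> mpolys A S \<Longrightarrow> q \<in> mpolys A S \<Longrightarrow> p - q \<in> mpolys A S"
  using mpolys_add[of p S "- q"] by simp

lemma mpolys_mult [simp]:
  assumes "p \<in> mpolys A S" "q \<in> mpolys A S"
  shows "p * q \<in> mpolys A S"
proof -
  have "p * q = (\<Sum>m\<in>Poly_Mapping.keys p. \<Sum>n\<in>Poly_Mapping.keys q.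
      Poly_Mapping.single (m + n) (poly_mapping.lookup p m * poly_mapping.lookup q n))"
    by (subst (1) mpoly_sum_single[of p], subst (1) mpoly_sum_single[of q])
       (simp add: sum_product mult_single)
  also have "\<dots> \<in> mpolys A S"
  proof (intro mpolys_sum mpolys_single)
    fix m n assume "m \<in> Poly_Mapping.keys p" "n \<in> Poly_Mapping.keys q"
    then show "Poly_Mapping.keys (m + n) \<subseteq> S"
      using assms by (auto simp: mpolys_def poly_vars_def keys_add_nat)
    show "poly_mapping.lookup p m * poly_mapping.lookup q n \<in> A" using assms by (auto simp: mpolys_def)
  qed
  finally show ?thesis .
qed

lemma ratfunsI: "p \<in> mpolys A S \<Longrightarrow> q \<in> mpolys A S \<Longrightarrow> q \<noteq> 0 \<Longrightarrow> Fraction_Field.Fract p q \<in> ratfuns A S"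
  by (auto simp: ratfuns_def)

lemma ratfuns_to_fr [simp]: "p \<in> mpolys A S \<Longrightarrow> to_fr p \<in> ratfuns A S"
  by (rule ratfunsI) auto

lemma type_subfield_ratfuns: "type_subfield (ratfuns A S)"
proof
  show "1 \<in> ratfuns A S" unfolding One_fract_def by simp
  fix x y assume "x \<in> ratfuns A S" "y \<in> ratfuns A S"
  then obtain p q r s where x: "x = Fraction_Field.Fract p q" "q \<noteq> 0" "p \<in> mpolys A S" "q \<in> mpolys A S"
    and y: "y = Fraction_Field.Fract r s" "s \<noteq> 0" "r \<in> mpolys A S" "s \<in> mpolys A S"
    by (auto simp: ratfuns_def)
  show "x - y \<in> ratfuns A S" unfolding x(1) y(1) using x y by (auto intro!: ratfunsI)
  show "x / y \<in> ratfuns A S" if "y \<noteq> 0"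
    unfolding x(1) y(1) using x y that by (auto intro!: ratfunsI simp: Zero_fract_def eq_fract)
qed

lemma clear_denominators:
  fixes n :: nat
  assumes "\<And>i. i < n \<Longrightarrow> c i \<in> ratfuns A S"
  shows "\<exists>D C. D \<in> mpolys A S \<and> D \<noteq> 0 \<and> (\<forall>i<n. C i \<in> mpolys A S \<and> to_fr (C i) = to_fr D * c i)"
  using assms
proof (induction n)
  case 0
  show ?case by (intro exI[of _ 1]) auto
next
  case (Suc n)
  then obtain D C where DC: "D \<in> mpolys A S" "D \<noteq> 0" "\<forall>i<n. C i \<in> mpolys A S \<and> to_fr (C i) = to_fr D * c i"
    by (metis less_SucI)
  obtain p q where pq: "c n = Fraction_Field.Fract p q" "q \<noteq> 0" "p \<in> mpolys A S" "q \<in> mpolys A S"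
    using Suc.prems[of n] by (auto simp: ratfuns_def)
  have "to_fr (D * p) = to_fr (D * q) * c n" using pq by (simp add: eq_fract)
  moreover have "to_fr (C i * q) = to_fr (D * q) * c i" if "i < n" for i
  proof -
    have "to_fr (C i) = to_fr D * c i" using DC(3) that by blast
    then show ?thesis unfolding to_fr_hom(4) by simp
  qed
  ultimately show ?case using DC pq
    by (intro exI[of _ "D * q"] exI[of _ "\<lambda>i. if i < n then C i * q else D * p"])
       (auto simp: less_Suc_eq simp del: mult_fract)
qed

text \<open>Isotropy over the rational functions with denominators cleared; in this shape it can be
  compared between different fields of constants.\<close>

definition iso_over_mpolys :: "nat set \<Rightarrow> nat \<Rightarrow> (nat \<Rightarrow> 'b mpoly) \<Rightarrow> bool" where
  "iso_over_mpolys S n g \<longleftrightarrow>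
     (\<exists>c. (\<forall>i<n. c i \<in> mpolys A S) \<and> (\<exists>i<n. c i \<noteq> 0) \<and> (\<Sum>i<n. g i * (c i)\<^sup>2) = 0)"

lemma iso_over_mpolys_of_ratfuns:
  assumes "\<not> type_subfield.aniso_over (ratfuns A S) n (\<lambda>i. to_fr (g i))"
  shows "iso_over_mpolys S n g"
proof -
  interpret F: type_subfield "ratfuns A S" by (rule type_subfield_ratfuns)
  obtain c where c: "\<forall>i<n. c i \<in> ratfuns A S" "(\<Sum>i<n. to_fr (g i) * (c i)\<^sup>2) = 0" "\<exists>i<n. c i \<noteq> 0"
    using assms unfolding F.aniso_over_def by blast
  obtain D C where DC: "D \<noteq> 0" "\<forall>i<n. C i \<in> mpolys A S \<and> to_fr (C i) = to_fr D * c i"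
    using clear_denominators[of n c S] c(1) by blast
  have "to_fr (\<Sum>i<n. g i * (C i)\<^sup>2) = (\<Sum>i<n. to_fr (g i) * (to_fr (C i) * to_fr (C i)))"
    unfolding to_fr_sum by (intro sum.cong) (auto simp: power2_eq_square)
  also have "\<dots> = (\<Sum>i<n. (to_fr D * to_fr D) * (to_fr (g i) * (c i)\<^sup>2))"
    using DC(2) by (intro sum.cong refl) (simp only: lessThan_iff power2_eq_square ac_simps)
  also have "\<dots> = 0" unfolding sum_distrib_left[symmetric] c(2) by simp
  finally have "(\<Sum>i<n. g i * (C i)\<^sup>2) = 0" by (simp only: to_fr_eq_0)
  moreover obtain i where i: "i < n" "c i \<noteq> 0" using c(3) by blast
  have "to_fr (C i) \<noteq> 0" using DC i to_fr_eq_0[of D] by simp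
  then have "C i \<noteq> 0" by (simp add: to_fr_eq_0)
  ultimately show ?thesis using DC(2) i(1) unfolding iso_over_mpolys_def by blast
qed

text \<open>Minimality for \<theta> survives the adjunction of variables. After clearing
  denominators, each monomial of the coefficients of P contributes a polynomial over
  \<open>A\<close> that vanishes at \<theta>, hence is divisible by f, and P is a combination of
  these.\<close>

lemma min_poly_over_ratfuns:
  assumes f: "f \<in> polys" and min: "\<And>p. p \<in> polys \<Longrightarrow> poly p \<theta> = 0 \<Longrightarrow> f dvd p"
    and P: "\<And>k. Polynomial.coeff P k \<in> ratfuns A S" "poly P (to_fr (cst \<theta>)) = 0"
  shows "map_poly (\<lambda>c. to_fr (cst c)) f dvd P"
proof -
  let ?h = "\<lambda>c :: 'b. to_fr (cst c)"
  have h: "?h 0 = 0" "?h (x + y) = ?h x + ?h y" "?h (x * y) = ?h x * ?h y" for x y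
    by (simp_all only: cst_hom to_fr_hom)
  let ?N = "Suc (Polynomial.degree P)"
  obtain D C where DC: "D \<noteq> 0" "\<forall>k<?N. C k \<in> mpolys A S \<and> to_fr (C k) = to_fr D * Polynomial.coeff P k"
    using clear_denominators[of ?N "Polynomial.coeff P" S] P(1) by blast
  have hp: "?h (x ^ k) = ?h x ^ k" for x k
    by (induction k) (simp_all add: cst_hom(2) to_fr_hom(2) h(3) cst_hom(4) del: mult_fract, simp_all add: to_fr_hom(4) cst_hom(4))
  have "to_fr (\<Sum>k<?N. C k * cst (\<theta> ^ k)) = (\<Sum>k<?N. to_fr D * (Polynomial.coeff P k * ?h \<theta> ^ k))"
    unfolding to_fr_sum using DC(2)
    by (intro sum.cong refl) (simp only: to_fr_hom(4) hp lessThan_iff mult.assoc)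
  also have "\<dots> = to_fr D * poly P (?h \<theta>)"
    unfolding poly_altdef sum_distrib_left lessThan_Suc_atMost ..
  finally have Z: "(\<Sum>k<?N. C k * cst (\<theta> ^ k)) = 0" using P(2) by (simp only: mult_zero_right to_fr_eq_0)
  \<comment> \<open>The coefficients of the monomial m in the \<open>C k\<close> are collected into
    a polynomial in one variable. It vanishes at \<theta> because distinct monomials are independent
    over the ambient field.\<close>
  define T where "T = (\<lambda>m. \<Sum>k<?N. Polynomial.monom (poly_mapping.lookup (C k) m) k)"
  have T: "T m \<in> polys" for m
    unfolding T_def using DC(2) by (intro polys_sum polys_monom) (auto simp: mpolys_def)
  have coeff_T: "Polynomial.coeff (T m) k = poly_mapping.lookup (C k) m" if "k < ?N" for m k
    using that by (simp add: T_def Polynomial.coeff_sum sum.delta)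
  have coeff_T0: "Polynomial.coeff (T m) k = 0" if "\<not> k < ?N" for m k
    using that by (auto simp: T_def Polynomial.coeff_sum intro!: sum.neutral)
  have "poly (T m) \<theta> = 0" for m
  proof -
    have "poly_mapping.lookup (\<Sum>k<?N. C k * cst (\<theta> ^ k)) m = (\<Sum>k<?N. poly_mapping.lookup (C k) m * \<theta> ^ k)"
      unfolding lookup_sum by (intro sum.cong refl) (simp add: mult.commute[of _ "cst _"] lookup_cst_mult)
    then have "(\<Sum>k<?N. poly_mapping.lookup (C k) m * \<theta> ^ k) = 0" unfolding Z by simp
    then show ?thesis by (simp only: T_def poly_sum poly_monom)
  qed
  then have dvd: "map_poly ?h f dvd map_poly ?h (T m)" for m
    using min[OF T] map_poly_hom_mult[of ?h, OF h] by (metis dvd_def)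
  let ?U = "\<Union>k<?N. Poly_Mapping.keys (C k)"
  have "Polynomial.smult (to_fr D) P = (\<Sum>m\<in>?U. Polynomial.smult (to_fr (Poly_Mapping.single m 1)) (map_poly ?h (T m)))"
  proof (rule poly_eqI)
    fix k
    have R: "Polynomial.coeff (\<Sum>m\<in>?U. Polynomial.smult (to_fr (Poly_Mapping.single m 1)) (map_poly ?h (T m))) k
      = (\<Sum>m\<in>?U. to_fr (Poly_Mapping.single m 1) * ?h (Polynomial.coeff (T m) k))"
      by (simp only: Polynomial.coeff_sum Polynomial.coeff_smult coeff_map_poly[of ?h, OF h(1)])
    show "Polynomial.coeff (Polynomial.smult (to_fr D) P) k =
      Polynomial.coeff (\<Sum>m\<in>?U. Polynomial.smult (to_fr (Poly_Mapping.single m 1)) (map_poly ?h (T m))) k"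
    proof (cases "k < ?N")
      case True
      have "to_fr D * Polynomial.coeff P k = to_fr (C k)" using DC(2) True by metis
      also have "C k = (\<Sum>m\<in>?U. Poly_Mapping.single m 1 * cst (poly_mapping.lookup (C k) m))"
      proof -
        have "C k = (\<Sum>m\<in>Poly_Mapping.keys (C k). Poly_Mapping.single m (poly_mapping.lookup (C k) m))"
          by (rule mpoly_sum_single)
        also have "\<dots> = (\<Sum>m\<in>?U. Poly_Mapping.single m (poly_mapping.lookup (C k) m))"
          using True by (intro sum.mono_neutral_left) (auto simp: in_keys_iff)
        finally show ?thesis by (simp add: cst_def mult_single)
      qed
      also have "to_fr \<dots> = (\<Sum>m\<in>?U. to_fr (Poly_Mapping.single m 1) * ?h (Polynomial.coeff (T m) k))"
        unfolding to_fr_sum coeff_T[OF True] to_fr_hom(4) ..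
      finally show ?thesis unfolding R Polynomial.coeff_smult .
    next
      case False
      then have "Polynomial.coeff P k = 0" by (simp add: Polynomial.coeff_eq_0)
      then show ?thesis unfolding R by (simp only: coeff_T0[OF False] h(1) Polynomial.coeff_smult mult_zero_right sum.neutral_const)
    qed
  qed
  moreover have "map_poly ?h f dvd (\<Sum>m\<in>?U. Polynomial.smult (to_fr (Poly_Mapping.single m 1)) (map_poly ?h (T m)))"
    by (intro dvd_sum dvd_smult dvd)
  ultimately have "map_poly ?h f dvd Polynomial.smult (to_fr D) P" by (simp only:)
  then show ?thesis using DC(1) to_fr_eq_0[of D] by (auto dest: dvd_smult_cancel)
qed

text \<open>Springer's theorem for the adjunction of \<theta> to the rational functions over
  \<open>A\<close>: f keeps its odd degree, and its minimality by
  \<open>min_poly_over_ratfuns\<close>.\<close>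

lemma iso_over_mpolys_descend:
  assumes f: "f \<in> polys" "odd (Polynomial.degree f)" "poly f \<theta> = 0"
    and min: "\<And>p. p \<in> polys \<Longrightarrow> poly p \<theta> = 0 \<Longrightarrow> f dvd p"
    and g: "\<And>i. i < n \<Longrightarrow> g i \<in> mpolys A S"
    and iso: "\<And>i. i < n \<Longrightarrow> c i \<in> mpolys ((\<lambda>p. poly p \<theta>) ` polys) S" "\<exists>i<n. c i \<noteq> 0" "(\<Sum>i<n. g i * (c i)\<^sup>2) = 0"
  shows "iso_over_mpolys S n g"
proof (rule iso_over_mpolys_of_ratfuns, rule notI)
  interpret F: type_subfield "ratfuns A S" by (rule type_subfield_ratfuns)
  let ?h = "\<lambda>c :: 'b. to_fr (cst c)"
  have h: "?h 0 = 0" "?h (x + y) = ?h x + ?h y" "?h (x * y) = ?h x * ?h y" for x y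
    by (simp_all only: cst_hom to_fr_hom)
  have hA: "?h x \<in> ratfuns A S" if "x \<in> A" for x using that by simp
  have h0: "?h x \<noteq> 0" if "x \<noteq> 0" for x
  proof -
    have "poly_mapping.lookup (cst x) 0 = x" by (simp add: cst_def)
    with that have "cst x \<noteq> 0" by auto
    then show ?thesis by (simp only: to_fr_eq_0 not_False_eq_True)
  qed
  assume an: "F.aniso_over n (\<lambda>i. to_fr (g i))"
  have "\<forall>i m. \<exists>p. i < n \<longrightarrow> p \<in> polys \<and> poly_mapping.lookup (c i) m = poly p \<theta>"
    using iso(1) unfolding mpolys_def by fastforce
  then obtain P where P: "\<And>i m. i < n \<Longrightarrow> P i m \<in> polys \<and> poly_mapping.lookup (c i) m = poly (P i m) \<theta>"
    by metis
  \<comment> \<open>Each coefficient of \<open>c i\<close> is the value at \<theta> of some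
    polynomial. Putting these polynomials in its place makes \<open>a i\<close> take the value
    \<open>c i\<close> at \<theta>.\<close>
  define a where "a = (\<lambda>i. \<Sum>m\<in>Poly_Mapping.keys (c i).
      Polynomial.smult (to_fr (Poly_Mapping.single m 1)) (map_poly ?h (P i m)))"
  have mp: "map_poly ?h p \<in> F.polys" if "p \<in> polys" for p
    using that hA by (auto simp: F.polys_def polys_def coeff_map_poly[of ?h, OF h(1)])
  have aF: "a i \<in> F.polys" if i: "i < n" for i
    unfolding a_def
  proof (rule F.polys_sum)
    fix m assume m: "m \<in> Poly_Mapping.keys (c i)"
    have "Poly_Mapping.keys m \<subseteq> S" using iso(1)[OF i] m by (auto simp: mpolys_def poly_vars_def)
    then have "to_fr (Poly_Mapping.single m 1) \<in> ratfuns A S" by (intro ratfuns_to_fr mpolys_single) auto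
    moreover have "map_poly ?h (P i m) \<in> F.polys" using P[OF i] mp by blast
    ultimately show "Polynomial.smult (to_fr (Poly_Mapping.single m 1)) (map_poly ?h (P i m)) \<in> F.polys"
      by (auto simp: F.polys_def)
  qed
  have pa: "poly (a i) (?h \<theta>) = to_fr (c i)" if i: "i < n" for i
  proof -
    have "poly (a i) (?h \<theta>) = (\<Sum>m\<in>Poly_Mapping.keys (c i). to_fr (Poly_Mapping.single m 1) * ?h (poly_mapping.lookup (c i) m))"
      unfolding a_def poly_sum poly_smult poly_map_poly_hom[of ?h, OF h]
      using P[OF i] by (intro sum.cong refl) (simp only:)
    also have "\<dots> = to_fr (\<Sum>m\<in>Poly_Mapping.keys (c i). Poly_Mapping.single m 1 * cst (poly_mapping.lookup (c i) m))"
      unfolding to_fr_sum to_fr_hom(4) ..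
    also have "(\<Sum>m\<in>Poly_Mapping.keys (c i). Poly_Mapping.single m 1 * cst (poly_mapping.lookup (c i) m)) = c i"
      by (subst (3) mpoly_sum_single) (simp add: cst_def mult_single)
    finally show ?thesis .
  qed
  obtain j where j: "j < n" "c j \<noteq> 0" using iso(2) by blast
  have "poly (a j) (?h \<theta>) = 0"
  proof (rule F.springer_simple_extension[where f = "map_poly ?h f" and n = n and u = "\<lambda>i. to_fr (g i)"])
    show "F.aniso_over n (\<lambda>i. to_fr (g i))" by (rule an)
    show "to_fr (g i) \<in> ratfuns A S" if "i < n" for i using g[OF that] by simp
    show "map_poly ?h f \<in> F.polys" using f(1) mp by blast
    show "odd (Polynomial.degree (map_poly ?h f))" using f(2) h0 by (subst degree_map_poly) auto
    show "poly (map_poly ?h f) (?h \<theta>) = 0" unfolding poly_map_poly_hom[of ?h, OF h] f(3) h(1) ..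
    show "map_poly ?h f dvd p" if "p \<in> F.polys" "poly p (?h \<theta>) = 0" for p
      using that by (intro min_poly_over_ratfuns[OF f(1) min]) (auto simp: F.polys_def)
    show "a i \<in> F.polys" if "i < n" for i using aF[OF that] .
    have "(\<Sum>i<n. to_fr (g i) * (poly (a i) (?h \<theta>))\<^sup>2) = to_fr (\<Sum>i<n. g i * (c i)\<^sup>2)"
      unfolding to_fr_sum by (intro sum.cong refl) (auto simp: pa power2_eq_square)
    then show "(\<Sum>i<n. to_fr (g i) * (poly (a i) (?h \<theta>))\<^sup>2) = 0" unfolding iso(3) to_fr_hom(1) .
  qed (rule j(1))
  then show False using j pa[OF j(1)] to_fr_eq_0[of "c j"] by simp
qed

end

section \<open>Embedding odd degree extensions into an algebraically closed field\<close>

context Ring.field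
begin

text \<open>The target is a type class field: by such maps, extensions given as records reach the
  algebraic closure.\<close>

definition sub_hom :: "'a set \<Rightarrow> ('a \<Rightarrow> 'c::field) \<Rightarrow> bool" where
  "sub_hom K \<phi> \<longleftrightarrow> \<phi> \<one> = 1 \<and> (\<forall>x\<in>K. \<forall>y\<in>K. \<phi> (x \<oplus> y) = \<phi> x + \<phi> y \<and> \<phi> (x \<otimes> y) = \<phi> x * \<phi> y)"

text \<open>The source polynomials are lists with the leading coefficient first, hence the
  reversal.\<close>

definition map_coeffs :: "('a \<Rightarrow> 'c::field) \<Rightarrow> 'a list \<Rightarrow> 'c poly" where
  "map_coeffs \<phi> p = Poly (rev (map \<phi> p))"

lemma sub_hom_minus:
  assumes "subfield K R" "sub_hom K \<phi>" "x \<in> K"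
  shows "\<phi> \<zero> = 0" "\<phi> (\<ominus> x) = - \<phi> x"
proof -
  have K: "\<zero> \<in> K" "\<ominus> x \<in> K" "x \<in> carrier R"
    using subringE(1,2,5)[OF subfieldE(1)[OF assms(1)]] assms(3) by auto
  have "\<phi> (\<zero> \<oplus> \<zero>) = \<phi> \<zero> + \<phi> \<zero>" using assms(2) K(1) unfolding sub_hom_def by blast
  then show z: "\<phi> \<zero> = 0" by (simp only: add_cancel_right_right l_zero zero_closed)
  have "\<phi> (\<ominus> x \<oplus> x) = \<phi> (\<ominus> x) + \<phi> x" using assms K unfolding sub_hom_def by blast
  then show "\<phi> (\<ominus> x) = - \<phi> x" using K z by (simp add: l_neg eq_neg_iff_add_eq_0)
qed

lemma sub_hom_nonzero:
  assumes "subfield K R" "sub_hom K \<phi>" "x \<in> K" "\<phi> x = 0"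
  shows "x = \<zero>"
proof (rule ccontr)
  assume "x \<noteq> \<zero>"
  then have i: "inv x \<in> K" "x \<otimes> inv x = \<one>" using subfield_m_inv[OF assms(1)] assms(3) by auto
  have "\<phi> (x \<otimes> inv x) = \<phi> x * \<phi> (inv x)" using assms(2,3) i(1) unfolding sub_hom_def by blast
  then show False using assms(2,4) i by (simp add: sub_hom_def)
qed

lemma type_subfield_image:
  assumes "subfield K R" "sub_hom K \<phi>"
  shows "type_subfield (\<phi> ` K)"
proof
  note sr = subringE[OF subfieldE(1)[OF assms(1)]]
  show "1 \<in> \<phi> ` K" using assms(2) sr(3) unfolding sub_hom_def by (metis image_eqI)
  fix a b assume "a \<in> \<phi> ` K" "b \<in> \<phi> ` K"
  then obtain x y where xy: "x \<in> K" "y \<in> K" "a = \<phi> x" "b = \<phi> y" by blast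
  have my: "\<ominus> y \<in> K" using sr(5) xy by blast
  have "\<phi> (x \<oplus> \<ominus> y) = \<phi> x + \<phi> (\<ominus> y)" using assms(2) xy(1) my unfolding sub_hom_def by blast
  then have "a - b = \<phi> (x \<oplus> \<ominus> y)" using sub_hom_minus[OF assms xy(2)] xy by simp
  then show "a - b \<in> \<phi> ` K" using sr(7) xy(1) my by blast
  show "a / b \<in> \<phi> ` K" if "b \<noteq> 0"
  proof -
    have "y \<noteq> \<zero>" using that xy sub_hom_minus(1)[OF assms xy(2)] by auto
    then have i: "inv y \<in> K" "y \<otimes> inv y = \<one>" using subfield_m_inv[OF assms(1)] xy by auto
    have "\<phi> (y \<otimes> inv y) = b * \<phi> (inv y)" "\<phi> (x \<otimes> inv y) = a * \<phi> (inv y)"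
      using assms(2) xy i(1) unfolding sub_hom_def by blast+
    then have "a / b = \<phi> (x \<otimes> inv y)" using i assms(2) that by (simp add: sub_hom_def field_simps)
    then show ?thesis using sr(6) xy(1) i(1) by blast
  qed
qed

lemma carrier_univ_polyD:
  assumes "p \<in> carrier (K[X])"
  shows "set p \<subseteq> K"
  using assms polynomial_incl unfolding univ_poly_carrier[symmetric] by blast

lemma coeff_mem:
  assumes "subfield K R" "p \<in> carrier (K[X])"
  shows "coeff p i \<in> K"
proof (cases "i < length p")
  case True
  then have "p ! (length p - 1 - i) \<in> set p" by simp
  then show ?thesis using carrier_univ_polyD[OF assms(2)] coeff_nth[OF True] by auto
next
  case False
  then show ?thesis using coeff_length[of p i] subringE(2)[OF subfieldE(1)[OF assms(1)]] by simp
qed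

lemma coeff_map_coeffs:
  assumes "\<phi> \<zero> = 0"
  shows "Polynomial.coeff (map_coeffs \<phi> p) i = \<phi> (coeff p i)"
proof (cases "i < length p")
  case True
  then show ?thesis by (simp add: map_coeffs_def nth_default_def rev_nth coeff_nth)
next
  case False
  then show ?thesis using coeff_length[of p i] assms by (simp add: map_coeffs_def nth_default_def)
qed

context
  fixes K :: "'a set" and \<phi> :: "'a \<Rightarrow> 'c::field"
  assumes K: "subfield K R" and \<phi>: "sub_hom K \<phi>"
begin

lemma sub_hom_zero: "\<phi> \<zero> = 0"
  using sub_hom_minus(1)[OF K \<phi>] subringE(2)[OF subfieldE(1)[OF K]] by blast

lemma map_coeffs_add:
  assumes "p \<in> carrier (K[X])" "q \<in> carrier (K[X])"
  shows "map_coeffs \<phi> (p \<oplus>\<^bsub>K[X]\<^esub> q) = map_coeffs \<phi> p + map_coeffs \<phi> q"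
proof (rule poly_eqI)
  fix i
  have "set p \<subseteq> carrier R" "set q \<subseteq> carrier R"
    using carrier_univ_polyD[OF assms(1)] carrier_univ_polyD[OF assms(2)] subfieldE(3)[OF K] by auto
  then have "coeff (p \<oplus>\<^bsub>K[X]\<^esub> q) i = coeff p i \<oplus> coeff q i"
    by (simp only: univ_poly_add poly_add_coeff)
  then show "Polynomial.coeff (map_coeffs \<phi> (p \<oplus>\<^bsub>K[X]\<^esub> q)) i = Polynomial.coeff (map_coeffs \<phi> p + map_coeffs \<phi> q) i"
    using \<phi> coeff_mem[OF K assms(1)] coeff_mem[OF K assms(2)]
    by (simp add: coeff_map_coeffs sub_hom_zero sub_hom_def)
qed

lemma sub_hom_finsum:
  assumes "finite F" "\<And>i. i \<in> F \<Longrightarrow> f i \<in> K"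
  shows "\<phi> (\<Oplus>i\<in>F. f i) = (\<Sum>i\<in>F. \<phi> (f i)) \<and> (\<Oplus>i\<in>F. f i) \<in> K"
  using assms
proof (induction F rule: finite_induct)
  case empty
  then show ?case using sub_hom_zero subringE(2)[OF subfieldE(1)[OF K]] by simp
next
  case (insert a F)
  have c: "f i \<in> carrier R" if "i \<in> insert a F" for i using insert.prems that subfieldE(3)[OF K] by blast
  have s: "(\<Oplus>i\<in>insert a F. f i) = f a \<oplus> (\<Oplus>i\<in>F. f i)" using insert.hyps c by (subst finsum_insert) auto
  have IH: "\<phi> (\<Oplus>i\<in>F. f i) = (\<Sum>i\<in>F. \<phi> (f i))" "(\<Oplus>i\<in>F. f i) \<in> K" using insert by auto
  then have "\<phi> (f a \<oplus> (\<Oplus>i\<in>F. f i)) = \<phi> (f a) + \<phi> (\<Oplus>i\<in>F. f i)"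
    using \<phi> insert.prems unfolding sub_hom_def by blast
  moreover have "f a \<oplus> (\<Oplus>i\<in>F. f i) \<in> K"
    using subringE(7)[OF subfieldE(1)[OF K]] insert.prems IH(2) by blast
  ultimately show ?case unfolding s using insert.hyps IH(1) by simp
qed

lemma map_coeffs_mult:
  assumes "p \<in> carrier (K[X])" "q \<in> carrier (K[X])"
  shows "map_coeffs \<phi> (p \<otimes>\<^bsub>K[X]\<^esub> q) = map_coeffs \<phi> p * map_coeffs \<phi> q"
proof (rule poly_eqI)
  fix i
  have "set p \<subseteq> carrier R" "set q \<subseteq> carrier R"
    using carrier_univ_polyD[OF assms(1)] carrier_univ_polyD[OF assms(2)] subfieldE(3)[OF K] by auto
  then have c: "coeff (p \<otimes>\<^bsub>K[X]\<^esub> q) i = (\<Oplus>k\<in>{..i}. coeff p k \<otimes> coeff q (i - k))"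
    by (simp add: univ_poly_mult poly_mult_coeff)
  have m: "coeff p k \<otimes> coeff q (i - k) \<in> K" for k
    using subringE(6)[OF subfieldE(1)[OF K]] coeff_mem[OF K assms(1)] coeff_mem[OF K assms(2)] by blast
  have "\<phi> (coeff p k \<otimes> coeff q (i - k)) = \<phi> (coeff p k) * \<phi> (coeff q (i - k))" for k
    using \<phi> coeff_mem[OF K assms(1)] coeff_mem[OF K assms(2)] unfolding sub_hom_def by blast
  then show "Polynomial.coeff (map_coeffs \<phi> (p \<otimes>\<^bsub>K[X]\<^esub> q)) i = Polynomial.coeff (map_coeffs \<phi> p * map_coeffs \<phi> q) i"
    using sub_hom_finsum[of "{..i}" "\<lambda>k. coeff p k \<otimes> coeff q (i - k)"] m
    by (simp add: coeff_map_coeffs sub_hom_zero c Polynomial.coeff_mult)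
qed

lemma map_coeffs_surj:
  assumes "\<And>i. Polynomial.coeff P i \<in> \<phi> ` K"
  shows "\<exists>p\<in>carrier (K[X]). map_coeffs \<phi> p = P"
proof -
  obtain k where k: "\<And>i. k i \<in> K" "\<And>i. Polynomial.coeff P i = \<phi> (k i)"
    using assms unfolding image_iff by metis
  define p where "p = rev (map k [0..<Suc (Polynomial.degree P)])"
  have "set p \<subseteq> K" using k(1) by (auto simp: p_def)
  then have n: "normalize p \<in> carrier (K[X])"
    using normalize_gives_polynomial univ_poly_carrier by blast
  have "map_coeffs \<phi> (normalize p) = P"
  proof (rule poly_eqI)
    fix i
    have "\<phi> (coeff p i) = Polynomial.coeff P i"
    proof (cases "i < length p")
      case True
      have "coeff p i = rev p ! i" using True by (simp add: coeff_nth rev_nth)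
      also have "\<dots> = k i" using True by (simp add: p_def del: upt_Suc)
      finally show ?thesis using k(2) by simp
    next
      case False
      then show ?thesis using coeff_length[of p i] sub_hom_zero by (simp add: p_def Polynomial.coeff_eq_0)
    qed
    then show "Polynomial.coeff (map_coeffs \<phi> (normalize p)) i = Polynomial.coeff P i"
      using normalize_coeff[of p] by (simp add: coeff_map_coeffs[where \<phi> = \<phi>, OF sub_hom_zero])
  qed
  then show ?thesis using n by blast
qed

text \<open>The simple extension is the quotient of \<open>K[X]\<close> by the multiples of
  \<open>Irr K x\<close>, so sending x to a root \<theta> of the image of \<open>Irr K x\<close> is
  well defined.\<close>

lemma extend_sub_hom:
  assumes x: "x \<in> carrier R" "(algebraic over K) x"
    and root: "poly (map_coeffs \<phi> (Irr K x)) \<theta> = 0"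
  obtains \<tau> where "sub_hom (simple_extension K x) \<tau>" "\<And>k. k \<in> K \<Longrightarrow> \<tau> k = \<phi> k"
    "\<And>p. p \<in> carrier (K[X]) \<Longrightarrow> \<tau> (eval p x) = poly (map_coeffs \<phi> p) \<theta>"
proof -
  note Ksr = subfieldE(1)[OF K]
  interpret UP: cring "K[X]" using univ_poly_is_cring[OF Ksr] .
  have ev: "(\<lambda>p. eval p x) \<in> ring_hom (K[X]) R" by (rule eval_is_hom[OF Ksr x(1)])
  have ker: "poly (map_coeffs \<phi> p) \<theta> = 0" if p: "p \<in> carrier (K[X])" "eval p x = \<zero>" for p
  proof -
    have "Irr K x divides\<^bsub>K[X]\<^esub> p"
      using Irr_minimal[OF K x p] pdivides_iff_shell[OF K IrrE(1)[OF K x] p(1)] by blast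
    then obtain c where c: "c \<in> carrier (K[X])" "p = Irr K x \<otimes>\<^bsub>K[X]\<^esub> c" by (auto simp: factor_def)
    show ?thesis using map_coeffs_mult[OF IrrE(1)[OF K x] c(1)] root c(2) by simp
  qed
  have wd: "poly (map_coeffs \<phi> p) \<theta> = poly (map_coeffs \<phi> q) \<theta>"
    if p: "p \<in> carrier (K[X])" and q: "q \<in> carrier (K[X])" and e: "eval p x = eval q x" for p q
  proof -
    define d where "d = p \<ominus>\<^bsub>K[X]\<^esub> q"
    have d: "d \<in> carrier (K[X])" using p q by (simp add: d_def)
    have pq: "p = d \<oplus>\<^bsub>K[X]\<^esub> q" using p q unfolding d_def a_minus_def
      by (metis UP.a_assoc UP.a_inv_closed UP.l_neg UP.r_zero)
    have ec: "eval d x \<in> carrier R" "eval q x \<in> carrier R" using ring_hom_closed[OF ev] d q by auto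
    have "eval p x = eval d x \<oplus> eval q x" using ring_hom_add[OF ev d q] pq by simp
    then have "eval d x \<oplus> eval q x = \<zero> \<oplus> eval q x" using e ec by simp
    then have "eval d x = \<zero>" using ec by (metis add.right_cancel zero_closed)
    then have "poly (map_coeffs \<phi> d) \<theta> = 0" by (rule ker[OF d])
    then show ?thesis using map_coeffs_add[OF d q] pq by simp
  qed
  \<comment> \<open>A polynomial representing y is chosen; \<open>wd\<close> makes the value
    independent of the choice.\<close>
  define \<tau> where "\<tau> = (\<lambda>y. poly (map_coeffs \<phi> (SOME p. p \<in> carrier (K[X]) \<and> eval p x = y)) \<theta>)"
  have \<tau>: "\<tau> (eval p x) = poly (map_coeffs \<phi> p) \<theta>" if p: "p \<in> carrier (K[X])" for p
  proof -
    define r where "r = (SOME r. r \<in> carrier (K[X]) \<and> eval r x = eval p x)"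
    have "r \<in> carrier (K[X]) \<and> eval r x = eval p x" unfolding r_def by (rule someI[of _ p]) (use p in simp)
    then show ?thesis using wd[of r p] p by (simp add: \<tau>_def r_def)
  qed
  have k: "\<tau> k = \<phi> k" if k: "k \<in> K" for k
  proof (cases "k = \<zero>")
    case True
    have "\<tau> (eval [] x) = 0" by (subst \<tau>) (auto simp: map_coeffs_def)
    then show ?thesis using True sub_hom_zero by simp
  next
    case False
    have kc: "k \<in> carrier R" using k subfieldE(3)[OF K] by blast
    have "[k] \<in> carrier (K[X])" using False k const_is_polynomial univ_poly_carrier by blast
    then have "\<tau> (eval [k] x) = \<phi> k" by (subst \<tau>) (auto simp: map_coeffs_def)
    then show ?thesis using kc x(1) by simp
  qed
  have "sub_hom (simple_extension K x) \<tau>"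
    unfolding sub_hom_def
  proof (intro conjI ballI)
    have "\<one> \<in> K" using subringE(3)[OF Ksr] .
    then show "\<tau> \<one> = 1" using k \<phi> by (simp add: sub_hom_def)
    fix y z assume "y \<in> simple_extension K x" "z \<in> simple_extension K x"
    then obtain p q where p: "p \<in> carrier (K[X])" "y = eval p x" and q: "q \<in> carrier (K[X])" "z = eval q x"
      unfolding simple_extension_as_eval_img[OF subfieldE(3)[OF K] x(1)] by blast
    have "\<tau> (y \<oplus> z) = \<tau> (eval (p \<oplus>\<^bsub>K[X]\<^esub> q) x)" using ring_hom_add[OF ev p(1) q(1)] p q by simp
    also have "\<dots> = \<tau> y + \<tau> z"
      using p q by (simp add: \<tau> map_coeffs_add)
    finally show "\<tau> (y \<oplus> z) = \<tau> y + \<tau> z" .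
    have "\<tau> (y \<otimes> z) = \<tau> (eval (p \<otimes>\<^bsub>K[X]\<^esub> q) x)" using ring_hom_mult[OF ev p(1) q(1)] p q by simp
    also have "\<dots> = \<tau> y * \<tau> z"
      using p q by (simp add: \<tau> map_coeffs_mult)
    finally show "\<tau> (y \<otimes> z) = \<tau> y * \<tau> z" .
  qed
  then show ?thesis using that \<tau> k by blast
qed

end

text \<open>A list that spans over K also spans over F.\<close>

lemma finite_dimension_larger_base:
  assumes "subfield K R" "subfield F R" "K \<subseteq> F" "finite_dimension K (carrier R)"
  shows "finite_dimension F (carrier R)"
proof -
  obtain n where "dimension n K (carrier R)" using assms(4) by auto
  then obtain Us where Us: "set Us \<subseteq> carrier R" "Span K Us = carrier R"
    using exists_base[OF assms(1)] by blast
  have "Span K Us \<subseteq> Span F Us"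
  proof (induction Us)
    case (Cons u Us)
    show ?case
    proof
      fix y assume "y \<in> Span K (u # Us)"
      then obtain k w where "k \<in> K" "w \<in> Span K Us" "y = k \<otimes> u \<oplus> w" by (auto simp: line_extension_mem_iff)
      then show "y \<in> Span F (u # Us)" using Cons assms(3) by (auto simp: line_extension_mem_iff)
    qed
  qed simp
  then have "Span F Us = carrier R"
    using Us Span_in_carrier[OF subfieldE(3)[OF assms(2)] Us(1)] by auto
  then show ?thesis using Span_finite_dimension[OF assms(2) Us(1)] by simp
qed

text \<open>Induction on the degree. For x outside K, the degrees of the simple extension and of the
  rest have an odd product, so both are odd. The rest is covered by induction, the simple extension
  by Springer's theorem. The embedding is extended along the way, because the descent compares
  images in the algebraically closed field.\<close>

theorem odd_extension_descend:
  fixes \<phi> :: "'a \<Rightarrow> 'c::alg_closed_field"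
  assumes "subfield K R" "sub_hom K \<phi>" "finite_dimension K (carrier R)" "odd ((dim over K) (carrier R))"
  shows "\<exists>\<tau>. sub_hom (carrier R) \<tau> \<and> (\<forall>k\<in>K. \<tau> k = \<phi> k) \<and>
    (\<forall>S n g. (\<forall>i<n. g i \<in> mpolys (\<phi> ` K) S) \<longrightarrow>
      type_subfield.iso_over_mpolys (\<tau> ` carrier R) S n g \<longrightarrow> type_subfield.iso_over_mpolys (\<phi> ` K) S n g)"
  using assms
proof (induction "(dim over K) (carrier R)" arbitrary: K \<phi> rule: less_induct)
  case less
  note K = less.prems(1) and \<phi> = less.prems(2) and fin = less.prems(3) and odd = less.prems(4)
  note Ksr = subfieldE(1)[OF K]
  show ?case
  proof (cases "K = carrier R")
    case True
    then show ?thesis using \<phi> by blast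
  next
    case False
    then obtain x where x: "x \<in> carrier R" "x \<notin> K" using subfieldE(3)[OF K] by blast
    have alg: "(algebraic over K) x"
      using finite_dimension_imp_algebraic[OF K carrier_is_subring fin x(1)] .
    let ?F = "simple_extension K x" and ?f = "Irr K x"
    have F: "subfield ?F R" using simple_extension_is_subfield[OF K x(1)] alg by blast
    have KF: "K \<subseteq> ?F" by (rule simple_extension_incl[OF subfieldE(3)[OF K] x(1)])
    have finF: "finite_dimension ?F (carrier R)" by (rule finite_dimension_larger_base[OF K F KF fin])
    have finKF: "finite_dimension K ?F" using finite_dimension_simple_extension[OF K x(1)] alg by blast
    have dim: "(dim over K) (carrier R) = Polynomials.degree ?f * (dim over ?F) (carrier R)"
      using telescopic_base_dim(2)[OF K F finKF finF] simple_extension_dim[OF K x(1) alg] by simp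
    have f: "?f \<in> carrier (K[X])" "pirreducible K ?f" "hd ?f = \<one>" "eval ?f x = \<zero>"
      using IrrE[OF K x(1) alg] .
    have oddf: "odd (Polynomials.degree ?f)" and oddF: "odd ((dim over ?F) (carrier R))" using odd dim by simp_all
    have fne: "?f \<noteq> []" using pirreducibleE(1)[OF Ksr f(1,2)] .
    have sz: "\<phi> \<zero> = 0" by (rule sub_hom_zero[OF K \<phi>])
    \<comment> \<open>A degree other than 1 makes the dimension over the simple extension strictly
      smaller, so that the induction applies.\<close>
    have deg1: "Polynomials.degree ?f \<noteq> 1"
    proof
      assume "Polynomials.degree ?f = 1"
      then obtain b where b: "?f = [\<one>, b]"
        using f(3) fne by (cases ?f; cases "tl ?f") auto
      then have bK: "b \<in> K" using carrier_univ_polyD[OF f(1)] by simp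
      then have bc: "b \<in> carrier R" using subfieldE(3)[OF K] by blast
      have "x \<oplus> b = \<zero>" using f(4) b bc x(1) by simp
      then have "x = \<ominus> b" using minus_equality[of x b] bc x(1) by simp
      then show False using x(2) bK subringE(5)[OF Ksr] by simp
    qed
    have "(dim over ?F) (carrier R) < (dim over K) (carrier R)"
    proof -
      have "Polynomials.degree ?f \<ge> 2" using deg1 oddf by (cases "Polynomials.degree ?f") auto
      moreover have "(dim over ?F) (carrier R) > 0" using oddF by (rule odd_pos)
      ultimately show ?thesis unfolding dim by simp
    qed
    note IH = less.hyps[OF this F _ finF oddF]
    let ?P = "map_coeffs \<phi> ?f"
    have cP: "Polynomial.coeff ?P i = \<phi> (coeff ?f i)" for i by (rule coeff_map_coeffs[where \<phi> = \<phi>, OF sz])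
    have "Polynomial.degree ?P = Polynomials.degree ?f"
    proof (rule antisym)
      show "Polynomial.degree ?P \<le> Polynomials.degree ?f"
        by (rule degree_le) (simp add: cP coeff_degree sz)
      have "coeff ?f (Polynomials.degree ?f) = \<one>" using f(3) fne by (cases ?f) auto
      then have "Polynomial.coeff ?P (Polynomials.degree ?f) \<noteq> 0" using \<phi> by (simp add: cP sub_hom_def)
      then show "Polynomials.degree ?f \<le> Polynomial.degree ?P" by (rule le_degree)
    qed
    then have oddP: "odd (Polynomial.degree ?P)" using oddf by simp
    then obtain \<theta> where root: "poly ?P \<theta> = 0" using alg_closed_imp_poly_has_root[of ?P, OF odd_pos[OF oddP]] by blast
    obtain \<rho> where \<rho>: "sub_hom ?F \<rho>" "\<And>k. k \<in> K \<Longrightarrow> \<rho> k = \<phi> k"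
      "\<And>p. p \<in> carrier (K[X]) \<Longrightarrow> \<rho> (eval p x) = poly (map_coeffs \<phi> p) \<theta>"
      using extend_sub_hom[OF K \<phi> x(1) alg root] by blast
    obtain \<tau> where \<tau>: "sub_hom (carrier R) \<tau>" "\<forall>k\<in>?F. \<tau> k = \<rho> k"
      "\<forall>S n g. (\<forall>i<n. g i \<in> mpolys (\<rho> ` ?F) S) \<longrightarrow>
        type_subfield.iso_over_mpolys (\<tau> ` carrier R) S n g \<longrightarrow> type_subfield.iso_over_mpolys (\<rho> ` ?F) S n g"
      using IH[OF \<rho>(1)] by blast
    interpret M: type_subfield "\<phi> ` K" by (rule type_subfield_image[OF K \<phi>])
    interpret N: type_subfield "\<rho> ` ?F" by (rule type_subfield_image[OF F \<rho>(1)])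
    have mc: "map_coeffs \<phi> p \<in> M.polys" if "p \<in> carrier (K[X])" for p
      using coeff_mem[OF K that] by (auto simp: M.polys_def coeff_map_coeffs[where \<phi> = \<phi>, OF sz])
    have surj: "\<exists>p\<in>carrier (K[X]). map_coeffs \<phi> p = P" if "P \<in> M.polys" for P
      using that by (intro map_coeffs_surj[OF K \<phi>]) (auto simp: M.polys_def)
    have img: "\<rho> ` ?F = (\<lambda>p. poly p \<theta>) ` M.polys"
    proof -
      have "\<rho> ` ?F = (\<lambda>p. poly (map_coeffs \<phi> p) \<theta>) ` carrier (K[X])"
        unfolding simple_extension_as_eval_img[OF subfieldE(3)[OF K] x(1)] image_image
        using \<rho>(3) by (intro image_cong) auto
      also have "\<dots> = (\<lambda>p. poly p \<theta>) ` (map_coeffs \<phi> ` carrier (K[X]))" by (simp add: image_image)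
      also have "map_coeffs \<phi> ` carrier (K[X]) = M.polys" using mc surj by blast
      finally show ?thesis .
    qed
    have min: "?P dvd P" if P: "P \<in> M.polys" "poly P \<theta> = 0" for P
    proof -
      obtain p where p: "p \<in> carrier (K[X])" "map_coeffs \<phi> p = P" using surj[OF P(1)] by blast
      have "eval p x \<in> ?F" using p(1) unfolding simple_extension_as_eval_img[OF subfieldE(3)[OF K] x(1)] by blast
      then have "eval p x = \<zero>" using sub_hom_nonzero[OF F \<rho>(1)] \<rho>(3)[OF p(1)] p(2) P(2) by simp
      then have "?f divides\<^bsub>K[X]\<^esub> p"
        using Irr_minimal[OF K x(1) alg p(1)] pdivides_iff_shell[OF K f(1) p(1)] by blast
      then obtain c where c: "c \<in> carrier (K[X])" "p = ?f \<otimes>\<^bsub>K[X]\<^esub> c" by (auto simp: factor_def)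
      then have "P = ?P * map_coeffs \<phi> c" using map_coeffs_mult[OF K \<phi> f(1) c(1)] p(2) by simp
      then show ?thesis by (rule dvdI)
    qed
    have "M.iso_over_mpolys S n g"
      if g: "\<forall>i<n. g i \<in> mpolys (\<phi> ` K) S" and iso: "type_subfield.iso_over_mpolys (\<tau> ` carrier R) S n g" for S n g
    proof -
      have "\<phi> ` K \<subseteq> \<rho> ` ?F"
      proof
        fix y assume "y \<in> \<phi> ` K"
        then obtain k where k: "k \<in> K" "y = \<phi> k" by blast
        then have "y = \<rho> k" using \<rho>(2) by simp
        then show "y \<in> \<rho> ` ?F" using k(1) KF by blast
      qed
      then have "\<forall>i<n. g i \<in> mpolys (\<rho> ` ?F) S" using g by (auto simp: mpolys_def)
      then have "N.iso_over_mpolys S n g" using \<tau>(3) iso by blast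
      then obtain c where c: "\<forall>i<n. c i \<in> mpolys (\<rho> ` ?F) S" "\<exists>i<n. c i \<noteq> 0" "(\<Sum>i<n. g i * (c i)\<^sup>2) = 0"
        unfolding N.iso_over_mpolys_def by blast
      show ?thesis
        using M.iso_over_mpolys_descend[OF mc[OF f(1)] oddP root min, of n g S c] g c unfolding img by blast
    qed
    moreover have "\<forall>k\<in>K. \<tau> k = \<phi> k" using \<tau>(2) \<rho>(2) KF by auto
    ultimately show ?thesis using \<tau>(1) by blast
  qed
qed

end

section \<open>Zeros of forms over rational function fields\<close>

lemma inj_to_ac: "inj (to_ac :: 'a::field \<Rightarrow> 'a alg_closure)"
proof (rule injI)
  fix x y :: 'a assume "to_ac x = to_ac y"
  then have z: "to_ac (x - y) = 0" by simp
  show "x = y"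
  proof (rule ccontr)
    assume "x \<noteq> y"
    then have "to_ac ((x - y) * inverse (x - y)) = 1" by simp
    then show False unfolding to_ac_mult z by simp
  qed
qed

lemma type_subfield_UNIV: "type_subfield (UNIV :: 'b::field set)"
  by standard auto

text \<open>Bounding each exponent instead of the total degree gives a box, whose size is a pure
  power.\<close>

definition exponents :: "nat \<Rightarrow> nat \<Rightarrow> (nat \<Rightarrow>\<^sub>0 nat) set" where
  "exponents r d = {m. Poly_Mapping.keys m \<subseteq> {1..r} \<and> (\<forall>a. poly_mapping.lookup m a \<le> d)}"

lemma card_exponents: "card (exponents r d) = (d + 1) ^ r" and finite_exponents: "finite (exponents r d)"
proof -
  let ?G = "\<lambda>f. Abs_poly_mapping (\<lambda>a. if a \<in> {1..r} then f a else 0) :: nat \<Rightarrow>\<^sub>0 nat"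
  have lk: "poly_mapping.lookup (?G f) = (\<lambda>a. if a \<in> {1..r} then f a else 0)" for f :: "nat \<Rightarrow> nat"
  proof (rule Abs_poly_mapping_inverse)
    have "{a. (if a \<in> {1..r} then f a else 0) \<noteq> 0} \<subseteq> {1..r}" by auto
    then show "(\<lambda>a. if a \<in> {1..r} then f a else 0) \<in> {f. finite {x. f x \<noteq> 0}}"
      using finite_subset by auto
  qed
  have b: "bij_betw (\<lambda>m. restrict (poly_mapping.lookup m) {1..r}) (exponents r d) (PiE {1..r} (\<lambda>_. {..d}))"
  proof (rule bij_betw_byWitness[where f' = ?G])
    show "\<forall>m\<in>exponents r d. ?G (restrict (poly_mapping.lookup m) {1..r}) = m"
    proof
      fix m assume m: "m \<in> exponents r d"
      show "?G (restrict (poly_mapping.lookup m) {1..r}) = m"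
      proof (rule poly_mapping_eqI)
        fix a
        show "poly_mapping.lookup (?G (restrict (poly_mapping.lookup m) {1..r})) a = poly_mapping.lookup m a"
          unfolding lk using m by (cases "a \<in> {1..r}") (auto simp: exponents_def in_keys_iff subset_iff)
      qed
    qed
    show "\<forall>f\<in>PiE {1..r} (\<lambda>_. {..d}). restrict (poly_mapping.lookup (?G f)) {1..r} = f"
      unfolding lk by (auto simp: fun_eq_iff PiE_def extensional_def)
    show "(\<lambda>m. restrict (poly_mapping.lookup m) {1..r}) ` exponents r d \<subseteq> PiE {1..r} (\<lambda>_. {..d})"
      by (auto simp: exponents_def)
    show "?G ` PiE {1..r} (\<lambda>_. {..d}) \<subseteq> exponents r d"
    proof (rule image_subsetI)
      fix f assume "f \<in> PiE {1..r} (\<lambda>_. {..d})"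
      then show "?G f \<in> exponents r d"
        unfolding exponents_def using lk[of f] by (auto simp: in_keys_iff PiE_def Pi_def split: if_splits)
    qed
  qed
  have "finite (PiE {1..r} (\<lambda>_. {..d}))" by (intro finite_PiE) auto
  then show "finite (exponents r d)" using bij_betw_finite[OF b] by simp
  have "card (exponents r d) = card (PiE {1..r} (\<lambda>_. {..d}))" by (rule bij_betw_same_card[OF b])
  then show "card (exponents r d) = (d + 1) ^ r" by (simp add: card_PiE)
qed

text \<open>As M grows, the quotient of (2M + d + 1)^r by (M + 1)^r tends to 2^r, and 2^i 2^r <
  n.\<close>

lemma many_unknowns:
  fixes i r d n :: nat
  assumes "2 ^ (i + r) < n"
  obtains M where "(2 * M + d + 1) ^ r * 2 ^ i < n * (M + 1) ^ r"
proof -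
  \<comment> \<open>Here N stands for M + 1, and 2 + d/N slightly exceeds the quotient (2M + d +
    1)/N.\<close>
  have "(\<lambda>N. 2 ^ i * (2 + real d / real N) ^ r) \<longlonglongrightarrow> 2 ^ i * (2 + 0) ^ r"
    by (intro tendsto_intros lim_const_over_n)
  moreover have "2 ^ i * (2 + 0) ^ r < real n"
  proof -
    have "real (2 ^ (i + r)) < real n" using assms by (simp only: of_nat_less_iff)
    then show ?thesis by (simp add: power_add)
  qed
  ultimately have "eventually (\<lambda>N. 2 ^ i * (2 + real d / real N) ^ r < real n) sequentially"
    by (rule order_tendstoD(2))
  then obtain N0 where N0: "\<And>N. N \<ge> N0 \<Longrightarrow> 2 ^ i * (2 + real d / real N) ^ r < real n"
    by (auto simp: eventually_sequentially)
  define M where "M = N0"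
  let ?N = "real (M + 1)"
  have "2 ^ i * (2 + real d / ?N) ^ r * ?N ^ r < real n * ?N ^ r"
    using N0[of "M + 1"] by (intro mult_strict_right_mono) (auto simp: M_def)
  moreover have "(2 + real d / ?N) ^ r * ?N ^ r = (2 * ?N + real d) ^ r"
  proof -
    have "(2 + real d / ?N) * ?N = 2 * ?N + real d" by (simp add: distrib_right)
    then show ?thesis unfolding power_mult_distrib[symmetric] by (simp only:)
  qed
  ultimately have "2 ^ i * (2 * ?N + real d) ^ r < real n * ?N ^ r" by (simp only: mult.assoc)
  moreover have "real (2 * M + d + 1) ^ r \<le> (2 * ?N + real d) ^ r" by (intro power_mono) auto
  ultimately have "real (2 * M + d + 1) ^ r * 2 ^ i < real n * ?N ^ r"
    by (metis (no_types, lifting) mult.commute mult_left_mono order_le_less_trans zero_le_numeral zero_le_power)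
  then have "real ((2 * M + d + 1) ^ r * 2 ^ i) < real (n * (M + 1) ^ r)" by simp
  then show ?thesis using that by (simp only: of_nat_less_iff)
qed

section \<open>Change of the field of coefficients\<close>

definition map_mpoly :: "('a::comm_ring_1 \<Rightarrow> 'b::comm_ring_1) \<Rightarrow> 'a mpoly \<Rightarrow> 'b mpoly" where
  "map_mpoly h = mp_hom (\<lambda>c. cst (h c)) (\<lambda>m. Poly_Mapping.single m 1)"

context
  fixes h :: "'a::comm_ring_1 \<Rightarrow> 'b::comm_ring_1"
  assumes h: "h 0 = 0" "h 1 = 1" "\<And>x y. h (x + y) = h x + h y" "\<And>x y. h (x * y) = h x * h y"
begin

lemma map_mpoly_aux:
  "cst (h 0) = 0" "cst (h 1) = 1" "cst (h (x + y)) = cst (h x) + cst (h y)"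
  "cst (h (x * y)) = cst (h x) * cst (h y)"
  "Poly_Mapping.single (0 :: nat \<Rightarrow>\<^sub>0 nat) (1 :: 'b) = 1"
  "Poly_Mapping.single (m + n :: nat \<Rightarrow>\<^sub>0 nat) (1 :: 'b) = Poly_Mapping.single m 1 * Poly_Mapping.single n 1"
  by (simp_all add: h cst_hom mult_single)

lemma map_mpoly_hom:
  "map_mpoly h 0 = 0" "map_mpoly h 1 = 1" "map_mpoly h (p + q) = map_mpoly h p + map_mpoly h q"
  "map_mpoly h (p * q) = map_mpoly h p * map_mpoly h q"
  unfolding map_mpoly_def
  by (rule mp_hom_zero mp_hom_add mp_hom_mult mp_hom_one; rule map_mpoly_aux)+

lemma map_mpoly_single: "map_mpoly h (Poly_Mapping.single m c) = Poly_Mapping.single m (h c)"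
proof -
  have "map_mpoly h (Poly_Mapping.single m c) = cst (h c) * Poly_Mapping.single m 1"
    unfolding map_mpoly_def by (rule mp_hom_single; rule map_mpoly_aux)
  then show ?thesis by (simp add: cst_def mult_single)
qed

lemma lookup_map_mpoly: "poly_mapping.lookup (map_mpoly h p) m = h (poly_mapping.lookup p m)"
  by (induction p rule: mpoly_induct)
     (auto simp: map_mpoly_single map_mpoly_hom Poly_Mapping.lookup_add lookup_single when_def h)

lemma map_mpoly_sum: "map_mpoly h (sum f I) = (\<Sum>i\<in>I. map_mpoly h (f i))"
  by (induction I rule: infinite_finite_induct) (auto simp: map_mpoly_hom)

lemma poly_vars_map_mpoly: "poly_vars (map_mpoly h p) \<subseteq> poly_vars p"
proof -
  have "Poly_Mapping.keys (map_mpoly h p) \<subseteq> Poly_Mapping.keys p"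
    using h(1) by (auto simp: in_keys_iff lookup_map_mpoly)
  then show ?thesis by (auto simp: poly_vars_def)
qed

end

lemma degree_bound:
  fixes g :: "nat \<Rightarrow> 'a::zero mpoly"
  shows "\<exists>d. \<forall>k<n. \<forall>m\<in>Poly_Mapping.keys (g k). \<forall>a. poly_mapping.lookup m a \<le> d"
proof -
  let ?S = "\<Union>k<n. \<Union>m\<in>Poly_Mapping.keys (g k). poly_mapping.lookup m ` Poly_Mapping.keys m"
  have "finite ?S" by auto
  then obtain d where d: "\<And>s. s \<in> ?S \<Longrightarrow> s \<le> d" by (meson finite_nat_set_iff_bounded_le)
  have "poly_mapping.lookup m a \<le> d" if "k < n" "m \<in> Poly_Mapping.keys (g k)" for k m a
  proof (cases "a \<in> Poly_Mapping.keys m")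
    case True
    then show ?thesis using that by (intro d) blast
  next
    case False
    then show ?thesis by (simp add: in_keys_iff)
  qed
  then show ?thesis by blast
qed

text \<open>The inverse of h followed by \<open>to_ac\<close> embeds the image of h into the
  algebraic closure, and \<open>odd_extension_descend\<close> extends this embedding to all of
  E.\<close>

lemma zero_in_odd_extension:
  fixes h :: "'a::field \<Rightarrow> nat \<Rightarrow> 'a"
  assumes ext: "odd_degree_extension (ring_of_type_algebra :: 'a ring) E h"
  shows "\<exists>\<tau> :: _ \<Rightarrow> 'a alg_closure. field.sub_hom E (carrier E) \<tau> \<and> (\<forall>a. \<tau> (h a) = to_ac a) \<and>
    (\<forall>S n g. (\<forall>i<n. g i \<in> mpolys (range to_ac) S) \<longrightarrow>
      type_subfield.iso_over_mpolys (\<tau> ` carrier E) S n g \<longrightarrow> type_subfield.iso_over_mpolys (range to_ac) S n g)"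
proof -
  let ?R = "ring_of_type_algebra :: 'a ring"
  have R: "carrier ?R = UNIV" "x \<otimes>\<^bsub>?R\<^esub> y = x * y" "x \<oplus>\<^bsub>?R\<^esub> y = x + y" "\<one>\<^bsub>?R\<^esub> = 1" for x y
    by (simp_all add: ring_of_type_algebra_def)
  obtain d where E: "field E" and hom: "h \<in> ring_hom ?R E" and d: "odd d" "ring.dimension E d (range h) (carrier E)"
    using ext unfolding odd_degree_extension_def R(1) by blast
  interpret E: field E by (rule E)
  have h: "h a \<in> carrier E" "h (a * b) = h a \<otimes>\<^bsub>E\<^esub> h b" "h (a + b) = h a \<oplus>\<^bsub>E\<^esub> h b" "h 1 = \<one>\<^bsub>E\<^esub>" for a b
    using ring_hom_closed[OF hom, of a] ring_hom_mult[OF hom, of a b] ring_hom_add[OF hom, of a b]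
      ring_hom_one[OF hom] unfolding R by auto
  have h0: "h 0 = \<zero>\<^bsub>E\<^esub>"
    using ring_hom_zero[OF hom ring_from_type_algebra E.ring_axioms] by (simp add: ring_of_type_algebra_def)
  have hneg: "\<ominus>\<^bsub>E\<^esub> h a = h (- a)" for a
    using h(3)[of "- a" a] h(1) by (intro E.minus_equality) (simp_all add: h0)
  have hinv: "h a \<otimes>\<^bsub>E\<^esub> h (inverse a) = \<one>\<^bsub>E\<^esub>" if "a \<noteq> 0" for a
    using h(2)[of a "inverse a"] h(4) that by simp
  have inj: "inj h"
  proof (rule injI)
    fix a b assume "h a = h b"
    then have z: "h (a - b) = \<zero>\<^bsub>E\<^esub>" using h(3)[of a "- b"] hneg[of b, symmetric] h(1)[of b] E.r_neg by simp
    show "a = b"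
    proof (rule ccontr)
      assume "a \<noteq> b"
      then have "\<zero>\<^bsub>E\<^esub> \<otimes>\<^bsub>E\<^esub> h (inverse (a - b)) = \<one>\<^bsub>E\<^esub>" using hinv[of "a - b"] z by simp
      then show False using h(1) by simp
    qed
  qed
  have K: "subfield (range h) E"
  proof (rule E.subfieldI')
    show "subring (range h) E"
    proof (rule E.subringI)
      show "\<one>\<^bsub>E\<^esub> \<in> range h" unfolding h(4)[symmetric] by simp
    qed (use h(1) hneg in \<open>auto simp flip: h(2,3)\<close>)
    fix k assume "k \<in> range h - {\<zero>\<^bsub>E\<^esub>}"
    then obtain a where a: "k = h a" "a \<noteq> 0" using h0 by auto
    have "h (inverse a) = inv\<^bsub>E\<^esub> k"
      unfolding a(1) using h(1) hinv[OF a(2)] by (intro E.inv_unique') (simp_all add: E.m_comm)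
    then show "inv\<^bsub>E\<^esub> k \<in> range h" by (metis rangeI)
  qed
  define \<phi> where "\<phi> = (\<lambda>y. to_ac (inv_into UNIV h y))"
  have \<phi>: "\<phi> (h a) = to_ac a" for a using inj by (simp add: \<phi>_def)
  have sub: "E.sub_hom (range h) \<phi>"
    unfolding E.sub_hom_def
  proof (intro conjI ballI)
    show "\<phi> \<one>\<^bsub>E\<^esub> = 1" unfolding h(4)[symmetric] \<phi> by simp
    fix x y assume "x \<in> range h" "y \<in> range h"
    then obtain a b where ab: "x = h a" "y = h b" by blast
    show "\<phi> (x \<oplus>\<^bsub>E\<^esub> y) = \<phi> x + \<phi> y" unfolding ab h(3)[symmetric] \<phi> by simp
    show "\<phi> (x \<otimes>\<^bsub>E\<^esub> y) = \<phi> x * \<phi> y" unfolding ab h(2)[symmetric] \<phi> by simp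
  qed
  have img: "\<phi> ` range h = range to_ac" unfolding image_image \<phi> ..
  have "odd ((E.dim over range h) (carrier E))" using E.dimI[OF K d(2)] d(1) by simp
  then obtain \<tau> where \<tau>: "E.sub_hom (carrier E) \<tau>" "\<forall>k\<in>range h. \<tau> k = \<phi> k"
    "\<forall>S n g. (\<forall>i<n. g i \<in> mpolys (\<phi> ` range h) S) \<longrightarrow>
      type_subfield.iso_over_mpolys (\<tau> ` carrier E) S n g \<longrightarrow> type_subfield.iso_over_mpolys (\<phi> ` range h) S n g"
    using E.odd_extension_descend[OF K sub E.finite_dimensionI[OF d(2)]] by blast
  show ?thesis
  proof (intro exI conjI)
    show "E.sub_hom (carrier E) \<tau>" by (rule \<tau>(1))
    show "\<forall>a. \<tau> (h a) = to_ac a" using \<tau>(2) \<phi> by simp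
    show "\<forall>S n g. (\<forall>i<n. g i \<in> mpolys (range to_ac) S) \<longrightarrow>
      type_subfield.iso_over_mpolys (\<tau> ` carrier E) S n g \<longrightarrow> type_subfield.iso_over_mpolys (range to_ac) S n g"
      using \<tau>(3) unfolding img .
  qed
qed

lemma to_ac_hom: "to_ac 0 = 0" "to_ac 1 = 1" "to_ac (x + y) = to_ac x + to_ac y" "to_ac (x * y) = to_ac x * to_ac y"
  by simp_all

text \<open>All coefficients of a zero lie in the image of the injective map \<open>to_ac\<close>
  and can be pulled back one by one.\<close>

lemma iso_over_mpolys_of_to_ac:
  fixes g :: "nat \<Rightarrow> 'a::field mpoly"
  assumes "type_subfield.iso_over_mpolys (range to_ac) S n (\<lambda>k. map_mpoly to_ac (g k))"
  shows "type_subfield.iso_over_mpolys UNIV S n g"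
proof -
  interpret U: type_subfield "UNIV :: 'a set" by (rule type_subfield_UNIV)
  interpret T: type_subfield "range (to_ac :: 'a \<Rightarrow> _)"
  proof
    show "1 \<in> range (to_ac :: 'a \<Rightarrow> _)" unfolding to_ac_1[symmetric] by (rule rangeI)
    fix x y assume "x \<in> range (to_ac :: 'a \<Rightarrow> _)" "y \<in> range (to_ac :: 'a \<Rightarrow> _)"
    then obtain a b where ab: "x = to_ac (a :: 'a)" "y = to_ac b" by blast
    show "x - y \<in> range to_ac" unfolding ab to_ac_diff[symmetric] by (rule rangeI)
    show "x / y \<in> range to_ac" unfolding ab to_ac_divide[symmetric] by (rule rangeI)
  qed
  obtain c where c: "\<forall>i<n. c i \<in> mpolys (range to_ac) S" "\<exists>i<n. c i \<noteq> 0" "(\<Sum>i<n. map_mpoly to_ac (g i) * (c i)\<^sup>2) = 0"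
    using assms unfolding T.iso_over_mpolys_def by blast
  define w where "w = (\<lambda>i. \<Sum>m\<in>Poly_Mapping.keys (c i). Poly_Mapping.single m (inv_into UNIV to_ac (poly_mapping.lookup (c i) m)) :: 'a mpoly)"
  have jw: "map_mpoly to_ac (w i) = c i" if "i < n" for i
  proof -
    have "to_ac (inv_into UNIV to_ac (poly_mapping.lookup (c i) m)) = poly_mapping.lookup (c i) m" for m
      using c(1) that by (intro f_inv_into_f) (auto simp: mpolys_def)
    then show ?thesis
      unfolding w_def map_mpoly_sum[where h = to_ac, OF to_ac_hom] map_mpoly_single[where h = to_ac, OF to_ac_hom]
      by (simp add: mpoly_sum_single[symmetric])
  qed
  have wS: "w i \<in> mpolys UNIV S" if "i < n" for i
    unfolding w_def using c(1) that
    by (intro U.mpolys_sum U.mpolys_single) (auto simp: mpolys_def poly_vars_def)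
  have "map_mpoly to_ac (\<Sum>i<n. g i * (w i)\<^sup>2) = (\<Sum>i<n. map_mpoly to_ac (g i) * (c i)\<^sup>2)"
    unfolding map_mpoly_sum[where h = to_ac, OF to_ac_hom]
    by (intro sum.cong) (simp_all add: power2_eq_square map_mpoly_hom[where h = to_ac, OF to_ac_hom] jw)
  then have z: "map_mpoly to_ac (\<Sum>i<n. g i * (w i)\<^sup>2) = 0" using c(3) by simp
  have "(\<Sum>i<n. g i * (w i)\<^sup>2) = 0"
  proof (rule poly_mapping_eqI)
    fix m
    have "to_ac (poly_mapping.lookup (\<Sum>i<n. g i * (w i)\<^sup>2) m) = to_ac 0"
      unfolding lookup_map_mpoly[where h = to_ac, OF to_ac_hom, symmetric] z by simp
    then show "poly_mapping.lookup (\<Sum>i<n. g i * (w i)\<^sup>2) m = poly_mapping.lookup 0 m"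
      using inj_to_ac by (simp add: inj_def)
  qed
  moreover obtain i where "i < n" "c i \<noteq> 0" using c(2) by blast
  moreover have "w i \<noteq> 0"
  proof
    assume "w i = 0"
    then have "c i = 0" using jw[OF \<open>i < n\<close>] by (simp add: map_mpoly_hom(1)[where h = to_ac, OF to_ac_hom])
    with \<open>c i \<noteq> 0\<close> show False ..
  qed
  ultimately show ?thesis using wS unfolding U.iso_over_mpolys_def by blast
qed

text \<open>
  The coefficients of the value of the form at polynomials of degree at most \<open>M\<close> in each variable are quadratic forms
  in the coefficients of these polynomials. For large \<open>M\<close>, there are enough unknowns to apply property \<open>\<A>\<^sub>i(2)\<close>.
\<close>

lemma iso_over_mpolys_of_A2:
  fixes g :: "nat \<Rightarrow> 'a::field mpoly"
  assumes A2: "property_A2 i (ring_of_type_algebra :: 'a ring)"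
    and g: "\<And>k. k < n \<Longrightarrow> g k \<in> mpolys UNIV {1..r}" and n: "2 ^ (i + r) < n"
  shows "type_subfield.iso_over_mpolys UNIV {1..r} n g"
proof -
  let ?R = "ring_of_type_algebra :: 'a ring"
  obtain d where d: "\<forall>k<n. \<forall>m\<in>Poly_Mapping.keys (g k). \<forall>a. poly_mapping.lookup m a \<le> d"
    using degree_bound by blast
  \<comment> \<open>With exponents at most M in the coordinates, those of the value are at most 2M +
    d. The left side is 2^i times the number of equations, the right side the number of
    unknowns.\<close>
  obtain M where M: "(2 * M + d + 1) ^ r * 2 ^ i < n * (M + 1) ^ r" using many_unknowns[OF n] by blast
  let ?B = "exponents r M" and ?T = "exponents r (2 * M + d)"
  let ?V = "{..<n} \<times> ?B"
  have cV: "card ?V = n * (M + 1) ^ r" by (simp add: card_cartesian_product card_exponents)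
  obtain \<beta> where \<beta>: "bij_betw \<beta> {..<card ?V} ?V"
    using ex_bij_betw_nat_finite[of ?V] finite_exponents[of r M] by (auto simp: lessThan_atLeast0)
  obtain \<gamma> where \<gamma>: "bij_betw \<gamma> {..<card ?T} ?T"
    using ex_bij_betw_nat_finite[OF finite_exponents] by (auto simp: lessThan_atLeast0)
  \<comment> \<open>The unknown indexed by (k, e) is the coefficient of the monomial e in the k-th
    coordinate. Unknowns of different coordinates do not interact, because the form is
    diagonal.\<close>
  define C where "C = (\<lambda>t p q. if fst p = fst q then
      poly_mapping.lookup (g (fst p) * Poly_Mapping.single (snd p + snd q) 1) t else 0)"
  define Q where "Q = (\<lambda>t. QForm (card ?V) (\<lambda>p q. C (\<gamma> t) (\<beta> p) (\<beta> q)))"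
  have C_sym: "C t p q = C t q p" for t p q by (simp add: C_def add.commute)
  have "1 \<le> card ?T" by (simp add: card_exponents)
  moreover have "card ?T * 2 ^ i < card ?V" using M by (simp add: cV card_exponents)
  moreover have "\<forall>t<card ?T. quadratic_form ?R (Q t) \<and> qdim (Q t) = card ?V"
    unfolding quadratic_form_def Q_def by (auto intro: C_sym simp: ring_of_type_algebra_def)
  ultimately obtain E h x where ext: "odd_degree_extension ?R E h"
    and x: "x \<in> vecs E (card ?V)" "x \<noteq> vec_zero E (card ?V)"
      "\<forall>t<card ?T. qeval E (base_change h (Q t)) x = \<zero>\<^bsub>E\<^esub>"
    using A2 unfolding property_A2_def by blast
  interpret E: field E using ext by (simp add: odd_degree_extension_def)
  obtain \<tau> :: "_ \<Rightarrow> 'a alg_closure" where \<tau>: "E.sub_hom (carrier E) \<tau>" "\<forall>a. \<tau> (h a) = to_ac a"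
    "\<forall>S n g. (\<forall>i<n. g i \<in> mpolys (range to_ac) S) \<longrightarrow>
      type_subfield.iso_over_mpolys (\<tau> ` carrier E) S n g \<longrightarrow> type_subfield.iso_over_mpolys (range to_ac) S n g"
    using zero_in_odd_extension[OF ext] by blast
  have hc: "h a \<in> carrier E" for a
    using ext ring_hom_closed[of h ?R E a] by (simp add: odd_degree_extension_def ring_of_type_algebra_def)
  have Esf: "subfield (carrier E) E" by (rule E.carrier_is_subfield)
  have \<tau>m: "\<tau> (a \<otimes>\<^bsub>E\<^esub> b) = \<tau> a * \<tau> b" if "a \<in> carrier E" "b \<in> carrier E" for a b
    using \<tau>(1) that unfolding E.sub_hom_def by blast
  interpret N: type_subfield "\<tau> ` carrier E" by (rule E.type_subfield_image[OF Esf \<tau>(1)])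
  define y where "y = (\<lambda>p. \<tau> (x (inv_into {..<card ?V} \<beta> p)))"
  have yb: "y (\<beta> p) = \<tau> (x p)" if "p < card ?V" for p
    using \<beta> that by (simp add: y_def bij_betw_def)
  have xc: "x p \<in> carrier E" if "p < card ?V" for p using vecs_D[OF x(1) that] .
  have yN: "y p \<in> \<tau> ` carrier E" if p: "p \<in> ?V" for p
  proof -
    have "inv_into {..<card ?V} \<beta> p < card ?V" using \<beta> p by (metis bij_betw_def inv_into_into lessThan_iff)
    then show ?thesis unfolding y_def using xc by blast
  qed
  define c where "c = (\<lambda>k. \<Sum>e\<in>?B. Poly_Mapping.single e (y (k, e)))"
  let ?G = "\<lambda>k. map_mpoly to_ac (g k)"
  have cN: "c k \<in> mpolys (\<tau> ` carrier E) {1..r}" if "k < n" for k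
    unfolding c_def using that yN by (intro N.mpolys_sum N.mpolys_single) (auto simp: exponents_def)
  have lc: "poly_mapping.lookup (c k) e = y (k, e)" if "e \<in> ?B" for k e
    using that finite_exponents[of r M] by (simp add: c_def lookup_sum lookup_single when_def)
  have nz: "\<exists>k<n. c k \<noteq> 0"
  proof (rule ccontr)
    assume "\<not> (\<exists>k<n. c k \<noteq> 0)"
    then have c0: "c k = 0" if "k < n" for k using that by blast
    have y0: "y p = 0" if p: "p \<in> ?V" for p
    proof -
      obtain k e where ke: "p = (k, e)" "k < n" "e \<in> ?B" using p by auto
      then show ?thesis using lc[OF ke(3), of k] c0[OF ke(2)] by simp
    qed
    have "x = vec_zero E (card ?V)"
    proof (rule vecs_eqI[OF x(1) E.vec_zero_closed])
      fix p assume p: "p < card ?V"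
      then have "\<beta> p \<in> ?V" using \<beta> by (auto dest: bij_betwE)
      then have "\<tau> (x p) = 0" using y0 yb[OF p] by simp
      then have "x p = \<zero>\<^bsub>E\<^esub>" using E.sub_hom_nonzero[OF Esf \<tau>(1)] xc[OF p] by blast
      then show "x p = vec_zero E (card ?V) p" using p by (simp add: vec_zero_def)
    qed
    then show False using x(2) by simp
  qed
  have tm: "poly_mapping.lookup (?G k * (c k)\<^sup>2) t =
      (\<Sum>e\<in>?B. \<Sum>e'\<in>?B. to_ac (poly_mapping.lookup (g k * Poly_Mapping.single (e + e') 1) t) * (y (k, e) * y (k, e')))" for k t
  proof -
    have "?G k * (c k)\<^sup>2 = (\<Sum>e\<in>?B. \<Sum>e'\<in>?B. cst (y (k, e) * y (k, e')) * map_mpoly to_ac (g k * Poly_Mapping.single (e + e') 1))"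
      unfolding power2_eq_square c_def sum_product unfolding sum_distrib_left
      by (intro sum.cong refl)
         (simp add: mult_single map_mpoly_hom[where h = to_ac, OF to_ac_hom]
           map_mpoly_single[where h = to_ac, OF to_ac_hom] cst_def mult.left_commute)
    note eq = this
    show ?thesis
      unfolding eq lookup_sum lookup_cst_mult lookup_map_mpoly[where h = to_ac, OF to_ac_hom]
      by (intro sum.cong refl mult.commute)
  qed
  have zero: "(\<Sum>k<n. ?G k * (c k)\<^sup>2) = 0"
  proof (rule poly_mapping_eqI)
    fix t
    have L: "poly_mapping.lookup (\<Sum>k<n. ?G k * (c k)\<^sup>2) t =
      (\<Sum>k<n. \<Sum>e\<in>?B. \<Sum>e'\<in>?B. to_ac (poly_mapping.lookup (g k * Poly_Mapping.single (e + e') 1) t) * (y (k, e) * y (k, e')))"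
      unfolding lookup_sum tm ..
    show "poly_mapping.lookup (\<Sum>k<n. ?G k * (c k)\<^sup>2) t = poly_mapping.lookup 0 t"
    proof (cases "t \<in> ?T")
      case False
      \<comment> \<open>The value has no monomials outside the box \<open>?T\<close>, so the
        equations for t in \<open>?T\<close> suffice.\<close>
      have "poly_mapping.lookup (g k * Poly_Mapping.single (e + e') 1) t = 0" if k: "k < n" and e: "e \<in> ?B" "e' \<in> ?B" for k e e'
      proof (rule ccontr)
        assume "poly_mapping.lookup (g k * Poly_Mapping.single (e + e') 1) t \<noteq> 0"
        then have "t \<in> Poly_Mapping.keys (g k * Poly_Mapping.single (e + e') (1 :: 'a))" by (simp add: in_keys_iff)
        then obtain m l where m: "t = m + l" "m \<in> Poly_Mapping.keys (g k)" "l \<in> Poly_Mapping.keys (Poly_Mapping.single (e + e') (1 :: 'a))"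
          using keys_mult[of "g k" "Poly_Mapping.single (e + e') 1"] by blast
        then have t: "t = m + (e + e')" by simp
        have km: "Poly_Mapping.keys m \<subseteq> {1..r}" using g[OF k] m(2) unfolding mpolys_def poly_vars_def by blast
        have kt: "Poly_Mapping.keys t \<subseteq> {1..r}" unfolding t keys_add_nat using km e by (simp add: exponents_def)
        have bt: "poly_mapping.lookup t a \<le> 2 * M + d" for a
        proof -
          have "poly_mapping.lookup m a \<le> d" using d k m(2) by blast
          moreover have "poly_mapping.lookup e a \<le> M" "poly_mapping.lookup e' a \<le> M" using e unfolding exponents_def by blast+
          ultimately show ?thesis unfolding t Poly_Mapping.lookup_add by simp
        qed
        have "t \<in> ?T" unfolding exponents_def using kt bt by blast
        with False show False by simp
      qed
      then show ?thesis unfolding L by (simp add: sum.neutral)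
    next
      case True
      \<comment> \<open>Inside the box, the coefficient at t is the image under \<tau> of the
        equation with index \<open>t'\<close>, which x satisfies.\<close>
      then have "t \<in> \<gamma> ` {..<card ?T}" using \<gamma> unfolding bij_betw_def by blast
      then obtain t' where t': "t' < card ?T" "\<gamma> t' = t" by blast
      let ?f = "\<lambda>p q. h (C t (\<beta> p) (\<beta> q)) \<otimes>\<^bsub>E\<^esub> (x p \<otimes>\<^bsub>E\<^esub> x q)"
      have fc: "?f p q \<in> carrier E" if "p < card ?V" "q < card ?V" for p q using hc xc that by simp
      have "\<zero>\<^bsub>E\<^esub> = (\<Oplus>\<^bsub>E\<^esub>p\<in>{..<card ?V}. \<Oplus>\<^bsub>E\<^esub>q\<in>{..<card ?V}. ?f p q)"
      proof -
        have "qeval E (base_change h (Q t')) x = \<zero>\<^bsub>E\<^esub>" using x(3) t'(1) by blast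
        then show ?thesis
          unfolding qeval_def qbilin_def base_change_def Q_def qform.sel t'(2) by (rule sym)
      qed
      then have "0 = \<tau> (\<Oplus>\<^bsub>E\<^esub>p\<in>{..<card ?V}. \<Oplus>\<^bsub>E\<^esub>q\<in>{..<card ?V}. ?f p q)"
        using E.sub_hom_zero[OF Esf \<tau>(1)] by simp
      also have "\<dots> = (\<Sum>p<card ?V. \<tau> (\<Oplus>\<^bsub>E\<^esub>q\<in>{..<card ?V}. ?f p q))"
        using E.sub_hom_finsum[OF Esf \<tau>(1), of "{..<card ?V}" "\<lambda>p. \<Oplus>\<^bsub>E\<^esub>q\<in>{..<card ?V}. ?f p q"] fc
        by (auto intro: E.finsum_closed)
      also have "\<dots> = (\<Sum>p<card ?V. \<Sum>q<card ?V. to_ac (C t (\<beta> p) (\<beta> q)) * (y (\<beta> p) * y (\<beta> q)))"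
      proof (rule sum.cong[OF refl])
        fix p assume p: "p \<in> {..<card ?V}"
        have "\<tau> (\<Oplus>\<^bsub>E\<^esub>q\<in>{..<card ?V}. ?f p q) = (\<Sum>q<card ?V. \<tau> (?f p q))"
          using E.sub_hom_finsum[OF Esf \<tau>(1), of "{..<card ?V}" "?f p"] fc p by auto
        also have "\<dots> = (\<Sum>q<card ?V. to_ac (C t (\<beta> p) (\<beta> q)) * (y (\<beta> p) * y (\<beta> q)))"
          using p xc hc by (intro sum.cong) (auto simp: \<tau>m \<tau>(2) yb)
        finally show "\<tau> (\<Oplus>\<^bsub>E\<^esub>q\<in>{..<card ?V}. ?f p q) = (\<Sum>q<card ?V. to_ac (C t (\<beta> p) (\<beta> q)) * (y (\<beta> p) * y (\<beta> q)))" .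
      qed
      also have "\<dots> = (\<Sum>p\<in>?V. \<Sum>q\<in>?V. to_ac (C t p q) * (y p * y q))"
        using sum.reindex_bij_betw[OF \<beta>, of "\<lambda>p. \<Sum>q\<in>?V. to_ac (C t p q) * (y p * y q)"]
          sum.reindex_bij_betw[OF \<beta>, of "\<lambda>q. to_ac (C t p q) * (y p * y q)" for p] by simp
      also have "\<dots> = (\<Sum>k<n. \<Sum>e\<in>?B. \<Sum>k'<n. \<Sum>e'\<in>?B. to_ac (C t (k, e) (k', e')) * (y (k, e) * y (k', e')))"
      proof -
        have cp: "(\<Sum>p\<in>?V. f p) = (\<Sum>k<n. \<Sum>e\<in>?B. f (k, e))" for f :: "_ \<Rightarrow> 'a alg_closure"
          by (simp add: sum.cartesian_product case_prod_beta)
        show ?thesis unfolding cp ..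
      qed
      also have "\<dots> = (\<Sum>k<n. \<Sum>e\<in>?B. \<Sum>e'\<in>?B. to_ac (poly_mapping.lookup (g k * Poly_Mapping.single (e + e') 1) t) * (y (k, e) * y (k, e')))"
      proof (intro sum.cong refl)
        fix k e assume "k \<in> {..<n}"
        have "(\<Sum>k'<n. \<Sum>e'\<in>?B. to_ac (C t (k, e) (k', e')) * (y (k, e) * y (k', e'))) =
            (\<Sum>k'\<in>{k}. \<Sum>e'\<in>?B. to_ac (C t (k, e) (k', e')) * (y (k, e) * y (k', e')))"
          using \<open>k \<in> {..<n}\<close> by (intro sum.mono_neutral_right) (auto simp: C_def)
        then show "(\<Sum>k'<n. \<Sum>e'\<in>?B. to_ac (C t (k, e) (k', e')) * (y (k, e) * y (k', e'))) =
            (\<Sum>e'\<in>?B. to_ac (poly_mapping.lookup (g k * Poly_Mapping.single (e + e') 1) t) * (y (k, e) * y (k, e')))"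
          by (simp add: C_def)
      qed
      finally show ?thesis unfolding L by simp
    qed
  qed
  have isoN: "N.iso_over_mpolys {1..r} n ?G"
    unfolding N.iso_over_mpolys_def using cN nz zero by blast
  have "type_subfield.iso_over_mpolys (range to_ac) {1..r} n ?G"
  proof (rule \<tau>(3)[rule_format, OF _ isoN])
    fix k assume "k < n"
    then have "poly_vars (?G k) \<subseteq> {1..r}"
      using g[of k] poly_vars_map_mpoly[where h = to_ac, OF to_ac_hom, of "g k"] by (auto simp: mpolys_def)
    then show "?G k \<in> mpolys (range to_ac) {1..r}"
      by (auto simp: mpolys_def lookup_map_mpoly[where h = to_ac, OF to_ac_hom])
  qed
  then show ?thesis by (rule iso_over_mpolys_of_to_ac)
qed

text \<open>If D is a common denominator and C_k = D us_k, then the entries D C_k are polynomials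
  and differ from us_k by the square D^2.\<close>

theorem isotropic_over_ratfuns:
  fixes us :: "'a::field mpoly fract list"
  assumes A2: "property_A2 i (ring_of_type_algebra :: 'a ring)"
    and us: "set us \<subseteq> ratfuns UNIV {1..r}" "2 ^ (i + r) < length us"
  shows "\<exists>c. (\<forall>i<length us. c i \<in> ratfuns UNIV {1..r}) \<and> (\<exists>i<length us. c i \<noteq> 0) \<and>
    (\<Sum>i<length us. us ! i * (c i)\<^sup>2) = 0"
proof -
  interpret U: type_subfield "UNIV :: 'a set" by (rule type_subfield_UNIV)
  interpret F: type_subfield "ratfuns (UNIV :: 'a set) {1..r}" by (rule U.type_subfield_ratfuns)
  let ?n = "length us"
  have "us ! k \<in> ratfuns UNIV {1..r}" if "k < ?n" for k using us(1) nth_mem[OF that] by blast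
  then obtain D C where DC: "D \<in> mpolys UNIV {1..r}" "D \<noteq> 0"
    "\<forall>k<?n. C k \<in> mpolys UNIV {1..r} \<and> to_fr (C k) = to_fr D * us ! k"
    using U.clear_denominators[of ?n "\<lambda>k. us ! k" "{1..r}"] by blast
  have "U.iso_over_mpolys {1..r} ?n (\<lambda>k. D * C k)"
    using DC by (intro iso_over_mpolys_of_A2[OF A2 _ us(2)]) simp
  then obtain c where c: "\<forall>k<?n. c k \<in> mpolys UNIV {1..r}" "\<exists>k<?n. c k \<noteq> 0" "(\<Sum>k<?n. D * C k * (c k)\<^sup>2) = 0"
    unfolding U.iso_over_mpolys_def by blast
  have D0: "to_fr D \<noteq> 0" using DC(2) by (simp only: to_fr_eq_0 not_False_eq_True)
  show ?thesis
  proof (intro exI[of _ "\<lambda>k. to_fr D * to_fr (c k)"] conjI allI impI)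
    show "to_fr D * to_fr (c k) \<in> ratfuns UNIV {1..r}" if "k < ?n" for k
      using c(1) that DC(1) by (intro F.mult_mem U.ratfuns_to_fr) auto
    obtain k where k: "k < ?n" "c k \<noteq> 0" using c(2) by blast
    then have "to_fr (c k) \<noteq> 0" by (simp only: to_fr_eq_0 not_False_eq_True)
    then show "\<exists>k<?n. to_fr D * to_fr (c k) \<noteq> 0" using k(1) D0 by (intro exI[of _ k]) (simp del: mult_fract)
    have "us ! k * (to_fr D * to_fr (c k))\<^sup>2 = to_fr (D * C k * (c k)\<^sup>2)" if "k < ?n" for k
    proof -
      have "to_fr (C k) = to_fr D * us ! k" using DC(3) that by blast
      then show ?thesis unfolding power2_eq_square to_fr_hom(4) by (simp only: ac_simps)
    qed
    then have "(\<Sum>k<?n. us ! k * (to_fr D * to_fr (c k))\<^sup>2) = to_fr (\<Sum>k<?n. D * C k * (c k)\<^sup>2)"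
      unfolding to_fr_sum by (intro sum.cong) auto
    then show "(\<Sum>k<?n. us ! k * (to_fr D * to_fr (c k))\<^sup>2) = 0" unfolding c(3) to_fr_hom(1) .
  qed
qed

section \<open>The forms violating the local-global principle\<close>

lemma finsum_type_ring:
  fixes f :: "'i \<Rightarrow> 'b::field"
  assumes "finite I"
  shows "finsum (ring_of_type_algebra :: 'b ring) f I = sum f I"
proof -
  interpret R: field "ring_of_type_algebra :: 'b ring" by (rule field_from_type_algebra)
  have c: "carrier (ring_of_type_algebra :: 'b ring) = UNIV" by (simp add: ring_of_type_algebra_def)
  show ?thesis using assms
    by (induction I rule: finite_induct) (simp_all add: c R.finsum_insert, simp_all add: ring_of_type_algebra_def)
qed

text \<open>Completing the square. Anisotropy makes the leading entry of the Gram matrix nonzero at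
  every stage. One direction is recorded: each value of the diagonal form is attained by the given
  one, at a nonzero vector if the coordinates are not all zero.\<close>

lemma diagonalization:
  fixes G :: "nat \<Rightarrow> nat \<Rightarrow> 'b::field"
  assumes "\<And>i j. i < n \<Longrightarrow> j < n \<Longrightarrow> G i j = G j i"
    and "\<And>x. (\<Sum>i<n. \<Sum>j<n. G i j * (x i * x j)) = 0 \<Longrightarrow> \<forall>i<n. x i = 0"
  shows "\<exists>us. length us = n \<and> (\<forall>cs. length cs = n \<longrightarrow>
    (\<exists>x. (\<Sum>i<n. \<Sum>j<n. G i j * (x i * x j)) = qval us cs \<and> ((\<forall>i<n. x i = 0) \<longrightarrow> set cs \<subseteq> {0})))"
  using assms
proof (induction n arbitrary: G)
  case 0
  show ?case by (intro exI[of _ "[]"]) auto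
next
  case (Suc n)
  note sym = Suc.prems(1) and an = Suc.prems(2)
  define a where "a = G 0 0"
  define s where "s = (\<lambda>y. \<Sum>j<n. G 0 (Suc j) * y j)"
  define Q where "Q = (\<lambda>y. \<Sum>i<n. \<Sum>j<n. G (Suc i) (Suc j) * (y i * y j))"
  define ext :: "'b \<Rightarrow> (nat \<Rightarrow> 'b) \<Rightarrow> nat \<Rightarrow> 'b"
    where "ext = (\<lambda>c y i. case i of 0 \<Rightarrow> c | Suc j \<Rightarrow> y j)"
  have full: "(\<Sum>i<Suc n. \<Sum>j<Suc n. G i j * (ext c y i * ext c y j)) = a * (c * c) + 2 * (c * s y) + Q y" for c y
  proof -
    have sl: "(\<Sum>j<n. G (Suc j) 0 * (y j * c)) = c * s y"
      unfolding s_def sum_distrib_left using sym by (intro sum.cong) (auto simp: algebra_simps)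
    have sr: "(\<Sum>j<n. G 0 (Suc j) * (c * y j)) = c * s y"
      unfolding s_def sum_distrib_left by (intro sum.cong) (auto simp: algebra_simps)
    have "(\<Sum>i<Suc n. \<Sum>j<Suc n. G i j * (ext c y i * ext c y j)) =
      a * (c * c) + (\<Sum>j<n. G 0 (Suc j) * (c * y j)) + ((\<Sum>j<n. G (Suc j) 0 * (y j * c)) + Q y)"
      unfolding sum.lessThan_Suc_shift by (simp add: ext_def a_def Q_def sum.distrib)
    then show ?thesis unfolding sl sr by (simp add: algebra_simps)
  qed
  have a0: "a \<noteq> 0"
  proof
    assume "a = 0"
    then have "(\<Sum>i<Suc n. \<Sum>j<Suc n. G i j * (ext 1 (\<lambda>_. 0) i * ext 1 (\<lambda>_. 0) j)) = 0"
      unfolding full by (simp add: s_def Q_def)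
    from an[OF this] have "ext 1 (\<lambda>_. 0) 0 = (0 :: 'b)" by blast
    then show False by (simp add: ext_def)
  qed
  \<comment> \<open>The Schur complement of the first entry, left after removing the square a(c + s
    y/a)^2.\<close>
  define G' where "G' = (\<lambda>i j. G (Suc i) (Suc j) - G 0 (Suc i) * G 0 (Suc j) / a)"
  have Q': "(\<Sum>i<n. \<Sum>j<n. G' i j * (y i * y j)) = Q y - s y * s y / a" for y
  proof -
    have "s y * s y / a = (\<Sum>i<n. \<Sum>j<n. G 0 (Suc i) * G 0 (Suc j) / a * (y i * y j))"
      unfolding s_def sum_product sum_divide_distrib by (intro sum.cong refl) simp
    then show ?thesis unfolding Q_def by (simp add: G'_def sum_subtractf[symmetric] left_diff_distrib)
  qed
  have val: "(\<Sum>i<Suc n. \<Sum>j<Suc n. G i j * (ext (c - s y / a) y i * ext (c - s y / a) y j)) =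
      a * c\<^sup>2 + (\<Sum>i<n. \<Sum>j<n. G' i j * (y i * y j))" for c y
    unfolding full Q' using a0 by (simp add: field_simps power2_eq_square)
  have "\<exists>us. length us = n \<and> (\<forall>cs. length cs = n \<longrightarrow>
    (\<exists>x. (\<Sum>i<n. \<Sum>j<n. G' i j * (x i * x j)) = qval us cs \<and> ((\<forall>i<n. x i = 0) \<longrightarrow> set cs \<subseteq> {0})))"
  proof (rule Suc.IH)
    show "G' i j = G' j i" if "i < n" "j < n" for i j using sym[of "Suc i" "Suc j"] that by (simp add: G'_def mult.commute)
    fix y assume "(\<Sum>i<n. \<Sum>j<n. G' i j * (y i * y j)) = 0"
    then have z: "(\<Sum>i<Suc n. \<Sum>j<Suc n. G i j * (ext (0 - s y / a) y i * ext (0 - s y / a) y j)) = 0"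
      unfolding val by simp
    have "y i = 0" if "i < n" for i
    proof -
      have "ext (0 - s y / a) y (Suc i) = 0" using an[OF z] that by blast
      then show ?thesis by (simp add: ext_def)
    qed
    then show "\<forall>i<n. y i = 0" by blast
  qed
  then obtain us where us: "length us = n" "\<And>cs. length cs = n \<Longrightarrow>
    \<exists>x. (\<Sum>i<n. \<Sum>j<n. G' i j * (x i * x j)) = qval us cs \<and> ((\<forall>i<n. x i = 0) \<longrightarrow> set cs \<subseteq> {0})" by blast
  have "\<exists>x. (\<Sum>i<Suc n. \<Sum>j<Suc n. G i j * (x i * x j)) = qval (a # us) ds \<and> ((\<forall>i<Suc n. x i = 0) \<longrightarrow> set ds \<subseteq> {0})"
    if ds: "length ds = Suc n" for ds
  proof -
    obtain c cs where c: "ds = c # cs" "length cs = n" using ds by (cases ds) auto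
    obtain y where y: "(\<Sum>i<n. \<Sum>j<n. G' i j * (y i * y j)) = qval us cs" "(\<forall>i<n. y i = 0) \<longrightarrow> set cs \<subseteq> {0}"
      using us(2)[OF c(2)] by blast
    let ?x = "ext (c - s y / a) y"
    have ds0: "set ds \<subseteq> {0}" if x0: "\<forall>i<Suc n. ?x i = 0"
    proof -
      have y0: "y i = 0" if "i < n" for i
      proof -
        have "?x (Suc i) = 0" using x0 that by blast
        then show ?thesis by (simp add: ext_def)
      qed
      then have "s y = 0" by (simp add: s_def)
      moreover have "?x 0 = 0" using x0 by blast
      ultimately have "c = 0" by (simp add: ext_def)
      then show ?thesis using y(2) y0 c(1) by simp
    qed
    show ?thesis
    proof (intro exI[of _ ?x] conjI impI)
      show "(\<Sum>i<Suc n. \<Sum>j<Suc n. G i j * (?x i * ?x j)) = qval (a # us) ds"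
        by (simp only: val c(1) qval_Cons y(1))
    qed (rule ds0)
  qed
  then show ?case using us(1) by (intro exI[of _ "a # us"]) simp
qed

text \<open>A finite supremum of a nonempty set of extended naturals is a maximum, so an anisotropic
  form of dimension N exists; it is then diagonalized.\<close>

lemma u_invariant_form:
  assumes "u_invariant (ring_of_type_algebra :: 'b::field ring) = enat N" "0 < N"
  shows "\<exists>us :: 'b list. length us = N \<and> aniso us"
proof -
  let ?R = "ring_of_type_algebra :: 'b ring"
  define S where "S = {enat (qdim q) |q. regular_form ?R q \<and> anisotropic ?R q}"
  have Sup: "Sup S = enat N" using assms(1) by (simp add: u_invariant_def S_def)
  have ne: "S \<noteq> {}"
  proof
    assume "S = {}"
    then show False using Sup assms(2) by (simp add: Sup_enat_def zero_enat_def)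
  qed
  have fin: "finite S"
  proof (rule ccontr)
    assume "\<not> finite S"
    then show False using Sup ne by (simp add: Sup_enat_def)
  qed
  have "enat N \<in> S" using Sup ne fin Max_in[OF fin ne] by (simp add: Sup_enat_def)
  then obtain q where q: "qdim q = N" "regular_form ?R q" "anisotropic ?R q" by (auto simp: S_def)
  have c: "carrier ?R = UNIV" "\<zero>\<^bsub>?R\<^esub> = 0" "a \<otimes>\<^bsub>?R\<^esub> b = a * b" for a b by (simp_all add: ring_of_type_algebra_def)
  have "\<forall>i<N. x i = 0" if "(\<Sum>i<N. \<Sum>j<N. gram q i j * (x i * x j)) = 0" for x
  proof -
    let ?x = "restrict x {..<N}"
    have "qeval ?R q ?x = (\<Sum>i<N. \<Sum>j<N. gram q i j * (?x i * ?x j))"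
      by (simp add: qeval_def qbilin_def finsum_type_ring q(1) c)
    also have "\<dots> = 0" using that by simp
    finally have "?x = vec_zero ?R N" using q(1,3) by (auto simp: anisotropic_def vecs_def c)
    then show ?thesis by (auto simp: vec_zero_def c fun_eq_iff restrict_def split: if_splits)
  qed
  moreover have "gram q i j = gram q j i" if "i < N" "j < N" for i j
    using q(1,2) that by (auto simp: regular_form_def quadratic_form_def)
  ultimately obtain us where us: "length us = N" "\<And>cs. length cs = N \<Longrightarrow>
    \<exists>x. (\<Sum>i<N. \<Sum>j<N. gram q i j * (x i * x j)) = qval us cs \<and> ((\<forall>i<N. x i = 0) \<longrightarrow> set cs \<subseteq> {0})"
    using diagonalization[of N "gram q"] by blast
  have "aniso us"
    unfolding aniso_def us(1)
  proof (intro allI impI)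
    fix cs :: "'b list" assume cs: "length cs = N" "qval us cs = 0"
    obtain x where x: "(\<Sum>i<N. \<Sum>j<N. gram q i j * (x i * x j)) = qval us cs" "(\<forall>i<N. x i = 0) \<longrightarrow> set cs \<subseteq> {0}"
      using us(2)[OF cs(1)] by blast
    then show "set cs \<subseteq> {0}" using cs(2) \<open>\<And>x. (\<Sum>i<N. \<Sum>j<N. gram q i j * (x i * x j)) = 0 \<Longrightarrow> \<forall>i<N. x i = 0\<close>[of x] by simp
  qed
  then show ?thesis using us(1) by blast
qed

lemma aniso_nonzero:
  fixes us :: "'b::idom list"
  assumes "aniso us" "u \<in> set us"
  shows "u \<noteq> 0"
proof
  assume u: "u = 0"
  obtain as bs where "us = as @ [u] @ bs" using split_list[OF assms(2)] by auto
  then have "aniso [u]" using aniso_sublist assms(1) by blast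
  moreover have "qval [u] [1] = 0" by (simp add: u)
  ultimately have "set [1 :: 'b] \<subseteq> {0}" unfolding aniso_def by (metis length_Cons list.size(3))
  then show False by simp
qed

text \<open>Connects the evaluation of forms over ring records with the list-based
  \<open>qval\<close>, for which anisotropy was proved.\<close>

lemma (in type_subfield) qeval_diagq:
  assumes "set us \<subseteq> A" "x \<in> vecs (subring_of A) (length us)"
  shows "qeval (subring_of A) (diagq (subring_of A) us) x = qval us (map x [0..<length us])"
  using assms
proof (induction us arbitrary: x)
  case Nil
  interpret F: field "subring_of A" by (rule field_subring_of)
  show ?case by (simp add: qeval_def qbilin_def)
next
  case (Cons u us)
  interpret F: field "subring_of A" by (rule field_subring_of)
  obtain c y where cy: "c \<in> A" "y \<in> vecs (subring_of A) (length us)" "x = vcons (length us) c y"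
    using Cons.prems(2) by (auto elim: vecs_SucE)
  have u: "u \<in> A" "set us \<subseteq> A" using Cons.prems(1) by auto
  have Q: "quadratic_form (subring_of A) (diagq (subring_of A) us)" using u(2) by (intro F.quadratic_form_diagq) simp
  have m: "map x [0..<length (u # us)] = c # map y [0..<length us]"
    by (rule nth_equalityI) (auto simp: cy(3) nth_Cons vcons_Suc simp del: upt_Suc split: nat.splits)
  have "qeval (subring_of A) (diagq (subring_of A) (u # us)) x = u * (c * c) + qeval (subring_of A) (diagq (subring_of A) us) y"
    using F.qeval_consq[of u "diagq (subring_of A) us" c y] Q u cy by simp
  then show ?case unfolding m qval_Cons using Cons.IH[OF u(2) cy(2)] by (simp add: power2_eq_square)
qed

lemma (in type_subfield) anisotropic_diagq:
  assumes "set us \<subseteq> A" "aniso us"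
  shows "anisotropic (subring_of A) (diagq (subring_of A) us)"
  unfolding anisotropic_def
proof (intro ballI impI)
  fix x assume x: "x \<in> vecs (subring_of A) (qdim (diagq (subring_of A) us))"
    "qeval (subring_of A) (diagq (subring_of A) us) x = \<zero>\<^bsub>subring_of A\<^esub>"
  then have "qval us (map x [0..<length us]) = 0" using qeval_diagq[OF assms(1)] by simp
  then have z: "set (map x [0..<length us]) \<subseteq> {0}"
    by (intro assms(2)[unfolded aniso_def, rule_format]) simp_all
  have "x i = 0" if "i < length us" for i using z that by (auto simp: image_subset_iff)
  then show "x = vec_zero (subring_of A) (qdim (diagq (subring_of A) us))"
    using x(1) by (intro vecs_eqI[OF x(1)]) (auto simp: vec_zero_def vecs_def zero_mem)
qed

lemma mset_concat_pairs:
  "mset (concat (map (\<lambda>(a, b). [a, b]) (map (\<lambda>c. (f c, g c)) F))) = mset (map f F) + mset (map g F)"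
  by (induction F) auto

section \<open>Local Witt indices of the form\<close>

context valued_subfield
begin

text \<open>st - 1 = (s - 1)(t - 1) + (s - 1) + (t - 1).\<close>

lemma vge_one_mult:
  assumes "s \<in> A" "t \<in> A" "vge 1 (s - 1)" "vge 1 (t - 1)"
  shows "vge 1 (s * t - 1)"
proof -
  have "vge (1 + 1) ((s - 1) * (t - 1))" using assms by (intro vge_mult) auto
  then have m: "vge 1 ((s - 1) * (t - 1))" by (rule vge_mono) simp
  have a: "vge 1 ((s - 1) + (t - 1))"
    by (rule vge_add[OF _ _ assms(3,4)]) (intro diff_mem one_mem assms)+
  have "vge 1 ((s - 1) * (t - 1) + ((s - 1) + (t - 1)))"
    by (rule vge_add[OF _ _ m a]) (intro mult_mem diff_mem add_mem one_mem assms)+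
  then show ?thesis by (simp add: algebra_simps)
qed

lemma units_mult: "a \<in> units \<Longrightarrow> b \<in> units \<Longrightarrow> a * b \<in> units"
  by (simp add: units_def val_mult)

lemma units_minus: "a \<in> units \<Longrightarrow> - a \<in> units"
  by (simp add: units_def)

text \<open>The elements \<xi> and \<zeta> stand for x and z. The bound in \<open>iso\<close> is the
  dimension of the full form, which has four blocks of length \<open>length F\<close>.\<close>

lemma LGP_form_witt_index:
  assumes \<xi>: "\<xi> \<in> units" and \<zeta>: "\<zeta> \<in> A" "\<zeta> \<noteq> 0" and F: "set F \<subseteq> units" and n: "n < length F"
    and us: "us = drop n F @ map ((*) (- \<zeta>)) F @ map ((*) (- \<xi>)) F @ map ((*) (\<xi> * (\<zeta> - 1) * (\<zeta> - \<xi>\<^sup>2))) F"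
      "set us \<subseteq> A - {0}"
    and nontriv: "\<exists>x\<in>A - {0}. v x \<noteq> 0"
    and iso: "\<And>us. set us \<subseteq> A - {0} \<Longrightarrow> 4 * length F < length us \<Longrightarrow>
      \<exists>c. (\<forall>i<length us. c i \<in> A) \<and> (\<exists>i<length us. c i \<noteq> 0) \<and> (\<Sum>i<length us. us ! i * (c i)\<^sup>2) = 0"
  shows "length F - n \<le> witt_index L (base_change emb (diagq K us))"
proof -
  let ?Y = "\<xi> * (\<zeta> - 1) * (\<zeta> - \<xi>\<^sup>2)"
  note XA = units_D[OF \<xi>]
  have FA: "c \<in> A" if "c \<in> set F" for c using F that units_D by blast
  \<comment> \<open>Minus the product of -\<xi> c and \<open>?Y * c\<close> is \<xi>^2 (\<zeta> -
    1)(\<zeta> - \<xi>^2) c^2. Both blocks are complete, so this case even gives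
    \<open>length F\<close> planes.\<close>
  have pairs1: ?thesis
    if sq: "\<exists>d\<in>A. \<exists>w\<in>A. \<xi>\<^sup>2 * ((\<zeta> - 1) * (\<zeta> - \<xi>\<^sup>2)) = d * d * w \<and> vge 1 (w - 1)"
  proof -
    let ?prs = "map (\<lambda>c. (- \<xi> * c, ?Y * c)) F"
    let ?cs = "drop n F @ map ((*) (- \<zeta>)) F"
    obtain d w where dw: "d \<in> A" "w \<in> A" "\<xi>\<^sup>2 * ((\<zeta> - 1) * (\<zeta> - \<xi>\<^sup>2)) = d * d * w" "vge 1 (w - 1)" using sq by blast
    have "length ?prs \<le> witt_index L (base_change emb (diagq K us))"
    proof (rule witt_index_pairs[OF _ us(2)])
      show "mset us = mset (concat (map (\<lambda>(a, b). [a, b]) ?prs) @ ?cs)"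
        unfolding mset_append mset_concat_pairs us(1) by (simp only: add.assoc add.commute add.left_commute list.map_ident)
      fix a b assume "(a, b) \<in> set ?prs"
      then obtain c where c: "c \<in> set F" "a = - \<xi> * c" "b = ?Y * c" by auto
      have "- (a * b) = \<xi>\<^sup>2 * ((\<zeta> - 1) * (\<zeta> - \<xi>\<^sup>2)) * (c * c)"
        unfolding c(2,3) by (simp add: power2_eq_square algebra_simps)
      also have "\<dots> = (d * c) * (d * c) * w" unfolding dw(3) by (simp add: algebra_simps)
      finally show "\<exists>d\<in>A. \<exists>w\<in>A. - (a * b) = d * d * w \<and> vge 1 (w - 1)"
        using dw FA[OF c(1)] by (intro bexI[of _ "d * c"] bexI[of _ w]) auto
    qed
    then show ?thesis by simp
  qed
  \<comment> \<open>Only the \<open>length F - n\<close> entries c left in the first block have a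
    partner -\<zeta> c; this is where n planes are lost.\<close>
  have pairs2: ?thesis
    if sq: "\<exists>d\<in>A. \<exists>w\<in>A. \<zeta> = d * d * w \<and> vge 1 (w - 1)"
  proof -
    let ?prs = "map (\<lambda>c. (c, - \<zeta> * c)) (drop n F)"
    let ?cs = "map ((*) (- \<zeta>)) (take n F) @ map ((*) (- \<xi>)) F @ map ((*) ?Y) F"
    obtain d w where dw: "d \<in> A" "w \<in> A" "\<zeta> = d * d * w" "vge 1 (w - 1)" using sq by blast
    have "length ?prs \<le> witt_index L (base_change emb (diagq K us))"
    proof (rule witt_index_pairs[OF _ us(2)])
      have "mset (map ((*) (- \<zeta>)) F) = mset (map ((*) (- \<zeta>)) (take n F)) + mset (map ((*) (- \<zeta>)) (drop n F))"
        unfolding mset_append[symmetric] map_append[symmetric] append_take_drop_id ..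
      then show "mset us = mset (concat (map (\<lambda>(a, b). [a, b]) ?prs) @ ?cs)"
        unfolding mset_append mset_concat_pairs us(1) by (simp only: add.assoc add.commute add.left_commute list.map_ident)
      fix a b assume "(a, b) \<in> set ?prs"
      then obtain c where c: "c \<in> set F" "a = c" "b = - \<zeta> * c" by (auto dest: in_set_dropD)
      have "- (a * b) = \<zeta> * (c * c)" unfolding c(2,3) by simp
      also have "\<dots> = (d * c) * (d * c) * w" by (subst dw(3)) (simp add: algebra_simps)
      finally show "\<exists>d\<in>A. \<exists>w\<in>A. - (a * b) = d * d * w \<and> vge 1 (w - 1)"
        using dw FA[OF c(1)] by (intro bexI[of _ "d * c"] bexI[of _ w]) auto
    qed
    then show ?thesis by simp
  qed
  have X2: "\<xi>\<^sup>2 \<in> units" unfolding power2_eq_square by (rule units_mult[OF \<xi> \<xi>])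
  note X2A = units_D[OF X2]
  consider "v \<zeta> > 0" | "v \<zeta> < 0" | "v \<zeta> = 0" "vge 1 (\<zeta> - 1)" | "v \<zeta> = 0" "vge 1 (\<zeta> - \<xi>\<^sup>2)"
    | "v \<zeta> = 0" "\<not> vge 1 (\<zeta> - 1)" "\<not> vge 1 (\<zeta> - \<xi>\<^sup>2)" by linarith
  then show ?thesis
  proof cases
    case 1
    \<comment> \<open>Since \<zeta> has positive value, the constant term \<xi>^2 is extracted from
      (\<zeta> - 1)(\<zeta> - \<xi>^2).\<close>
    let ?w = "(1 - \<zeta>) * (1 - \<zeta> / \<xi>\<^sup>2)"
    have "vge 1 \<zeta>" using 1 by (simp add: vge_def)
    moreover have "vge 1 (\<zeta> / \<xi>\<^sup>2)" using 1 \<zeta> X2A val_divide[of \<zeta> "\<xi>\<^sup>2"] by (simp add: vge_def)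
    ultimately have "vge 1 (?w - 1)"
      using \<zeta> X2A vge_minus[of \<zeta> 1] vge_minus[of "\<zeta> / \<xi>\<^sup>2" 1] by (intro vge_one_mult) auto
    moreover have "\<xi>\<^sup>2 * ((\<zeta> - 1) * (\<zeta> - \<xi>\<^sup>2)) = (\<xi> * \<xi>) * (\<xi> * \<xi>) * ?w"
      using XA(2) by (simp add: field_simps power2_eq_square)
    ultimately show ?thesis using \<zeta> XA X2A by (intro pairs1 bexI[of _ "\<xi> * \<xi>"] bexI[of _ ?w]) auto
  next
    case 2
    \<comment> \<open>At a pole of \<zeta>, the leading term \<zeta>^2 is extracted instead.\<close>
    let ?w = "(1 - 1 / \<zeta>) * (1 - \<xi>\<^sup>2 / \<zeta>)"
    have "vge 1 (1 / \<zeta>)" using 2 \<zeta> val_divide[of 1 \<zeta>] by (simp add: vge_def)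
    moreover have "vge 1 (\<xi>\<^sup>2 / \<zeta>)" using 2 \<zeta> X2A val_divide[of "\<xi>\<^sup>2" \<zeta>] by (simp add: vge_def)
    ultimately have "vge 1 (?w - 1)"
      using \<zeta> X2A vge_minus[of "1 / \<zeta>" 1] vge_minus[of "\<xi>\<^sup>2 / \<zeta>" 1] by (intro vge_one_mult) auto
    moreover have "\<xi>\<^sup>2 * ((\<zeta> - 1) * (\<zeta> - \<xi>\<^sup>2)) = (\<xi> * \<zeta>) * (\<xi> * \<zeta>) * ?w"
      using \<zeta>(2) by (simp add: field_simps power2_eq_square)
    ultimately show ?thesis using \<zeta> XA X2A by (intro pairs1 bexI[of _ "\<xi> * \<zeta>"] bexI[of _ ?w]) auto
  next
    case 3
    then show ?thesis using \<zeta> by (intro pairs2 bexI[of _ 1] bexI[of _ \<zeta>]) auto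
  next
    case 4
    have "vge (1 + - v (\<xi>\<^sup>2)) ((\<zeta> - \<xi>\<^sup>2) * inverse (\<xi>\<^sup>2))"
      using 4(2) \<zeta> X2A by (intro vge_mult) (auto simp: vge_def val_inverse)
    moreover have "(\<zeta> - \<xi>\<^sup>2) * inverse (\<xi>\<^sup>2) = \<zeta> / \<xi>\<^sup>2 - 1" using X2A(2) by (simp add: field_simps)
    ultimately have "vge 1 (\<zeta> / \<xi>\<^sup>2 - 1)" using X2A(3) by simp
    moreover have "\<zeta> = \<xi> * \<xi> * (\<zeta> / \<xi>\<^sup>2)" using XA(2) by (simp add: power2_eq_square)
    ultimately show ?thesis using \<zeta> XA X2A by (intro pairs2 bexI[of _ \<xi>] bexI[of _ "\<zeta> / \<xi>\<^sup>2"]) auto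
  next
    case 5
    have Zu: "\<zeta> \<in> units" using \<zeta> 5(1) by (simp add: units_def)
    have o: "1 \<in> units" by (simp add: units_def)
    have "vge 0 (\<zeta> - 1)" using Zu o unit_vge0 units_D by (intro vge_diff) auto
    then have Z1: "\<zeta> - 1 \<in> units" using 5(2) vge0_cases[of "\<zeta> - 1"] \<zeta> by auto
    have "vge 0 (\<zeta> - \<xi>\<^sup>2)" using Zu X2 unit_vge0 units_D by (intro vge_diff) auto
    then have ZX: "\<zeta> - \<xi>\<^sup>2 \<in> units" using 5(3) vge0_cases[of "\<zeta> - \<xi>\<^sup>2"] \<zeta> X2A by auto
    have Yu: "?Y \<in> units" using \<xi> Z1 ZX units_mult by blast
    have mu: "set (map ((*) a) F) \<subseteq> units" if "a \<in> units" for a using that F units_mult by auto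
    have "set us \<subseteq> units"
      unfolding us(1) set_append using mu[OF units_minus[OF Zu]] mu[OF units_minus[OF \<xi>]] mu[OF Yu] F
      by (intro Un_least) (auto dest: in_set_dropD)
    then show ?thesis
    proof (rule witt_index_units[OF nontriv, rotated])
      \<comment> \<open>With N = \<open>length F\<close>, this reads 2N + 2(N - n) < (4N - n) +
        2.\<close>
      show "2 * length F + 2 * (length F - n) < length us + 2" using n unfolding us(1) by simp
    qed (use iso in simp)
  qed
qed

end

section \<open>Assembly over the rational function field\<close>

lemma ratfun_field_eq: "ratfun_field r = subring_of (ratfuns UNIV {1..r})"
  unfolding ratfun_field_def subring_of_def ratfuns_def mpolys_def
  by (rule arg_cong[where f = "\<lambda>A. ring_of_type_algebra\<lparr>carrier := A\<rparr>"]) auto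

lemma to_fr_map: "map to_fr (map ((*) a) us) = map ((*) (to_fr a)) (map to_fr us)"
  by simp

lemma to_fr_minus: "to_fr (- x) = - to_fr x" "to_fr (x - y) = to_fr x - to_fr y" "to_fr (x\<^sup>2) = (to_fr x)\<^sup>2"
  by (simp_all add: power2_eq_square)

theorem theorem2p3:
  fixes i :: nat
  assumes "CHAR('a::field) \<noteq> 2"
    and "property_A2 i (ring_of_type_algebra :: 'a ring)"
    and "u_invariant (ring_of_type_algebra :: 'a ring) = enat (2 ^ i)"
  shows "\<forall>r\<ge>2. \<forall>n<2 ^ (i + r - 2). \<exists>q :: 'a mpoly fract qform.
    regular_form (ratfun_field r) q \<and> qdim q = 2 ^ (i + r) - n \<and>
    violates_LGP (ratfun_field r) (ratfun_valuations r) (2 ^ (i + r - 2) - n) 1 q"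
proof (intro allI impI)
  fix r n :: nat
  assume r: "2 \<le> r" and n: "n < 2 ^ (i + r - 2)"
  obtain \<phi> :: "'a list" where \<phi>: "length \<phi> = 2 ^ i" "aniso \<phi>" using u_invariant_form[OF assms(3)] by auto
  have two: "(2 :: 'a) \<noteq> 0"
  proof
    assume "(2 :: 'a) = 0"
    then have "of_nat 2 = (0 :: 'a)" by simp
    then have "CHAR('a) dvd 2" by (simp only: of_nat_eq_0_iff_char_dvd)
    then have "CHAR('a) = 1 \<or> CHAR('a) = 2" using two_is_prime_nat prime_nat_iff by blast
    then show False using assms(1) CHAR_not_1' by auto
  qed
  define F where "F = multi_double \<phi> (r - 2)"
  define x z where "x = (var (r - 1) :: 'a mpoly)" and "z = (var r :: 'a mpoly)"
  define y where "y = (z - 1) * (z - x\<^sup>2)"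
  have Flen: "length F = 2 ^ (i + r - 2)"
    using r by (simp add: F_def length_multi_double \<phi>(1) power_add[symmetric])
  have four: "(4 :: nat) * 2 ^ (i + r - 2) = 2 ^ (i + r)"
  proof -
    obtain s where "r = 2 + s" using le_Suc_ex[OF r] by blast
    then show ?thesis by (simp add: power_add)
  qed
  have Fv: "poly_vars p \<subseteq> {1..r - 2}" if "p \<in> set F" for p
    using that poly_vars_multi_double unfolding F_def by blast
  have anF: "aniso F" unfolding F_def by (rule aniso_multi_double[OF \<phi>(2)])
  define P where "P = (F @ map ((*) (- z)) F) @ map ((*) x) (map ((*) (- 1)) F @ map ((*) y) F)"
  have "r - 1 \<notin> poly_vars p \<and> r \<notin> poly_vars p" if "p \<in> set F" for p
  proof -
    have "r - 1 \<notin> {1..r - 2}" "r \<notin> {1..r - 2}" using r by auto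
    then show ?thesis using Fv[OF that] by blast
  qed
  then have anP: "aniso P" unfolding P_def x_def z_def y_def using r by (intro aniso_LGP_form anF) auto
  interpret U: type_subfield "UNIV :: 'a set" by (rule type_subfield_UNIV)
  \<comment> \<open>Keeps 1 from being rewritten to a successor in index sets such as
    \<open>{1..r - 1}\<close>.\<close>
  note One_nat_def [simp del]
  let ?A = "ratfuns (UNIV :: 'a set) {1..r}"
  let ?A' = "ratfuns (UNIV :: 'a set) {1..r - 1}"
  interpret T: type_subfield ?A by (rule U.type_subfield_ratfuns)
  let ?K = "subring_of ?A"
  interpret K: field ?K by (rule T.field_subring_of)
  have two': "(2 :: 'a mpoly fract) \<noteq> 0"
  proof -
    have e: "(2 :: 'a mpoly fract) = to_fr (cst 2)"
      using to_fr_hom(3)[of "cst 1" "cst (1 :: 'a)"] cst_hom(3)[of 1 "1 :: 'a"] by (simp add: cst_hom to_fr_hom(2) del: add_fract)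
    have "poly_mapping.lookup (cst (2 :: 'a)) 0 = 2" unfolding cst_def by (rule lookup_single_eq)
    then have "cst (2 :: 'a) \<noteq> 0" using two by auto
    then show ?thesis unfolding e by (simp only: to_fr_eq_0 not_False_eq_True)
  qed
  interpret K: field_not2 ?K by unfold_locales (use two' in simp)
  define f where "f = map to_fr F"
  define \<xi> \<zeta> where "\<xi> = to_fr x" and "\<zeta> = to_fr z"
  \<comment> \<open>All n dropped entries lie in the first block F, because n is less than its
    length.\<close>
  define us where "us = map to_fr (drop n P)"
  have us_eq: "us = drop n f @ map ((*) (- \<zeta>)) f @ map ((*) (- \<xi>)) f @ map ((*) (\<xi> * (\<zeta> - 1) * (\<zeta> - \<xi>\<^sup>2))) f"
  proof -
    have "drop n P = drop n F @ map ((*) (- z)) F @ map ((*) (- x)) F @ map ((*) (x * y)) F"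
      using n Flen by (simp add: P_def comp_def mult.assoc)
    moreover have "to_fr (- z) = - \<zeta>" "to_fr (- x) = - \<xi>" "to_fr (x * y) = \<xi> * (\<zeta> - 1) * (\<zeta> - \<xi>\<^sup>2)"
      unfolding \<xi>_def \<zeta>_def y_def by (simp_all only: to_fr_minus to_fr_hom mult.assoc)
    ultimately show ?thesis unfolding us_def f_def by (simp only: map_append to_fr_map drop_map)
  qed
  have "aniso (drop n P)" using aniso_sublist[of "take n P" "drop n P" "[]"] anP by simp
  then have anus: "aniso us" unfolding us_def by (rule aniso_fract)
  have mem: "x \<in> mpolys UNIV {1..r - 1}" "z \<in> mpolys UNIV {1..r}" "x \<in> mpolys UNIV {1..r}"
    unfolding x_def z_def using r by (intro U.mpolys_var; simp)+
  have Fm: "p \<in> mpolys UNIV {1..r - 1}" "p \<in> mpolys UNIV {1..r}" if "p \<in> set F" for p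
  proof -
    have "{1..r - 2} \<subseteq> {1..r - 1}" "{1..r - 2} \<subseteq> {1..r}" by auto
    then show "p \<in> mpolys UNIV {1..r - 1}" "p \<in> mpolys UNIV {1..r}"
      using Fv[OF that] unfolding mpolys_def by blast+
  qed
  have XZ: "\<xi> \<in> ?A'" "\<zeta> \<in> ?A" "\<xi> \<in> ?A" unfolding \<xi>_def \<zeta>_def using mem by simp_all
  have fA: "c \<in> ?A'" "c \<in> ?A" if c: "c \<in> set f" for c using c Fm by (auto simp: f_def)
  have usA: "set us \<subseteq> ?A"
  proof -
    have m: "set (map ((*) a) f) \<subseteq> ?A" if "a \<in> ?A" for a using T.mult_mem[OF that] fA(2) by auto
    have "set (drop n f) \<subseteq> ?A" using fA by (auto dest: in_set_dropD)
    then show ?thesis unfolding us_eq set_append using XZ by (intro Un_least m) simp_all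
  qed
  have us0: "set us \<subseteq> ?A - {0}" using usA aniso_nonzero[OF anus] by blast
  have len: "length us = 2 ^ (i + r) - n"
  proof -
    show ?thesis using n Flen four by (simp add: us_eq f_def)
  qed
  let ?q = "diagq ?K us"
  have reg: "regular_form ?K ?q" by (rule K.regular_form_diagq) (use us0 in simp)
  have "witt_index ?K ?q = 0"
    by (rule K.witt_index_anisotropic[OF reg T.anisotropic_diagq[OF usA anus]])
  moreover have "2 ^ (i + r - 2) - n \<le> witt_index (completion ?K v) (base_change (completion_embed ?K v) ?q)"
    if v: "v \<in> ratfun_valuations r" for v
  proof -
    have nv: "nontrivial_discrete_valuation ?K v" and tr: "trivial_on ?K v ?A'"
      using v unfolding ratfun_valuations_def ratfun_field_eq by auto
    \<comment> \<open>This makes 2, x and the entries of F units at v: they lie in the field of the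
      first r - 1 variables.\<close>
    have v0: "v c = 0" if "c \<in> ?A'" "c \<noteq> 0" for c using tr that by (auto simp: trivial_on_def)
    have two_mem: "(2 :: 'a mpoly fract) \<in> ?A'"
    proof -
      interpret T': type_subfield ?A' by (rule U.type_subfield_ratfuns)
      show ?thesis using T'.add_mem[OF T'.one_mem T'.one_mem] by simp
    qed
    interpret V: valued_subfield ?A v
      by unfold_locales (use nv two' v0[OF two_mem two'] in \<open>auto simp: nontrivial_discrete_valuation_def\<close>)
    have x0: "x \<noteq> 0" "z \<noteq> 0" by (simp_all add: x_def z_def var_nonzero)
    then have X0: "\<xi> \<noteq> 0" "\<zeta> \<noteq> 0" unfolding \<xi>_def \<zeta>_def by (simp_all only: to_fr_eq_0 not_False_eq_True)
    have f0: "c \<noteq> 0" if "c \<in> set f" for c using that aniso_nonzero[OF aniso_fract[OF anF]] unfolding f_def by blast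
    have "length f - n \<le> witt_index (completion ?K v) (base_change (completion_embed ?K v) ?q)"
    proof (rule V.LGP_form_witt_index[OF _ XZ(2) X0(2) _ _ us_eq us0])
      show "\<xi> \<in> V.units" using XZ X0 v0 by (simp add: V.units_def)
      show "set f \<subseteq> V.units" using fA f0 v0 by (auto simp: V.units_def)
      show "n < length f" using n Flen by (simp add: f_def)
      show "\<exists>x\<in>?A - {0}. v x \<noteq> 0" using nv by (auto simp: nontrivial_discrete_valuation_def)
      fix ws assume ws: "set ws \<subseteq> ?A - {0}" "4 * length f < length ws"
      have "4 * length f = 2 ^ (i + r)"
        using Flen four by (simp add: f_def)
      then show "\<exists>c. (\<forall>i<length ws. c i \<in> ?A) \<and> (\<exists>i<length ws. c i \<noteq> 0) \<and> (\<Sum>i<length ws. ws ! i * (c i)\<^sup>2) = 0"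
        using ws by (intro isotropic_over_ratfuns[OF assms(2)]) auto
    qed
    then show ?thesis using Flen by (simp add: f_def)
  qed
  ultimately show "\<exists>q :: 'a mpoly fract qform.
    regular_form (ratfun_field r) q \<and> qdim q = 2 ^ (i + r) - n \<and>
    violates_LGP (ratfun_field r) (ratfun_valuations r) (2 ^ (i + r - 2) - n) 1 q"
    unfolding ratfun_field_eq violates_LGP_def using reg len by (intro exI[of _ ?q]) simp
qed

end
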